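(* Let $G$ be a linear algebraic group over an algebraically closed field $K$ acting on a $K$-algebra $S$ by automorphisms. Let $R:=K[a_1,\dots,a_n]\subseteq S$ be a finitely generated subalgebra and assume that there exist $g_1,\dots,g_n\in K[G]\otimes R$ such that $\sigma^{-1}\cdot a_i=g_i(\sigma)$ for all $\sigma\in G$ and $i=1,\dots,n$. (a) Let $\widehat D:=(y_1-g_1,\dots,y_n-g_n)\subseteq K[G]\otimes S[y_1,\dots,y_n]$. Then the Derksen ideal is the elimination ideal \[ D_{a_1,\dots,a_n}=S[y_1,\dots,y_n]\cap\widehat D. \] (b) Let $f_1,\dots,f_s\in K[y_1,\dots,y_n]$ be polynomials and set $\widehat E:=\widehat D+(f_1,\dots,f_s)\subseteq K[G]\otimes S[y_1,\dots,y_n]$. If \[ R\cap\bigl(f_1(g_1,\dots,g_n),\dots,f_s(g_1,\dots,g_n)\bigr)\subseteq\sqrt{\{0\}}, \] where the ideal $\bigl(f_1(g_1,\dots,g_n),\dots,f_s(g_1,\dots,g_n)\bigr)$ is formed in $K[G]\otimes S$, then the elimination ideal $E:=S[y_1,\dots,y_n]\cap\widehat E$ is a tamely extended Derksen ideal with respect to $a_1,\dots,a_n$.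
   Context: Tensor products are over $K$. Rings are commutative with identity; algebra automorphisms fix $K$. $K[G]$ is the ring of regular functions on $G$; for $g\in K[G]\otimes R$ and $\sigma\in G$, $g(\sigma)\in R$ is the evaluation at $\sigma$. $G$ acts on $S[y_1,\dots,y_n]$ coefficient-wise, fixing the $y_i$. The Derksen ideal is $D_{a_1,\dots,a_n}:=\bigcap_{\sigma\in G}(y_1-\sigma\cdot a_1,\dots,y_n-\sigma\cdot a_n)\subseteq S[y_1,\dots,y_n]$. An extended Derksen ideal (with respect to $a_1,\dots,a_n$) is a proper $G$-stable ideal $E\subsetneqq S[y_1,\dots,y_n]$ containing $D_{a_1,\dots,a_n}$. It is called tamely extended if, with $I:=\{f(a_1,\dots,a_n)\mid f\in K[y_1,\dots,y_n]\cap E\}\subseteq R$, the intersection $\bigcap_{\sigma\in G}\sigma\cdot I$ is nilpotent. *)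

theory Defs
  imports
    "HOL-Computational_Algebra.Polynomial"
    "HOL-Library.Poly_Mapping"
    "HOL-Algebra.Module"
    "HOL-Algebra.QuotRing"
    "HOL-Algebra.Ideal_Product"
    "HOL-Algebra.Group_Action"
begin

section \<open>Algebras over a field\<close>

text \<open>
  The field \<open>K\<close>, the algebra \<open>S\<close> and the polynomial rings over them are types.  Tensor products
  of subalgebras and coordinate rings depend on terms, so they are records of HOL-Algebra.  The
  following function turns a type with a scalar multiplication into such a record.
\<close>

definition type_algebra :: "('k \<Rightarrow> 'a \<Rightarrow> 'a) \<Rightarrow> ('k, 'a::comm_ring_1) module" where
  "type_algebra scl =
     \<lparr>carrier = UNIV, mult = (*), one = 1, zero = 0, add = (+), smult = scl\<rparr>"

abbreviation base_field :: "('k, 'k::field) module" where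
  "base_field \<equiv> type_algebra (*)"

section \<open>Polynomials\<close>

text \<open>The polynomial ring over \<open>'c\<close> in variables indexed by \<open>'v\<close>.\<close>

type_synonym ('v, 'c) mpoly = "('v \<Rightarrow>\<^sub>0 nat) \<Rightarrow>\<^sub>0 'c"

definition mvar :: "'v \<Rightarrow> ('v, 'c::comm_ring_1) mpoly" where
  "mvar i = Poly_Mapping.single (Poly_Mapping.single i 1) 1"

definition mconst :: "'c \<Rightarrow> ('v, 'c::comm_ring_1) mpoly" where
  "mconst c = Poly_Mapping.single 0 c"

definition map_coeffs :: "('c \<Rightarrow> 'd) \<Rightarrow> ('v, 'c::comm_ring_1) mpoly \<Rightarrow> ('v, 'd::comm_ring_1) mpoly"
  where "map_coeffs h p = Poly_Mapping.map h p"

definition poly_algebra ::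
    "('k \<Rightarrow> 's \<Rightarrow> 's) \<Rightarrow> ('k, ('n, 's::comm_ring_1) mpoly) module" where
  "poly_algebra scl = type_algebra (\<lambda>c. map_coeffs (scl c))"

text \<open>The inclusion \<open>K[y\<^sub>1,\<dots>,y\<^sub>n] \<rightarrow> S[y\<^sub>1,\<dots>,y\<^sub>n]\<close>.\<close>

definition poly_embed ::
    "('k \<Rightarrow> 's \<Rightarrow> 's) \<Rightarrow> ('n, 'k::field) mpoly \<Rightarrow> ('n, 's::comm_ring_1) mpoly" where
  "poly_embed scl f = map_coeffs (\<lambda>c. scl c 1) f"

text \<open>The value \<open>f(x\<^sub>1,\<dots>,x\<^sub>n)\<close> of a polynomial over \<open>K\<close> at elements of a \<open>K\<close>-algebra \<open>A\<close>.\<close>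

definition poly_eval ::
    "('k::field, 'a) module \<Rightarrow> ('v::finite \<Rightarrow> 'a) \<Rightarrow> ('v, 'k) mpoly \<Rightarrow> 'a" where
  "poly_eval A x f =
     (\<Oplus>\<^bsub>A\<^esub>m\<in>Poly_Mapping.keys f. Poly_Mapping.lookup f m \<odot>\<^bsub>A\<^esub>
        (\<Otimes>\<^bsub>A\<^esub>i\<in>UNIV. x i [^]\<^bsub>A\<^esub> Poly_Mapping.lookup m i))"

text \<open>The subalgebra \<open>K[a\<^sub>1,\<dots>,a\<^sub>n]\<close> of \<open>A\<close>.\<close>

definition gen_subalgebra ::
    "('k::field, 'a) module \<Rightarrow> ('n::finite \<Rightarrow> 'a) \<Rightarrow> ('k, 'a) module" where
  "gen_subalgebra A a = A\<lparr>carrier := range (poly_eval A a)\<rparr>"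

section \<open>Tensor products of algebras\<close>

text \<open>
  The ring of formal integral combinations of pairs in \<open>A \<times> B\<close>, with multiplication extending
  \<open>(a, b) (a', b') = (a a', b b')\<close> biadditively.
\<close>

definition formal_tensors ::
    "('k, 'a) module \<Rightarrow> ('k, 'b) module \<Rightarrow> (('a \<times> 'b) \<Rightarrow>\<^sub>0 int) ring" where
  "formal_tensors A B =
     \<lparr>carrier = {u. Poly_Mapping.keys u \<subseteq> carrier A \<times> carrier B},
      mult = (\<lambda>u v. frag_extend (\<lambda>p. frag_extend (\<lambda>q.
                frag_of (fst p \<otimes>\<^bsub>A\<^esub> fst q, snd p \<otimes>\<^bsub>B\<^esub> snd q)) v) u),
      one = frag_of (\<one>\<^bsub>A\<^esub>, \<one>\<^bsub>B\<^esub>),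
      zero = 0,
      add = (+)\<rparr>"

definition tensor_relations ::
    "('k, 'k) module \<Rightarrow> ('k, 'a) module \<Rightarrow> ('k, 'b) module \<Rightarrow> (('a \<times> 'b) \<Rightarrow>\<^sub>0 int) set" where
  "tensor_relations K A B =
     {frag_of (a \<oplus>\<^bsub>A\<^esub> a', b) - frag_of (a, b) - frag_of (a', b) | a a' b.
        a \<in> carrier A \<and> a' \<in> carrier A \<and> b \<in> carrier B} \<union>
     {frag_of (a, b \<oplus>\<^bsub>B\<^esub> b') - frag_of (a, b) - frag_of (a, b') | a b b'.
        a \<in> carrier A \<and> b \<in> carrier B \<and> b' \<in> carrier B} \<union>
     {frag_of (c \<odot>\<^bsub>A\<^esub> a, b) - frag_of (a, c \<odot>\<^bsub>B\<^esub> b) | c a b.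
        c \<in> carrier K \<and> a \<in> carrier A \<and> b \<in> carrier B}"

text \<open>
  The additive group generated by the relations is stable under multiplication by pairs, so the
  ideal they generate is the usual group of relations of the tensor product of modules.
\<close>

definition tensor_ideal ::
    "('k, 'k) module \<Rightarrow> ('k, 'a) module \<Rightarrow> ('k, 'b) module \<Rightarrow> (('a \<times> 'b) \<Rightarrow>\<^sub>0 int) set" where
  "tensor_ideal K A B = Idl\<^bsub>formal_tensors A B\<^esub> (tensor_relations K A B)"

definition pure_tensor ::
    "('k, 'k) module \<Rightarrow> ('k, 'a) module \<Rightarrow> ('k, 'b) module \<Rightarrow> 'a \<Rightarrow> 'b \<Rightarrow> (('a \<times> 'b) \<Rightarrow>\<^sub>0 int) set"
  where "pure_tensor K A B a b = tensor_ideal K A B +>\<^bsub>formal_tensors A B\<^esub> frag_of (a, b)"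

definition tensor_product ::
    "('k, 'k) module \<Rightarrow> ('k, 'a) module \<Rightarrow> ('k, 'b) module \<Rightarrow> ('k, (('a \<times> 'b) \<Rightarrow>\<^sub>0 int) set) module"
  where
  "tensor_product K A B =
     (let Q = formal_tensors A B Quot tensor_ideal K A B in
      \<lparr>carrier = carrier Q, mult = mult Q, one = one Q, zero = zero Q, add = add Q,
       smult = (\<lambda>c t. pure_tensor K A B (c \<odot>\<^bsub>A\<^esub> \<one>\<^bsub>A\<^esub>) \<one>\<^bsub>B\<^esub> \<otimes>\<^bsub>Q\<^esub> t)\<rparr>)"

text \<open>
  The additive map out of a tensor product induced by a balanced biadditive map \<open>\<beta>\<close> into \<open>T\<close>,
  sending \<open>a \<otimes> b\<close> to \<open>\<beta> a b\<close>.  For such \<open>\<beta>\<close> the image of a coset has exactly one element.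
\<close>

definition tensor_lift ::
    "('k, 't) module \<Rightarrow> ('a \<Rightarrow> 'b \<Rightarrow> 't) \<Rightarrow> (('a \<times> 'b) \<Rightarrow>\<^sub>0 int) set \<Rightarrow> 't" where
  "tensor_lift T \<beta> t =
     the_elem ((\<lambda>u. \<Oplus>\<^bsub>T\<^esub>p\<in>Poly_Mapping.keys u.
       add_pow T (Poly_Mapping.lookup u p) (\<beta> (fst p) (snd p))) ` t)"

section \<open>Linear algebraic groups\<close>

definition zariski_closed :: "('v::finite \<Rightarrow> 'k::field) set \<Rightarrow> bool" where
  "zariski_closed X \<longleftrightarrow> (\<exists>F. X = {x. \<forall>f\<in>F. poly_eval base_field x f = 0})"

definition regular_on :: "('v::finite \<Rightarrow> 'k::field) set \<Rightarrow> (('v \<Rightarrow> 'k) \<Rightarrow> 'k) \<Rightarrow> bool" where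
  "regular_on X h \<longleftrightarrow> (\<exists>f. \<forall>x\<in>X. h x = poly_eval base_field x f)"

text \<open>
  An affine variety with a group structure whose multiplication and inversion are morphisms.  The
  product variety is the set of points of affine space with coordinates in \<open>'m + 'm\<close> whose two
  halves lie in the group.
\<close>

definition linear_algebraic_group :: "('m::finite \<Rightarrow> 'k::field) monoid \<Rightarrow> bool" where
  "linear_algebraic_group G \<longleftrightarrow>
     group G \<and> zariski_closed (carrier G) \<and>
     (\<forall>j. regular_on {z :: 'm + 'm \<Rightarrow> 'k. z \<circ> Inl \<in> carrier G \<and> z \<circ> Inr \<in> carrier G}
            (\<lambda>z. ((z \<circ> Inl) \<otimes>\<^bsub>G\<^esub> (z \<circ> Inr)) j)) \<and>
     (\<forall>j. regular_on (carrier G) (\<lambda>\<sigma>. (inv\<^bsub>G\<^esub> \<sigma>) j))"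

text \<open>The ring \<open>K[X]\<close>; its elements are functions on \<open>X\<close>, hence extensional.\<close>

definition coordinate_ring ::
    "('v::finite \<Rightarrow> 'k::field) set \<Rightarrow> ('k, ('v \<Rightarrow> 'k) \<Rightarrow> 'k) module" where
  "coordinate_ring X =
     \<lparr>carrier = {h \<in> extensional X. regular_on X h},
      mult = (\<lambda>h h'. \<lambda>x\<in>X. h x * h' x),
      one = (\<lambda>x\<in>X. 1),
      zero = (\<lambda>x\<in>X. 0),
      add = (\<lambda>h h'. \<lambda>x\<in>X. h x + h' x),
      smult = (\<lambda>c h. \<lambda>x\<in>X. c * h x)\<rparr>"

definition acts_by_automorphisms ::
    "('m \<Rightarrow> 'k::field) monoid \<Rightarrow> ('k \<Rightarrow> 's \<Rightarrow> 's::comm_ring_1) \<Rightarrow> (('m \<Rightarrow> 'k) \<Rightarrow> 's \<Rightarrow> 's) \<Rightarrow> bool"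
  where
  "acts_by_automorphisms G scl act \<longleftrightarrow>
     group_action G UNIV act \<and>
     (\<forall>\<sigma>\<in>carrier G. act \<sigma> \<in> ring_hom (type_algebra scl) (type_algebra scl) \<and>
        (\<forall>c x. act \<sigma> (scl c x) = scl c (act \<sigma> x)))"

section \<open>Derksen ideals\<close>

definition derksen_ideal ::
    "('m \<Rightarrow> 'k::field) monoid \<Rightarrow> ('k \<Rightarrow> 's \<Rightarrow> 's) \<Rightarrow> (('m \<Rightarrow> 'k) \<Rightarrow> 's \<Rightarrow> 's) \<Rightarrow> ('n \<Rightarrow> 's::comm_ring_1)
      \<Rightarrow> ('n, 's) mpoly set" where
  "derksen_ideal G scl act a =
     (\<Inter>\<sigma>\<in>carrier G. Idl\<^bsub>poly_algebra scl\<^esub> (range (\<lambda>i. mvar i - mconst (act \<sigma> (a i)))))"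

definition extended_derksen_ideal ::
    "('m \<Rightarrow> 'k::field) monoid \<Rightarrow> ('k \<Rightarrow> 's \<Rightarrow> 's) \<Rightarrow> (('m \<Rightarrow> 'k) \<Rightarrow> 's \<Rightarrow> 's) \<Rightarrow> ('n \<Rightarrow> 's::comm_ring_1)
      \<Rightarrow> ('n, 's) mpoly set \<Rightarrow> bool" where
  "extended_derksen_ideal G scl act a E \<longleftrightarrow>
     ideal E (poly_algebra scl) \<and> E \<noteq> UNIV \<and>
     (\<forall>\<sigma>\<in>carrier G. map_coeffs (act \<sigma>) ` E \<subseteq> E) \<and>
     derksen_ideal G scl act a \<subseteq> E"

definition nilpotent_ideal :: "('k, 'a) module \<Rightarrow> 'a set \<Rightarrow> bool" where
  "nilpotent_ideal A I \<longleftrightarrow> (\<exists>k::nat. I [^]\<^bsub>ideals_set A\<^esub> k = {\<zero>\<^bsub>A\<^esub>})"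

definition tamely_extended_derksen_ideal ::
    "('m \<Rightarrow> 'k::field) monoid \<Rightarrow> ('k \<Rightarrow> 's \<Rightarrow> 's) \<Rightarrow> (('m \<Rightarrow> 'k) \<Rightarrow> 's \<Rightarrow> 's)
      \<Rightarrow> ('n::finite \<Rightarrow> 's::comm_ring_1) \<Rightarrow> ('n, 's) mpoly set \<Rightarrow> bool" where
  "tamely_extended_derksen_ideal G scl act a E \<longleftrightarrow>
     extended_derksen_ideal G scl act a E \<and>
     (let I = {poly_eval (type_algebra scl) a f | f. poly_embed scl f \<in> E} in
      nilpotent_ideal (gen_subalgebra (type_algebra scl) a) (\<Inter>\<sigma>\<in>carrier G. act \<sigma> ` I))"

section \<open>Tensor products with the coordinate ring of the group\<close>

text \<open>The algebra \<open>K[G] \<otimes> B\<close> and its element \<open>h \<otimes> b\<close>.\<close>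

definition coord_tensor ::
    "('m::finite \<Rightarrow> 'k::field) monoid \<Rightarrow> ('k, 'b) module
      \<Rightarrow> ('k, ((('m \<Rightarrow> 'k) \<Rightarrow> 'k) \<times> 'b \<Rightarrow>\<^sub>0 int) set) module" where
  "coord_tensor G B = tensor_product base_field (coordinate_ring (carrier G)) B"

definition coord_pure ::
    "('m::finite \<Rightarrow> 'k::field) monoid \<Rightarrow> ('k, 'b) module \<Rightarrow> (('m \<Rightarrow> 'k) \<Rightarrow> 'k) \<Rightarrow> 'b
      \<Rightarrow> ((('m \<Rightarrow> 'k) \<Rightarrow> 'k) \<times> 'b \<Rightarrow>\<^sub>0 int) set" where
  "coord_pure G B h b = pure_tensor base_field (coordinate_ring (carrier G)) B h b"

text \<open>The canonical map \<open>B \<rightarrow> K[G] \<otimes> B\<close>; it is the implicit inclusion in intersections \<open>B \<inter> J\<close>.\<close>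

definition coord_incl ::
    "('m::finite \<Rightarrow> 'k::field) monoid \<Rightarrow> ('k, 'b) module \<Rightarrow> 'b
      \<Rightarrow> ((('m \<Rightarrow> 'k) \<Rightarrow> 'k) \<times> 'b \<Rightarrow>\<^sub>0 int) set" where
  "coord_incl G B b = coord_pure G B \<one>\<^bsub>coordinate_ring (carrier G)\<^esub> b"

text \<open>The map \<open>id \<otimes> \<psi>\<close> into \<open>K[G] \<otimes> C\<close> induced by a homomorphism \<open>\<psi>\<close> into \<open>C\<close>.\<close>

definition coord_map ::
    "('m::finite \<Rightarrow> 'k::field) monoid \<Rightarrow> ('k, 'c) module \<Rightarrow> ('b \<Rightarrow> 'c)
      \<Rightarrow> ((('m \<Rightarrow> 'k) \<Rightarrow> 'k) \<times> 'b \<Rightarrow>\<^sub>0 int) set \<Rightarrow> ((('m \<Rightarrow> 'k) \<Rightarrow> 'k) \<times> 'c \<Rightarrow>\<^sub>0 int) set" where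
  "coord_map G C \<psi> t = tensor_lift (coord_tensor G C) (\<lambda>h b. coord_pure G C h (\<psi> b)) t"

text \<open>The value \<open>t(\<sigma>)\<close> in \<open>B\<close> of \<open>t\<close> in \<open>K[G] \<otimes> B\<close>.\<close>

definition coord_eval ::
    "('k::field, 'b) module \<Rightarrow> ('m \<Rightarrow> 'k) \<Rightarrow> ((('m \<Rightarrow> 'k) \<Rightarrow> 'k) \<times> 'b \<Rightarrow>\<^sub>0 int) set \<Rightarrow> 'b" where
  "coord_eval B \<sigma> t = tensor_lift B (\<lambda>h b. h \<sigma> \<odot>\<^bsub>B\<^esub> b) t"

text \<open>
  In the following definitions the \<open>g i\<close> are elements of \<open>K[G] \<otimes> R\<close>; they enter
  \<open>K[G] \<otimes> S[y\<^sub>1,\<dots>,y\<^sub>n]\<close> and \<open>K[G] \<otimes> S\<close> through the maps induced by \<open>R \<rightarrow> S[y\<^sub>1,\<dots>,y\<^sub>n]\<close>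
  and \<open>R \<rightarrow> S\<close>.
\<close>

definition derksen_hat ::
    "('m::finite \<Rightarrow> 'k::field) monoid \<Rightarrow> ('k \<Rightarrow> 's \<Rightarrow> 's)
      \<Rightarrow> ('n \<Rightarrow> ((('m \<Rightarrow> 'k) \<Rightarrow> 'k) \<times> 's::comm_ring_1 \<Rightarrow>\<^sub>0 int) set)
      \<Rightarrow> ((('m \<Rightarrow> 'k) \<Rightarrow> 'k) \<times> ('n, 's) mpoly \<Rightarrow>\<^sub>0 int) set set" where
  "derksen_hat G scl g =
     (let P = poly_algebra scl; T = coord_tensor G P in
      Idl\<^bsub>T\<^esub> (range (\<lambda>i. coord_incl G P (mvar i) \<ominus>\<^bsub>T\<^esub> coord_map G P mconst (g i))))"

definition extended_hat ::
    "('m::finite \<Rightarrow> 'k::field) monoid \<Rightarrow> ('k \<Rightarrow> 's \<Rightarrow> 's)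
      \<Rightarrow> ('n \<Rightarrow> ((('m \<Rightarrow> 'k) \<Rightarrow> 'k) \<times> 's::comm_ring_1 \<Rightarrow>\<^sub>0 int) set) \<Rightarrow> ('n, 'k) mpoly list
      \<Rightarrow> ((('m \<Rightarrow> 'k) \<Rightarrow> 'k) \<times> ('n, 's) mpoly \<Rightarrow>\<^sub>0 int) set set" where
  "extended_hat G scl g fs =
     (let P = poly_algebra scl; T = coord_tensor G P in
      derksen_hat G scl g <+>\<^bsub>T\<^esub> Idl\<^bsub>T\<^esub> ((\<lambda>f. coord_incl G P (poly_embed scl f)) ` set fs))"

definition elimination_ideal ::
    "('m::finite \<Rightarrow> 'k::field) monoid \<Rightarrow> ('k \<Rightarrow> 's \<Rightarrow> 's)
      \<Rightarrow> ((('m \<Rightarrow> 'k) \<Rightarrow> 'k) \<times> ('n, 's::comm_ring_1) mpoly \<Rightarrow>\<^sub>0 int) set set \<Rightarrow> ('n, 's) mpoly set"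
  where "elimination_ideal G scl J = {p. coord_incl G (poly_algebra scl) p \<in> J}"

text \<open>The ideal \<open>(f\<^sub>1(g\<^sub>1,\<dots>,g\<^sub>n),\<dots>,f\<^sub>s(g\<^sub>1,\<dots>,g\<^sub>n))\<close> of \<open>K[G] \<otimes> S\<close>.\<close>

definition substituted_ideal ::
    "('m::finite \<Rightarrow> 'k::field) monoid \<Rightarrow> ('k \<Rightarrow> 's \<Rightarrow> 's)
      \<Rightarrow> ('n::finite \<Rightarrow> ((('m \<Rightarrow> 'k) \<Rightarrow> 'k) \<times> 's::comm_ring_1 \<Rightarrow>\<^sub>0 int) set) \<Rightarrow> ('n, 'k) mpoly list
      \<Rightarrow> ((('m \<Rightarrow> 'k) \<Rightarrow> 'k) \<times> 's \<Rightarrow>\<^sub>0 int) set set" where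
  "substituted_ideal G scl g fs =
     (let S = type_algebra scl; T = coord_tensor G S in
      Idl\<^bsub>T\<^esub> (poly_eval T (\<lambda>i. coord_map G S id (g i)) ` set fs))"

end

theory Submission
  imports Defs
begin

text \<open>
  Everything rests on one fact about \<open>T = K[G] \<otimes> S\<close>: an element \<open>t\<close> is determined by its values
  \<open>t(\<sigma>) \<in> S\<close> (\<open>tensor_eqI\<close>).  If \<open>\<Sum> h\<^sub>i \<otimes> b\<^sub>i\<close> has only zero values and \<open>h\<^sub>1(\<sigma>) \<noteq> 0\<close>, then the value at \<open>\<sigma>\<close>
  expresses \<open>b\<^sub>1\<close> as a linear combination of the other \<open>b\<^sub>i\<close>, so the tensor is a shorter sum.
  Identities and homomorphisms into \<open>T\<close> can therefore be checked and constructed pointwise on \<open>G\<close>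
  (\<open>hom_from_values\<close>).

  Put \<open>b\<^sub>\<sigma> = (\<sigma>\<^sup>-\<^sup>1 a\<^sub>1, \<dots>, \<sigma>\<^sup>-\<^sup>1 a\<^sub>n)\<close>.  Substituting \<open>g\<^sub>i\<close> for \<open>y\<^sub>i\<close> is a homomorphism \<open>\<rho>\<close> from
  \<open>K[G] \<otimes> S[y]\<close> to \<open>T\<close>, left inverse to the inclusion \<open>\<kappa>\<close> of \<open>T\<close>; on values it is evaluation at \<open>b\<^sub>\<sigma>\<close>.
  Since each element \<open>z\<close> is congruent to \<open>\<kappa> (\<rho> z)\<close> modulo the \<open>y\<^sub>i - g\<^sub>i\<close>, the kernel of \<open>\<rho>\<close> is the
  ideal generated by them.  A polynomial \<open>p\<close> over \<open>S\<close> hence lies in the elimination ideal of the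
  first part iff \<open>p(b\<^sub>\<sigma>) = 0\<close> for all \<open>\<sigma>\<close>, and that is membership in every ideal
  \<open>(y\<^sub>1 - \<sigma> a\<^sub>1, \<dots>, y\<^sub>n - \<sigma> a\<^sub>n)\<close>, as \<open>\<sigma>\<close> and its inverse range over the same set.

  For the second part let \<open>J\<close> be the ideal of \<open>T\<close> generated by the \<open>f\<^sub>j(g\<^sub>1, \<dots>, g\<^sub>n)\<close>.  Then \<open>p \<in> E\<close> iff
  \<open>\<rho>(p) \<in> J\<close> (\<open>E_iff\<close>).  So \<open>E\<close> is an ideal containing the Derksen ideal, and it is proper because
  \<open>1 \<in> J\<close> would make \<open>1\<close> nilpotent.  It is stable under \<open>\<tau> \<in> G\<close> because the automorphism of \<open>T\<close> that
  sends \<open>t\<close> to the function with value \<open>\<tau> t(\<sigma>\<tau>)\<close> at \<open>\<sigma>\<close> fixes each \<open>f\<^sub>j(g)\<close>, whose coefficients lie in \<open>K\<close>,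
  and carries \<open>\<rho>(p)\<close> to \<open>\<rho>(\<tau> p)\<close>.

  Tameness is where the algebraic closedness of \<open>K\<close> enters.  Let \<open>r\<close> lie in \<open>\<sigma> I\<close> for every \<open>\<sigma>\<close>, and let
  \<open>Q\<close> be the preimage of \<open>J\<close> in the polynomial ring in the coordinates of \<open>G\<close> and the variables
  \<open>y\<^sub>1, \<dots>, y\<^sub>n\<close>, where \<open>y\<^sub>i\<close> is sent to \<open>a\<^sub>i\<close>.  A zero of \<open>Q\<close> consists of a point \<open>\<sigma>\<close> of \<open>G\<close> and a point \<open>\<eta>\<close>
  satisfying all relations between the \<open>a\<^sub>i\<close>.  From \<open>r \<in> \<sigma>\<^sup>-\<^sup>1 I\<close> it follows that \<open>r\<close>, written as a
  polynomial in the \<open>a\<^sub>i\<close>, vanishes at \<open>\<eta>\<close>.  By the Nullstellensatz a power of \<open>r\<close> lies in \<open>J\<close>, hence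
  \<open>r\<close> is nilpotent by hypothesis.  Thus the intersection of the \<open>\<sigma> I\<close> is a nil ideal of the ring
  \<open>K[a\<^sub>1, \<dots>, a\<^sub>n]\<close>, which is Noetherian by the Hilbert basis theorem, and a finitely generated nil
  ideal is nilpotent.

  The Nullstellensatz is proved by extending homomorphisms into \<open>K\<close> along the adjunction of one
  element at a time (\<open>extend_point\<close>).  Quotients by a prime \<open>P\<close> are avoided by working with
  congruences modulo \<open>P\<close> inside a fixed ring.
\<close>


section \<open>Subrings and ideals of a type\<close>

definition subring_set :: "'a::comm_ring_1 set \<Rightarrow> bool" where
  "subring_set B \<longleftrightarrow> 1 \<in> B \<and> (\<forall>x\<in>B. \<forall>y\<in>B. x - y \<in> B \<and> x * y \<in> B)"

text \<open>
  Subrings vary in the induction steps below while the ambient type stays fixed, so ideals are taken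
  relative to a subring given as a set.
\<close>

definition ideal_in :: "'a::comm_ring_1 set \<Rightarrow> 'a set \<Rightarrow> bool" where
  "ideal_in B I \<longleftrightarrow> I \<subseteq> B \<and> 0 \<in> I \<and> (\<forall>x\<in>I. \<forall>y\<in>I. x + y \<in> I) \<and> (\<forall>b\<in>B. \<forall>x\<in>I. b * x \<in> I)"

lemma subring_set_closed:
  assumes "subring_set B"
  shows "0 \<in> B" "1 \<in> B" "x \<in> B \<Longrightarrow> - x \<in> B" "x \<in> B \<Longrightarrow> y \<in> B \<Longrightarrow> x + y \<in> B"
    "x \<in> B \<Longrightarrow> y \<in> B \<Longrightarrow> x - y \<in> B" "x \<in> B \<Longrightarrow> y \<in> B \<Longrightarrow> x * y \<in> B" "x \<in> B \<Longrightarrow> x ^ n \<in> B"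
proof -
  show one: "1 \<in> B" and diff: "\<And>x y. x \<in> B \<Longrightarrow> y \<in> B \<Longrightarrow> x - y \<in> B"
    and mult: "\<And>x y. x \<in> B \<Longrightarrow> y \<in> B \<Longrightarrow> x * y \<in> B"
    using assms by (auto simp: subring_set_def)
  show zero: "0 \<in> B" using diff[OF one one] by simp
  show neg: "\<And>x. x \<in> B \<Longrightarrow> - x \<in> B" using diff[OF zero] by simp
  show "\<And>x y. x \<in> B \<Longrightarrow> y \<in> B \<Longrightarrow> x + y \<in> B" using diff[OF _ neg] by fastforce
  show "x \<in> B \<Longrightarrow> x ^ n \<in> B" by (induction n) (auto intro: one mult)
qed

lemma subring_set_sum: "subring_set B \<Longrightarrow> (\<And>i. i \<in> A \<Longrightarrow> f i \<in> B) \<Longrightarrow> sum f A \<in> B"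
  by (induction A rule: infinite_finite_induct) (auto intro: subring_set_closed)

lemma subring_set_prod: "subring_set B \<Longrightarrow> (\<And>i. i \<in> A \<Longrightarrow> f i \<in> B) \<Longrightarrow> prod f A \<in> B"
  by (induction A rule: infinite_finite_induct) (auto intro: subring_set_closed)

lemma subring_set_UNIV: "subring_set UNIV"
  by (simp add: subring_set_def)

lemma ideal_inD:
  assumes "ideal_in B I"
  shows "I \<subseteq> B" "0 \<in> I" "x \<in> I \<Longrightarrow> y \<in> I \<Longrightarrow> x + y \<in> I" "b \<in> B \<Longrightarrow> x \<in> I \<Longrightarrow> b * x \<in> I"
    "b \<in> B \<Longrightarrow> x \<in> I \<Longrightarrow> x * b \<in> I"
  using assms by (auto simp: ideal_in_def mult.commute)

lemma ideal_in_minus: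
  assumes "subring_set B" "ideal_in B I" "x \<in> I"
  shows "- x \<in> I"
proof -
  have "(-1) * x \<in> I"
    using assms by (intro ideal_inD(4)[OF assms(2)]) (auto intro: subring_set_closed)
  then show ?thesis by simp
qed

lemma ideal_in_diff:
  assumes "subring_set B" "ideal_in B I" "x \<in> I" "y \<in> I"
  shows "x - y \<in> I"
  using ideal_inD(3)[OF assms(2,3) ideal_in_minus[OF assms(1,2,4)]] by simp

lemma ideal_in_sum: "ideal_in B I \<Longrightarrow> (\<And>i. i \<in> A \<Longrightarrow> f i \<in> I) \<Longrightarrow> sum f A \<in> I"
  by (induction A rule: infinite_finite_induct) (auto intro: ideal_inD)

section \<open>Adjoining elements to a subring\<close>

definition polys :: "'a::comm_ring_1 set \<Rightarrow> 'a poly set" where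
  "polys B = {p. \<forall>i. coeff p i \<in> B}"

definition adjoin :: "'a::comm_ring_1 set \<Rightarrow> 'a \<Rightarrow> 'a set" where
  "adjoin B x = (\<lambda>p. poly p x) ` polys B"

primrec adjoin_list :: "'a::comm_ring_1 set \<Rightarrow> 'a list \<Rightarrow> 'a set" where
  "adjoin_list B [] = B"
| "adjoin_list B (x # xs) = adjoin (adjoin_list B xs) x"

lemma polysD: "p \<in> polys B \<Longrightarrow> coeff p i \<in> B"
  by (simp add: polys_def)

lemma subring_polys:
  assumes "subring_set B"
  shows "subring_set (polys B)"
  using subring_set_closed[OF assms]
  by (auto simp: subring_set_def polys_def coeff_mult intro!: subring_set_sum[OF assms])

lemma const_polys: "subring_set B \<Longrightarrow> b \<in> B \<Longrightarrow> [:b:] \<in> polys B"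
  by (auto simp: polys_def coeff_pCons subring_set_closed split: nat.split)

lemma monom_polys: "subring_set B \<Longrightarrow> b \<in> B \<Longrightarrow> monom b n \<in> polys B"
  by (auto simp: polys_def subring_set_closed)

lemma smult_polys: "subring_set B \<Longrightarrow> b \<in> B \<Longrightarrow> p \<in> polys B \<Longrightarrow> Polynomial.smult b p \<in> polys B"
  by (auto simp: polys_def subring_set_closed)

lemma subring_image:
  assumes "subring_set B" "f 1 = 1" "\<And>x y. f (x - y) = f x - f y" "\<And>x y. f (x * y) = f x * f y"
  shows "subring_set (f ` B)"
  using assms(1) image_eqI[of 1 f 1 B] unfolding subring_set_def
  by (auto simp: assms(2) simp flip: assms(3,4))

lemma subring_adjoin: "subring_set B \<Longrightarrow> subring_set (adjoin B x)"
  unfolding adjoin_def by (intro subring_image subring_polys) auto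

lemma subset_adjoin: "subring_set B \<Longrightarrow> B \<subseteq> adjoin B x"
  unfolding adjoin_def by (force intro: const_polys)

lemma gen_in_adjoin: "subring_set B \<Longrightarrow> x \<in> adjoin B x"
  unfolding adjoin_def
  by (rule image_eqI[of _ _ "monom 1 1"]) (auto intro: monom_polys subring_set_closed simp: poly_monom)

lemma subring_adjoin_list: "subring_set B \<Longrightarrow> subring_set (adjoin_list B xs)"
  by (induction xs) (auto intro: subring_adjoin)

lemma subset_adjoin_list: "subring_set B \<Longrightarrow> B \<subseteq> adjoin_list B xs"
  by (induction xs) (auto dest: subset_adjoin[OF subring_adjoin_list])

lemma gens_in_adjoin_list: "subring_set B \<Longrightarrow> set xs \<subseteq> adjoin_list B xs"
  by (induction xs)
    (auto intro: gen_in_adjoin subring_adjoin_list dest: subset_adjoin[OF subring_adjoin_list])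

lemma adjoin_list_least:
  assumes "subring_set C" "B \<subseteq> C" "set xs \<subseteq> C"
  shows "adjoin_list B xs \<subseteq> C"
  using assms(3)
proof (induction xs)
  case (Cons x xs)
  then have "adjoin_list B xs \<subseteq> C" "x \<in> C" by auto
  then show ?case
    by (auto simp: adjoin_def polys_def poly_altdef
        intro!: subring_set_sum[OF assms(1)] subring_set_closed[OF assms(1)])
qed (use assms in auto)

section \<open>Extending points to generated rings\<close>

definition prime_set :: "'a::comm_ring_1 set \<Rightarrow> bool" where
  "prime_set P \<longleftrightarrow> ideal_in UNIV P \<and> 1 \<notin> P \<and> (\<forall>x y. x * y \<in> P \<longrightarrow> x \<in> P \<or> y \<in> P)"

text \<open>
  A \<open>K\<close>-valued point of \<open>B / (B \<inter> P)\<close>, given as a function on the ambient type of which only the values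
  on \<open>B\<close> matter.
\<close>

definition point_on :: "'c::comm_ring_1 set \<Rightarrow> 'c set \<Rightarrow> ('c \<Rightarrow> 'k::field) \<Rightarrow> bool" where
  "point_on B P \<phi> \<longleftrightarrow> \<phi> 1 = 1 \<and>
     (\<forall>x\<in>B. \<forall>y\<in>B. \<phi> (x + y) = \<phi> x + \<phi> y \<and> \<phi> (x * y) = \<phi> x * \<phi> y) \<and> (\<forall>x\<in>B \<inter> P. \<phi> x = 0)"

lemma prime_setD:
  assumes "prime_set P"
  shows "ideal_in UNIV P" "1 \<notin> P" "x * y \<in> P \<Longrightarrow> x \<in> P \<or> y \<in> P" "0 \<in> P"
    "x \<in> P \<Longrightarrow> y \<in> P \<Longrightarrow> x + y \<in> P" "x \<in> P \<Longrightarrow> y \<in> P \<Longrightarrow> x - y \<in> P"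
    "x \<in> P \<Longrightarrow> y * x \<in> P" "x \<in> P \<Longrightarrow> x * y \<in> P" "x ^ n \<in> P \<Longrightarrow> x \<in> P"
proof -
  show id: "ideal_in UNIV P" and one: "1 \<notin> P" and pr: "\<And>x y. x * y \<in> P \<Longrightarrow> x \<in> P \<or> y \<in> P"
    using assms by (auto simp: prime_set_def)
  show "0 \<in> P" "x \<in> P \<Longrightarrow> y \<in> P \<Longrightarrow> x + y \<in> P" "x \<in> P \<Longrightarrow> y \<in> P \<Longrightarrow> x - y \<in> P"
    "x \<in> P \<Longrightarrow> y * x \<in> P" "x \<in> P \<Longrightarrow> x * y \<in> P"
    using ideal_inD[OF id] ideal_in_diff[OF subring_set_UNIV id] by auto
  show "x ^ n \<in> P \<Longrightarrow> x \<in> P" by (induction n) (use one pr in auto)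
qed

lemma point_onD:
  assumes "point_on B P \<phi>"
  shows "\<phi> 1 = 1" "x \<in> B \<Longrightarrow> y \<in> B \<Longrightarrow> \<phi> (x + y) = \<phi> x + \<phi> y"
    "x \<in> B \<Longrightarrow> y \<in> B \<Longrightarrow> \<phi> (x * y) = \<phi> x * \<phi> y" "x \<in> B \<Longrightarrow> x \<in> P \<Longrightarrow> \<phi> x = 0"
  using assms by (auto simp: point_on_def)

lemma point_on_sum:
  assumes "point_on B P \<phi>" "subring_set B" "0 \<in> P" "\<And>i. i \<in> A \<Longrightarrow> f i \<in> B"
  shows "\<phi> (sum f A) = (\<Sum>i\<in>A. \<phi> (f i))"
  using assms(4)
proof (induction A rule: infinite_finite_induct)
  case (insert i A)
  then show ?case
    by (simp add: point_onD(2)[OF assms(1)] subring_set_sum[OF assms(2)])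
qed (use point_onD(4)[OF assms(1) subring_set_closed(1)[OF assms(2)] assms(3)] in auto)

lemma point_on_power:
  assumes "point_on B P \<phi>" "subring_set B" "x \<in> B"
  shows "\<phi> (x ^ n) = \<phi> x ^ n"
  by (induction n) (use assms in \<open>auto simp: point_onD subring_set_closed\<close>)

lemma map_poly_point:
  assumes \<phi>: "point_on B P \<phi>" and B: "subring_set B" and P0: "0 \<in> P"
  shows "p \<in> polys B \<Longrightarrow> q \<in> polys B \<Longrightarrow> map_poly \<phi> (p + q) = map_poly \<phi> p + map_poly \<phi> q"
    and "p \<in> polys B \<Longrightarrow> q \<in> polys B \<Longrightarrow> map_poly \<phi> (p * q) = map_poly \<phi> p * map_poly \<phi> q"
    and "\<phi> 0 = 0" and "map_poly \<phi> 1 = 1"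
    and "b \<in> B \<Longrightarrow> p \<in> polys B \<Longrightarrow>
      map_poly \<phi> (Polynomial.smult b p) = Polynomial.smult (\<phi> b) (map_poly \<phi> p)"
proof -
  show z: "\<phi> 0 = 0" by (rule point_onD(4)[OF \<phi> subring_set_closed(1)[OF B] P0])
  show "map_poly \<phi> 1 = 1" using z point_onD(1)[OF \<phi>] by simp
  show "p \<in> polys B \<Longrightarrow> q \<in> polys B \<Longrightarrow> map_poly \<phi> (p + q) = map_poly \<phi> p + map_poly \<phi> q"
    by (intro poly_eqI) (auto simp: coeff_map_poly z polys_def point_onD(2)[OF \<phi>])
  show "b \<in> B \<Longrightarrow> p \<in> polys B \<Longrightarrow>
      map_poly \<phi> (Polynomial.smult b p) = Polynomial.smult (\<phi> b) (map_poly \<phi> p)"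
    by (intro poly_eqI) (auto simp: coeff_map_poly z polys_def point_onD(3)[OF \<phi>])
  show "p \<in> polys B \<Longrightarrow> q \<in> polys B \<Longrightarrow> map_poly \<phi> (p * q) = map_poly \<phi> p * map_poly \<phi> q"
    by (intro poly_eqI)
      (auto simp: coeff_map_poly z polys_def coeff_mult point_onD(3)[OF \<phi>]
        point_on_sum[OF \<phi> B P0] subring_set_closed[OF B])
qed

text \<open>
  A value \<open>\<xi>\<close> for \<open>x\<close> extends \<open>\<phi>\<close> to \<open>B[x]\<close> as soon as every polynomial relation of \<open>x\<close> modulo \<open>P\<close> is
  respected; applied to differences of polynomials, the condition makes the extension independent of
  how an element is written as a polynomial in \<open>x\<close>.
\<close>

lemma extend_point_by_value:
  assumes \<phi>: "point_on B P \<phi>" and B: "subring_set B" and P: "ideal_in UNIV P"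
    and kill: "\<And>p. p \<in> polys B \<Longrightarrow> poly p x \<in> P \<Longrightarrow> poly (map_poly \<phi> p) \<xi> = 0"
  shows "\<exists>\<psi>. point_on (adjoin B x) P \<psi> \<and> (\<forall>p\<in>polys B. \<psi> (poly p x) = poly (map_poly \<phi> p) \<xi>)"
proof -
  have P0: "0 \<in> P" using P by (rule ideal_inD)
  note mp = map_poly_point[OF \<phi> B P0]
  note closed = subring_set_closed[OF subring_polys[OF B]]
  have inj: "poly (map_poly \<phi> p) \<xi> = poly (map_poly \<phi> q) \<xi>"
    if "p \<in> polys B" "q \<in> polys B" "poly p x = poly q x" for p q
  proof -
    have "poly (map_poly \<phi> (p - q)) \<xi> = 0"
      by (rule kill) (use that P0 in \<open>auto intro: closed\<close>)
    moreover have "map_poly \<phi> ((p - q) + q) = map_poly \<phi> (p - q) + map_poly \<phi> q"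
      by (rule mp) (use that in \<open>auto intro: closed\<close>)
    ultimately show ?thesis by (metis add_0 diff_add_cancel poly_add)
  qed
  define \<psi> where "\<psi> y = poly (map_poly \<phi> (SOME p. p \<in> polys B \<and> poly p x = y)) \<xi>" for y
  have \<psi>: "\<psi> (poly p x) = poly (map_poly \<phi> p) \<xi>" if "p \<in> polys B" for p
    unfolding \<psi>_def using someI[of "\<lambda>q. q \<in> polys B \<and> poly q x = poly p x" p] that
    by (intro inj) auto
  have "point_on (adjoin B x) P \<psi>"
    unfolding point_on_def
  proof (intro conjI ballI)
    show "\<psi> 1 = 1" using \<psi>[of 1] mp(4) closed by simp
    fix y z assume "y \<in> adjoin B x" "z \<in> adjoin B x"
    then obtain p q where pq: "p \<in> polys B" "q \<in> polys B" "y = poly p x" "z = poly q x"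
      by (auto simp: adjoin_def)
    show "\<psi> (y + z) = \<psi> y + \<psi> z"
      using \<psi>[of "p + q"] \<psi>[of p] \<psi>[of q] mp(1)[of p q] closed(4)[of p q] pq by simp
    show "\<psi> (y * z) = \<psi> y * \<psi> z"
      using \<psi>[of "p * q"] \<psi>[of p] \<psi>[of q] mp(2)[of p q] closed(6)[of p q] pq by simp
  next
    fix y assume "y \<in> adjoin B x \<inter> P"
    then show "\<psi> y = 0" using kill \<psi> by (auto simp: adjoin_def)
  qed
  then show ?thesis using \<psi> by blast
qed

text \<open>
  Modulo \<open>P\<close> a polynomial may be replaced by one that is zero or has a leading coefficient outside \<open>P\<close>.
  This lets degrees be used as over the domain \<open>B / (B \<inter> P)\<close>.
\<close>

lemma drop_leading_terms_in_prime:
  assumes P: "prime_set P" and B: "subring_set B" and p: "p \<in> polys B" and nP: "\<exists>i. coeff p i \<notin> P"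
  shows "\<exists>q\<in>polys B. degree q \<le> degree p \<and> lead_coeff q \<notin> P \<and> poly q x - poly p x \<in> P"
  using p nP
proof (induction "degree p" arbitrary: p rule: less_induct)
  case less
  show ?case
  proof (cases "lead_coeff p \<in> P")
    case False
    then show ?thesis using less.prems prime_setD[OF P] by (intro bexI[of _ p]) auto
  next
    case True
    define r where "r = p - monom (lead_coeff p) (degree p)"
    have r: "r \<in> polys B" unfolding r_def
      using less.prems by (intro subring_set_closed(5)[OF subring_polys[OF B]] monom_polys[OF B])
        (auto intro: polysD)
    obtain i where i: "coeff p i \<notin> P" using less.prems by blast
    with True have ne: "i \<noteq> degree p" by auto
    then have ir: "coeff r i \<notin> P" using i by (simp add: r_def)
    have "i \<le> degree p" using i prime_setD(4)[OF P] by (metis le_degree)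
    then have pos: "degree p > 0" using ne by linarith
    have dr: "degree r < degree p"
      by (rule degree_lessI) (use pos in \<open>auto simp: r_def coeff_eq_0\<close>)
    obtain q where q: "q \<in> polys B" "degree q \<le> degree r" "lead_coeff q \<notin> P" "poly q x - poly r x \<in> P"
      using less.hyps[OF dr r] ir by blast
    have "poly q x - poly p x = (poly q x - poly r x) - lead_coeff p * x ^ degree p"
      by (simp add: r_def poly_monom)
    then have "poly q x - poly p x \<in> P"
      using prime_setD(6)[OF P q(4) prime_setD(8)[OF P True]] by metis
    then show ?thesis using q dr by (intro bexI[of _ q]) auto
  qed
qed

text \<open>
  Euclidean division without inverting the leading coefficient.  The bound on the degree of the
  quotient is what allows minimality of a degree to be applied to quotients.
\<close>

lemma pseudo_division:
  assumes B: "subring_set B" and p: "p \<in> polys B" "p \<noteq> 0" and q: "q \<in> polys B"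
  shows "\<exists>k. \<exists>s\<in>polys B. \<exists>r\<in>polys B. Polynomial.smult (lead_coeff p ^ k) q = s * p + r \<and>
    (r = 0 \<or> degree r < degree p) \<and> degree s \<le> degree q - degree p"
  using q
proof (induction "degree q" arbitrary: q rule: less_induct)
  case less
  note closed = subring_set_closed[OF subring_polys[OF B]]
  show ?case
  proof (cases "q = 0 \<or> degree q < degree p")
    case True
    then show ?thesis using less.prems
      by (intro exI[of _ 0] bexI[of _ 0] bexI[of _ q]) (auto intro: closed)
  next
    case False
    define v where "v = lead_coeff p"
    define m where "m = monom (lead_coeff q) (degree q - degree p)"
    define q' where "q' = Polynomial.smult v q - m * p"
    have m: "m \<in> polys B" unfolding m_def by (intro monom_polys B polysD[OF less.prems])
    have v: "v \<in> B" unfolding v_def by (intro polysD p)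
    have q'B: "q' \<in> polys B" unfolding q'_def
      by (intro closed smult_polys m p v B less.prems)
    have top: "coeff q' n = 0" if "n \<ge> degree q" for n
    proof -
      have n: "n \<ge> degree q - degree p" using that by simp
      have "coeff (m * p) n = lead_coeff q * coeff p (n - (degree q - degree p))"
        unfolding m_def using n by (subst coeff_monom_mult) auto
      also have "n - (degree q - degree p) = degree p + (n - degree q)" using that False by auto
      finally have mp: "coeff (m * p) n = lead_coeff q * coeff p (degree p + (n - degree q))" .
      show ?thesis
      proof (cases "n = degree q")
        case True then show ?thesis using mp by (simp add: q'_def v_def)
      next
        case neq: False
        then have "coeff p (degree p + (n - degree q)) = 0" "coeff q n = 0"
          using that by (auto intro!: coeff_eq_0)
        then show ?thesis using mp by (simp add: q'_def)
      qed
    qed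
    have "q' = 0 \<or> degree q' < degree q"
      using top by (metis leading_coeff_0_iff not_le)
    then show ?thesis
    proof
      assume "q' = 0"
      then have "Polynomial.smult (lead_coeff p ^ 1) q = m * p + 0" by (simp add: q'_def v_def)
      moreover have "degree m \<le> degree q - degree p" unfolding m_def by (rule degree_monom_le)
      ultimately show ?thesis using m closed(1) by blast
    next
      assume lt: "degree q' < degree q"
      obtain k s r where sr: "s \<in> polys B" "r \<in> polys B"
        "Polynomial.smult (v ^ k) q' = s * p + r" "r = 0 \<or> degree r < degree p"
        "degree s \<le> degree q' - degree p"
        using less.hyps[OF lt q'B] unfolding v_def by blast
      have "Polynomial.smult (v ^ Suc k) q = Polynomial.smult (v ^ k) q' + Polynomial.smult (v ^ k) m * p"
        by (simp add: q'_def smult_diff_right mult.commute)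
      also have "\<dots> = (s + Polynomial.smult (v ^ k) m) * p + r" by (simp add: sr(3) algebra_simps)
      finally have eq: "Polynomial.smult (v ^ Suc k) q = (s + Polynomial.smult (v ^ k) m) * p + r" .
      have "degree (Polynomial.smult (v ^ k) m) \<le> degree q - degree p"
        using degree_smult_le[of "v ^ k" m] degree_monom_le[of "lead_coeff q" "degree q - degree p"]
        unfolding m_def by linarith
      then have "degree (s + Polynomial.smult (v ^ k) m) \<le> degree q - degree p"
        using sr(5) lt by (intro degree_add_le) auto
      moreover have "s + Polynomial.smult (v ^ k) m \<in> polys B"
        by (intro closed sr smult_polys B m subring_set_closed(7) v)
      ultimately show ?thesis using eq sr(2,4) unfolding v_def by blast
    qed
  qed
qed

text \<open>
  If \<open>f\<close> vanished everywhere, then \<open>1 + X f\<close> would be a polynomial of positive degree without a root.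
\<close>

lemma alg_closed_non_root:
  assumes "(f :: 'k::alg_closed_field poly) \<noteq> 0"
  shows "\<exists>\<xi>. poly f \<xi> \<noteq> 0"
proof (rule ccontr)
  assume "\<not> ?thesis"
  moreover have "degree (pCons 1 f) > 0" using assms by simp
  then obtain \<xi> where "poly (pCons 1 f) \<xi> = 0" using alg_closed_imp_poly_has_root by blast
  ultimately show False by simp
qed


lemma poly_in_prime:
  assumes P: "prime_set P" and coeffs: "\<And>i. coeff p i \<in> P"
  shows "poly p x \<in> P"
  unfolding poly_altdef
  by (intro ideal_in_sum[OF prime_setD(1)[OF P]] prime_setD(8)[OF P] coeffs)

text \<open>
  Here \<open>p\<close> plays the role of the minimal polynomial of \<open>x\<close> over the field of fractions of
  \<open>B / (B \<inter> P)\<close>, so each element of \<open>B[x]\<close> outside \<open>P\<close> is invertible up to a denominator \<open>w\<close>.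
  The Euclidean algorithm finds the inverse: dividing \<open>p\<close> by \<open>q\<close> leaves a remainder of smaller degree
  that is again outside \<open>P\<close>, because otherwise the quotient would give a relation of \<open>x\<close> of degree
  smaller than that of \<open>p\<close>.
\<close>

lemma inverse_modulo_prime:
  assumes P: "prime_set P" and B: "subring_set B" and p: "p \<in> polys B" "lead_coeff p \<notin> P"
    and px: "poly p x \<in> P"
    and minimal: "\<And>r i. r \<in> polys B \<Longrightarrow> r = 0 \<or> degree r < degree p \<Longrightarrow> poly r x \<in> P \<Longrightarrow> coeff r i \<in> P"
    and q: "q \<in> polys B" "poly q x \<notin> P"
  shows "\<exists>s\<in>polys B. \<exists>w\<in>B. w \<notin> P \<and> poly s x * poly q x - w \<in> P"
  using q
proof (induction "degree q" arbitrary: q rule: less_induct)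
  case less
  note closed = subring_set_closed[OF subring_polys[OF B]]
  have "\<exists>i. coeff q i \<notin> P" using poly_in_prime[OF P] less.prems by blast
  then obtain q' where q': "q' \<in> polys B" "degree q' \<le> degree q" "lead_coeff q' \<notin> P"
    "poly q' x - poly q x \<in> P"
    using drop_leading_terms_in_prime[OF P B less.prems(1)] by blast
  have q'x: "poly q' x \<notin> P"
    using less.prems(2) prime_setD(6)[OF P _ q'(4), of "poly q' x"] by auto
  have q'0: "q' \<noteq> 0" using q'(3) prime_setD(4)[OF P] by auto
  have p0: "p \<noteq> 0" using p(2) prime_setD(4)[OF P] by auto
  have transfer: ?case if s: "s \<in> polys B" "w \<in> B" "w \<notin> P" "poly s x * poly q' x - w \<in> P" for s w
  proof -
    have "poly s x * poly q x - w = (poly s x * poly q' x - w) - poly s x * (poly q' x - poly q x)"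
      by (simp add: algebra_simps)
    then have "poly s x * poly q x - w \<in> P"
      using prime_setD(6)[OF P s(4) prime_setD(7)[OF P q'(4)]] by metis
    then show ?thesis using s by blast
  qed
  show ?case
  proof (cases "degree q' = 0")
    case True
    then have "poly q' x = coeff q' 0" by (metis degree_eq_zeroE poly_pCons coeff_pCons_0 mult_zero_right add.right_neutral poly_0)
    then show ?thesis
      using q' True prime_setD(4)[OF P] by (intro transfer[of 1 "coeff q' 0"]) (auto intro: closed polysD)
  next
    case pos: False
    show ?thesis
    proof (cases "degree p \<le> degree q'")
      case True
      obtain k s r where sr: "s \<in> polys B" "r \<in> polys B"
        "Polynomial.smult (lead_coeff p ^ k) q' = s * p + r" "r = 0 \<or> degree r < degree p"
        using pseudo_division[OF B p(1) p0 q'(1)] by blast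
      have eq: "lead_coeff p ^ k * poly q' x = poly s x * poly p x + poly r x"
        using arg_cong[OF sr(3), of "\<lambda>f. poly f x"] by simp
      have "lead_coeff p ^ k * poly q' x \<notin> P"
        using prime_setD(3)[OF P] prime_setD(9)[OF P] p(2) q'x by blast
      then have rx: "poly r x \<notin> P"
        using eq prime_setD(5)[OF P prime_setD(7)[OF P px]] by auto
      then have "r \<noteq> 0" using prime_setD(4)[OF P] by auto
      then have "degree r < degree q" using sr(4) True q'(2) by linarith
      then obtain s' w where s': "s' \<in> polys B" "w \<in> B" "w \<notin> P" "poly s' x * poly r x - w \<in> P"
        using less.hyps[OF _ sr(2) rx] by blast
      have "poly (Polynomial.smult (lead_coeff p ^ k) s') x * poly q' x - w
          = poly s' x * (lead_coeff p ^ k * poly q' x) - w" by (simp add: algebra_simps)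
      also have "\<dots> = (poly s' x * poly r x - w) + (poly s' x * poly s x) * poly p x"
        unfolding eq by (simp add: algebra_simps)
      also have "\<dots> \<in> P" by (rule prime_setD(5)[OF P s'(4) prime_setD(7)[OF P px]])
      finally show ?thesis
        using s' by (intro transfer[of "Polynomial.smult (lead_coeff p ^ k) s'" w])
          (auto simp del: poly_smult intro!: smult_polys[OF B] subring_set_closed[OF B] polysD[OF p(1)])
    next
      case False
      obtain k a r where sr: "a \<in> polys B" "r \<in> polys B"
        "Polynomial.smult (lead_coeff q' ^ k) p = a * q' + r" "r = 0 \<or> degree r < degree q'"
        "degree a \<le> degree p - degree q'"
        using pseudo_division[OF B q'(1) q'0 p(1)] by blast
      have eq: "lead_coeff q' ^ k * poly p x = poly a x * poly q' x + poly r x"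
        using arg_cong[OF sr(3), of "\<lambda>f. poly f x"] by simp
      have rx: "poly r x \<notin> P"
      proof
        assume "poly r x \<in> P"
        then have "lead_coeff q' ^ k * poly p x - poly r x \<in> P"
          by (intro prime_setD(6,7)[OF P] px)
        then have "poly a x * poly q' x \<in> P" unfolding eq by simp
        \<comment> \<open>The quotient is then a relation of smaller degree, so all its coefficients lie in the prime.\<close>
        then have "poly a x \<in> P" using prime_setD(3)[OF P] q'x by blast
        moreover have "degree a < degree p" using sr(5) pos False by linarith
        ultimately have aP: "coeff a i \<in> P" for i using minimal sr(1) by blast
        have "coeff r (degree p) = 0"
          using sr(4) False by (auto intro!: coeff_eq_0)
        then have "lead_coeff q' ^ k * lead_coeff p = coeff (a * q') (degree p)"
          using arg_cong[OF sr(3), of "\<lambda>f. coeff f (degree p)"] by simp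
        also have "\<dots> \<in> P"
          unfolding coeff_mult by (intro ideal_in_sum[OF prime_setD(1)[OF P]] prime_setD(8)[OF P] aP)
        finally show False using prime_setD(3,9)[OF P] p(2) q'(3) by blast
      qed
      then have "r \<noteq> 0" using prime_setD(4)[OF P] by auto
      then have "degree r < degree q" using sr(4) q'(2) by linarith
      then obtain s' w where s': "s' \<in> polys B" "w \<in> B" "w \<notin> P" "poly s' x * poly r x - w \<in> P"
        using less.hyps[OF _ sr(2) rx] by blast
      have "poly (- (s' * a)) x * poly q' x - w
          = poly s' x * (- (poly a x * poly q' x)) - w" by (simp add: algebra_simps)
      also have "- (poly a x * poly q' x) = poly r x - lead_coeff q' ^ k * poly p x"
        unfolding eq by simp
      also have "poly s' x * (poly r x - lead_coeff q' ^ k * poly p x) - w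
          = (poly s' x * poly r x - w) - (poly s' x * lead_coeff q' ^ k) * poly p x"
        by (simp add: algebra_simps)
      also have "\<dots> \<in> P" by (rule prime_setD(6)[OF P s'(4) prime_setD(7)[OF P px]])
      finally show ?thesis
        using s' sr(1) by (intro transfer[of "- (s' * a)" w]) (auto simp del: poly_minus poly_mult intro!: closed)
    qed
  qed
qed

text \<open>
  If \<open>x\<close> satisfies no relation modulo \<open>P\<close>, then any \<open>\<xi>\<close> is an admissible value for \<open>x\<close>, and it is
  chosen outside the zeros of \<open>c\<close>; \<open>b\<close> is a coefficient of \<open>c\<close>.  Otherwise \<open>\<xi>\<close> is a root of the image of
  a minimal relation \<open>p\<close>, and \<open>b\<close> is the product of the leading coefficient of \<open>p\<close>, which keeps the
  degree positive, and of the denominator of an inverse of \<open>c\<close>, which keeps the value of \<open>c\<close> nonzero.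
\<close>

lemma extend_point:
  fixes x :: "'c::comm_ring_1" and P :: "'c set"
  assumes P: "prime_set P" and B: "subring_set B" and c: "c \<in> adjoin B x" "c \<notin> P"
  shows "\<exists>b\<in>B. b \<notin> P \<and> (\<forall>\<phi> :: 'c \<Rightarrow> 'k::alg_closed_field. point_on B P \<phi> \<and> \<phi> b \<noteq> 0 \<longrightarrow>
    (\<exists>\<psi>. point_on (adjoin B x) P \<psi> \<and> \<psi> c \<noteq> 0 \<and> (\<forall>y\<in>B. \<psi> y = \<phi> y)))"
proof -
  note P0 = prime_setD(4)[OF P]
  note ext = extend_point_by_value[OF _ B prime_setD(1)[OF P]]
  have agree: "\<psi> y = \<phi> y"
    if "point_on B P \<phi>" "\<forall>p\<in>polys B. \<psi> (poly p x) = poly (map_poly \<phi> p) \<xi>" "y \<in> B"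
    for \<phi> \<psi> :: "'c \<Rightarrow> 'k" and \<xi> y
    using bspec[OF that(2) const_polys[OF B that(3)]] map_poly_point(3)[OF that(1) B P0]
    by (simp add: map_poly_pCons)
  obtain q where q: "q \<in> polys B" "c = poly q x" using c(1) by (auto simp: adjoin_def)
  show ?thesis
  proof (cases "\<forall>p\<in>polys B. poly p x \<in> P \<longrightarrow> (\<forall>i. coeff p i \<in> P)")
    case True
    obtain i where i: "coeff q i \<notin> P" using poly_in_prime[OF P] q c(2) by blast
    show ?thesis
    proof (rule bexI[of _ "coeff q i"], intro conjI allI impI)
      fix \<phi> :: "'c \<Rightarrow> 'k" assume \<phi>: "point_on B P \<phi> \<and> \<phi> (coeff q i) \<noteq> 0"
      have z: "\<phi> 0 = 0" using \<phi> by (intro map_poly_point(3)[OF _ B P0]) auto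
      have "coeff (map_poly \<phi> q) i \<noteq> 0" using \<phi> z by (simp add: coeff_map_poly)
      then have "map_poly \<phi> q \<noteq> 0" by auto
      then obtain \<xi> where \<xi>: "poly (map_poly \<phi> q) \<xi> \<noteq> 0" using alg_closed_non_root by blast
      have "map_poly \<phi> p = 0" if "p \<in> polys B" "poly p x \<in> P" for p
        using that True \<phi> z by (intro poly_eqI) (auto simp: coeff_map_poly polys_def point_on_def)
      then obtain \<psi> where "point_on (adjoin B x) P \<psi>"
        "\<forall>p\<in>polys B. \<psi> (poly p x) = poly (map_poly \<phi> p) \<xi>"
        using ext[of \<phi> x \<xi>] \<phi> by auto
      then show "\<exists>\<psi>. point_on (adjoin B x) P \<psi> \<and> \<psi> c \<noteq> 0 \<and> (\<forall>y\<in>B. \<psi> y = \<phi> y)"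
        using \<xi> q agree \<phi> by metis
    qed (use i q in \<open>auto intro: polysD\<close>)
  next
    case False
    define good where "good p \<longleftrightarrow> p \<in> polys B \<and> poly p x \<in> P \<and> lead_coeff p \<notin> P" for p
    have good: "\<exists>p'. good p' \<and> degree p' \<le> degree p"
      if p: "p \<in> polys B" "poly p x \<in> P" "\<exists>i. coeff p i \<notin> P" for p
    proof -
      obtain p' where p': "p' \<in> polys B" "degree p' \<le> degree p" "lead_coeff p' \<notin> P"
        "poly p' x - poly p x \<in> P"
        using drop_leading_terms_in_prime[OF P B p(1,3)] by blast
      have "poly p' x \<in> P" using prime_setD(5)[OF P p'(4) p(2)] by simp
      then show ?thesis using p' unfolding good_def by blast
    qed
    then have "\<exists>p. good p" using False by blast
    then obtain p where gp: "good p" and least: "\<And>p'. good p' \<Longrightarrow> degree p \<le> degree p'"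
      using arg_min_nat_lemma[of good _ degree] by blast
    have p: "p \<in> polys B" "poly p x \<in> P" "lead_coeff p \<notin> P" using gp by (auto simp: good_def)
    have p0: "p \<noteq> 0" using p P0 by auto
    have minimal: "coeff r i \<in> P" if r: "r \<in> polys B" "r = 0 \<or> degree r < degree p" "poly r x \<in> P" for r i
    proof (cases "r = 0")
      case True then show ?thesis using P0 by simp
    next
      case ne: False
      show ?thesis
      proof (rule ccontr)
        assume "coeff r i \<notin> P"
        then obtain p' where "good p'" "degree p' \<le> degree r" using good[OF r(1,3)] by blast
        then show False using least r ne by fastforce
      qed
    qed
    have pos: "degree p > 0"
    proof (rule ccontr)
      assume "\<not> degree p > 0"
      then obtain u where "p = [:u:]" by (metis degree_eq_zeroE not_gr_zero)
      then show False using p by simp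
    qed
    obtain s w where s: "s \<in> polys B" "w \<in> B" "w \<notin> P" "poly s x * poly q x - w \<in> P"
      using inverse_modulo_prime[OF P B p(1,3,2) minimal] q c(2) by blast
    define u where "u = lead_coeff p"
    have uB: "u \<in> B" unfolding u_def by (rule polysD[OF p(1)])
    show ?thesis
    proof (rule bexI[of _ "u * w"], intro conjI allI impI)
      show "u * w \<notin> P" using prime_setD(3)[OF P] p(3) s(3) unfolding u_def by blast
      show "u * w \<in> B" by (rule subring_set_closed(6)[OF B uB s(2)])
      fix \<phi> :: "'c \<Rightarrow> 'k" assume "point_on B P \<phi> \<and> \<phi> (u * w) \<noteq> 0"
      then have \<phi>: "point_on B P \<phi>" and nz: "\<phi> u \<noteq> 0" "\<phi> w \<noteq> 0"
        using uB s(2) by (auto simp: point_onD(3))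
      note mp = map_poly_point[OF \<phi> B P0]
      have "degree (map_poly \<phi> p) = degree p"
        using nz(1) pos unfolding u_def by (intro map_poly_degree_eq) auto
      then obtain \<xi> where \<xi>: "poly (map_poly \<phi> p) \<xi> = 0"
        using alg_closed_imp_poly_has_root[of "map_poly \<phi> p"] pos by auto
      have kill: "poly (map_poly \<phi> f) \<xi> = 0" if f: "f \<in> polys B" "poly f x \<in> P" for f
      proof -
        obtain k t r where sr: "t \<in> polys B" "r \<in> polys B"
          "Polynomial.smult (u ^ k) f = t * p + r" "r = 0 \<or> degree r < degree p"
          using pseudo_division[OF B p(1) p0 f(1)] unfolding u_def by blast
        have "poly r x = u ^ k * poly f x - poly t x * poly p x"
          using arg_cong[OF sr(3), of "\<lambda>f. poly f x"] by simp
        then have "poly r x \<in> P" using prime_setD(6)[OF P prime_setD(7)[OF P f(2)] prime_setD(7)[OF P p(2)]] by simp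
        then have "coeff r i \<in> P" for i using minimal sr(2,4) by blast
        then have "map_poly \<phi> r = 0"
          using point_onD(4)[OF \<phi> polysD[OF sr(2)]] by (intro poly_eqI) (simp add: coeff_map_poly mp(3))
        then have "map_poly \<phi> (Polynomial.smult (u ^ k) f) = map_poly \<phi> t * map_poly \<phi> p"
          unfolding sr(3)
          using mp(1)[of "t * p" r] mp(2)[of t p] sr(1,2) p(1) subring_set_closed[OF subring_polys[OF B]]
          by simp
        then have "Polynomial.smult (\<phi> u ^ k) (map_poly \<phi> f) = map_poly \<phi> t * map_poly \<phi> p"
          using mp(5)[OF _ f(1), of "u ^ k"] point_on_power[OF \<phi> B uB] subring_set_closed(7)[OF B uB]
          by simp
        from arg_cong[OF this, of "\<lambda>f. poly f \<xi>"] show ?thesis using \<xi> nz by simp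
      qed
      obtain \<psi> where \<psi>: "point_on (adjoin B x) P \<psi>"
        "\<forall>p\<in>polys B. \<psi> (poly p x) = poly (map_poly \<phi> p) \<xi>"
        using ext[OF \<phi> kill] by blast
      have wA: "w \<in> adjoin B x" and sA: "poly s x \<in> adjoin B x" and qA: "poly q x \<in> adjoin B x"
        using subset_adjoin[OF B] s q by (auto simp: adjoin_def)
      note closed = subring_set_closed[OF subring_adjoin[OF B, of x]]
      have "\<psi> ((poly s x * poly q x - w) + w) = \<psi> (poly s x * poly q x - w) + \<psi> w"
        by (rule point_onD(2)[OF \<psi>(1)]) (intro closed wA sA qA)+
      also have "\<psi> (poly s x * poly q x - w) = 0"
        by (rule point_onD(4)[OF \<psi>(1) _ s(4)]) (intro closed wA sA qA)+
      finally have "\<psi> (poly s x) * \<psi> c = \<phi> w"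
        using agree[OF \<phi> \<psi>(2) s(2)] point_onD(3)[OF \<psi>(1) sA qA] q(2) by simp
      then have "\<psi> c \<noteq> 0" using nz by auto
      then show "\<exists>\<psi>. point_on (adjoin B x) P \<psi> \<and> \<psi> c \<noteq> 0 \<and> (\<forall>y\<in>B. \<psi> y = \<phi> y)"
        using \<psi> agree[OF \<phi> \<psi>(2)] by blast
    qed
  qed
qed

lemma extend_point_list:
  fixes P :: "'c::comm_ring_1 set"
  assumes P: "prime_set P" and B: "subring_set B" and c: "c \<in> adjoin_list B xs" "c \<notin> P"
  shows "\<exists>b\<in>B. b \<notin> P \<and> (\<forall>\<phi> :: 'c \<Rightarrow> 'k::alg_closed_field. point_on B P \<phi> \<and> \<phi> b \<noteq> 0 \<longrightarrow>
    (\<exists>\<psi>. point_on (adjoin_list B xs) P \<psi> \<and> \<psi> c \<noteq> 0 \<and> (\<forall>y\<in>B. \<psi> y = \<phi> y)))"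
  using c
proof (induction xs arbitrary: c)
  case Nil
  then show ?case by auto
next
  case (Cons x xs)
  have sub: "B \<subseteq> adjoin_list B xs" using subset_adjoin_list[OF B] .
  obtain b' where b': "b' \<in> adjoin_list B xs" "b' \<notin> P"
    "\<forall>\<phi> :: 'c \<Rightarrow> 'k. point_on (adjoin_list B xs) P \<phi> \<and> \<phi> b' \<noteq> 0 \<longrightarrow>
    (\<exists>\<psi>. point_on (adjoin (adjoin_list B xs) x) P \<psi> \<and> \<psi> c \<noteq> 0 \<and> (\<forall>y\<in>adjoin_list B xs. \<psi> y = \<phi> y))"
    using extend_point[OF P subring_adjoin_list[OF B], of c xs x] Cons.prems by auto
  obtain b where b: "b \<in> B" "b \<notin> P"
    "\<forall>\<phi> :: 'c \<Rightarrow> 'k. point_on B P \<phi> \<and> \<phi> b \<noteq> 0 \<longrightarrow>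
    (\<exists>\<psi>. point_on (adjoin_list B xs) P \<psi> \<and> \<psi> b' \<noteq> 0 \<and> (\<forall>y\<in>B. \<psi> y = \<phi> y))"
    using Cons.IH[OF b'(1,2)] by blast
  show ?case
  proof (rule bexI[OF _ b(1)], intro conjI b(2) allI impI)
    fix \<phi> :: "'c \<Rightarrow> 'k" assume "point_on B P \<phi> \<and> \<phi> b \<noteq> 0"
    then obtain \<psi>' where "point_on (adjoin_list B xs) P \<psi>'" "\<psi>' b' \<noteq> 0" and e1: "\<forall>y\<in>B. \<psi>' y = \<phi> y"
      using b(3) by blast
    then obtain \<psi> where "point_on (adjoin (adjoin_list B xs) x) P \<psi>" "\<psi> c \<noteq> 0"
      and e2: "\<forall>y\<in>adjoin_list B xs. \<psi> y = \<psi>' y"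
      using b'(3) by blast
    moreover have "\<forall>y\<in>B. \<psi> y = \<phi> y" using e1 e2 sub by auto
    ultimately show "\<exists>\<psi>. point_on (adjoin_list B (x # xs)) P \<psi> \<and> \<psi> c \<noteq> 0 \<and> (\<forall>y\<in>B. \<psi> y = \<phi> y)"
      by auto
  qed
qed

section \<open>Prime ideals avoiding the powers of an element\<close>

text \<open>
  An ideal that is maximal among those containing \<open>Q\<close> and no power of \<open>h\<close> is prime.
\<close>

lemma exists_prime_avoiding_powers:
  fixes Q :: "'c::comm_ring_1 set"
  assumes Q: "ideal_in UNIV Q" and h: "\<And>n::nat. h ^ n \<notin> Q"
  shows "\<exists>P. prime_set P \<and> Q \<subseteq> P \<and> h \<notin> P"
proof -
  define \<A> where "\<A> = {I. ideal_in UNIV I \<and> Q \<subseteq> I \<and> (\<forall>n::nat. h ^ n \<notin> I)}"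
  have "\<exists>M\<in>\<A>. \<forall>X\<in>\<A>. M \<subseteq> X \<longrightarrow> X = M"
  proof (rule subset_Zorn_nonempty)
    show "\<A> \<noteq> {}" using Q h by (auto simp: \<A>_def)
    fix \<C> assume \<C>: "\<C> \<noteq> {}" "subset.chain \<A> \<C>"
    have sub: "I \<in> \<A>" if "I \<in> \<C>" for I using \<C>(2) that by (auto simp: subset.chain_def)
    have tot: "I \<subseteq> J \<or> J \<subseteq> I" if "I \<in> \<C>" "J \<in> \<C>" for I J
      using \<C>(2) that by (auto simp: subset.chain_def)
    have id: "ideal_in UNIV I" if "I \<in> \<C>" for I using sub[OF that] by (simp add: \<A>_def)
    have "x + y \<in> \<Union>\<C>" if "x \<in> \<Union>\<C>" "y \<in> \<Union>\<C>" for x y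
    proof -
      obtain I J where IJ: "I \<in> \<C>" "J \<in> \<C>" "x \<in> I" "y \<in> J" using \<open>x \<in> \<Union>\<C>\<close> \<open>y \<in> \<Union>\<C>\<close> by blast
      from tot[OF IJ(1,2)] show ?thesis
      proof
        assume "I \<subseteq> J"
        then have "x + y \<in> J" using IJ by (intro ideal_inD(3)[OF id[OF IJ(2)]]) auto
        then show ?thesis using IJ by blast
      next
        assume "J \<subseteq> I"
        then have "x + y \<in> I" using IJ by (intro ideal_inD(3)[OF id[OF IJ(1)]]) auto
        then show ?thesis using IJ by blast
      qed
    qed
    moreover have "b * x \<in> \<Union>\<C>" if "x \<in> \<Union>\<C>" for b x
      using that ideal_inD(4)[OF id] by blast
    moreover have "0 \<in> \<Union>\<C>" using \<C>(1) ideal_inD(2)[OF id] by blast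
    moreover have "Q \<subseteq> \<Union>\<C>" using \<C>(1) sub by (fastforce simp: \<A>_def)
    moreover have "\<forall>n. h ^ n \<notin> \<Union>\<C>" using sub by (auto simp: \<A>_def)
    ultimately show "\<Union>\<C> \<in> \<A>" by (auto simp: \<A>_def ideal_in_def)
  qed
  then obtain P where P: "P \<in> \<A>" "\<And>X. X \<in> \<A> \<Longrightarrow> P \<subseteq> X \<Longrightarrow> X = P" by blast
  have idP: "ideal_in UNIV P" and QP: "Q \<subseteq> P" and hP: "\<And>n. h ^ n \<notin> P" using P(1) by (auto simp: \<A>_def)
  have grow: "\<exists>n. \<exists>p\<in>P. \<exists>c. h ^ n = p + c * x" if "x \<notin> P" for x
  proof (rule ccontr)
    assume no: "\<not> ?thesis"
    define X where "X = {p + c * x | p c. p \<in> P}"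
    \<comment> \<open>By maximality the ideal generated by \<open>P\<close> and \<open>x\<close> contains a power of \<open>h\<close>.\<close>
    have "ideal_in UNIV X"
      unfolding ideal_in_def
    proof (intro conjI ballI)
      show "0 \<in> X" using ideal_inD(2)[OF idP] unfolding X_def by (force intro: exI[of _ 0])
    next
      fix y z assume "y \<in> X" "z \<in> X"
      then obtain p c p' c' where "p \<in> P" "p' \<in> P" "y = p + c * x" "z = p' + c' * x" by (auto simp: X_def)
      then have "y + z = (p + p') + (c + c') * x" "p + p' \<in> P"
        by (auto simp: algebra_simps intro: ideal_inD(3)[OF idP])
      then show "y + z \<in> X" unfolding X_def by blast
    next
      fix b y assume "y \<in> X"
      then obtain p c where "p \<in> P" "y = p + c * x" by (auto simp: X_def)
      then have "b * y = b * p + (b * c) * x" "b * p \<in> P"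
        by (auto simp: algebra_simps intro: ideal_inD(4)[OF idP])
      then show "b * y \<in> X" unfolding X_def by blast
    qed auto
    moreover have PX: "P \<subseteq> X" unfolding X_def by (force intro: exI[of _ 0])
    ultimately have "X \<in> \<A>" using no QP by (auto simp: \<A>_def X_def)
    then have "X = P" using P(2) PX by blast
    moreover have "x \<in> X" using ideal_inD(2)[OF idP] unfolding X_def by (force intro: exI[of _ 1])
    ultimately show False using that by simp
  qed
  have "prime_set P"
    unfolding prime_set_def
  proof (intro conjI allI impI idP)
    show "1 \<notin> P" using hP[of 0] by simp
    fix x y assume xy: "x * y \<in> P"
    show "x \<in> P \<or> y \<in> P"
    proof (rule ccontr)
      assume "\<not> ?thesis"
      then obtain n p c m q d where *: "p \<in> P" "q \<in> P" "h ^ n = p + c * x" "h ^ m = q + d * y"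
        using grow by (metis (no_types))
      have "h ^ (n + m) = (p + c * x) * q + (d * y) * p + (c * d) * (x * y)"
        by (simp add: power_add *(3,4) algebra_simps)
      also have "\<dots> \<in> P" by (intro ideal_inD(3,4)[OF idP] * xy) auto
      finally show False using hP by blast
    qed
  qed
  moreover have "h \<notin> P" using hP[of 1] by simp
  ultimately show ?thesis using QP by blast
qed


section \<open>Evaluation of polynomials\<close>

text \<open>
  Coefficients are moved by \<open>\<phi>\<close>, so that the same function evaluates polynomials over \<open>K\<close> in \<open>S\<close>,
  polynomials over \<open>S\<close> in \<open>S\<close>, and performs substitutions of polynomials.
\<close>

definition eval_poly :: "('c \<Rightarrow> 's) \<Rightarrow> ('v \<Rightarrow> 's) \<Rightarrow> ('v::finite, 'c::comm_ring_1) mpoly \<Rightarrow> 's::comm_ring_1" where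
  "eval_poly \<phi> x p = (\<Sum>m\<in>Poly_Mapping.keys p. \<phi> (Poly_Mapping.lookup p m) *
     (\<Prod>i\<in>UNIV. x i ^ Poly_Mapping.lookup m i))"

definition unital_hom :: "('a::comm_ring_1 \<Rightarrow> 'b::comm_ring_1) \<Rightarrow> bool" where
  "unital_hom \<phi> \<longleftrightarrow> \<phi> 1 = 1 \<and> (\<forall>x y. \<phi> (x + y) = \<phi> x + \<phi> y \<and> \<phi> (x * y) = \<phi> x * \<phi> y)"

lemma unital_homD:
  assumes "unital_hom \<phi>"
  shows "\<phi> 1 = 1" "\<phi> (x + y) = \<phi> x + \<phi> y" "\<phi> (x * y) = \<phi> x * \<phi> y" "\<phi> 0 = 0" "\<phi> (- x) = - \<phi> x"
    "\<phi> (x - y) = \<phi> x - \<phi> y" "\<phi> (x ^ n) = \<phi> x ^ n" "\<phi> (sum f A) = (\<Sum>i\<in>A. \<phi> (f i))"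
    "\<phi> (prod h A') = (\<Prod>i\<in>A'. \<phi> (h i))"
proof -
  show one: "\<phi> 1 = 1" and add: "\<And>x y. \<phi> (x + y) = \<phi> x + \<phi> y" and mult: "\<And>x y. \<phi> (x * y) = \<phi> x * \<phi> y"
    using assms by (auto simp: unital_hom_def)
  show zero: "\<phi> 0 = 0" using add[of 0 0] by simp
  show neg: "\<phi> (- x) = - \<phi> x" for x using add[of x "- x"] zero by (simp add: minus_unique)
  show "\<phi> (x - y) = \<phi> x - \<phi> y" using add[of x "- y"] neg by simp
  show "\<phi> (x ^ n) = \<phi> x ^ n" by (induction n) (simp_all add: one mult)
  show "\<phi> (sum f A) = (\<Sum>i\<in>A. \<phi> (f i))" by (induction A rule: infinite_finite_induct) (simp_all add: zero add)
  show "\<phi> (prod h A') = (\<Prod>i\<in>A'. \<phi> (h i))" by (induction A' rule: infinite_finite_induct) (simp_all add: one mult)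
qed

lemma mconst_hom: "unital_hom mconst"
  unfolding unital_hom_def mconst_def by (auto simp: single_add mult_single)

lemma mpoly_monomial:
  fixes m :: "'v::finite \<Rightarrow>\<^sub>0 nat"
  shows "Poly_Mapping.single m (c :: 'c::comm_ring_1) =
    mconst c * (\<Prod>i\<in>UNIV. mvar i ^ Poly_Mapping.lookup m i)"
proof -
  have pow: "mvar i ^ n = (Poly_Mapping.single (Poly_Mapping.single i n) 1 :: ('v, 'c) mpoly)" for i :: 'v and n
    by (induction n) (simp_all add: mvar_def mult_single flip: single_add)
  have prod: "(\<Prod>i\<in>A. Poly_Mapping.single (f i) (1::'c)) = Poly_Mapping.single (\<Sum>i\<in>A. f i) 1"
    if "finite A" for A and f :: "'v \<Rightarrow> ('v \<Rightarrow>\<^sub>0 nat)"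
    using that by induction (simp_all add: mult_single)
  have "(\<Sum>i\<in>UNIV. Poly_Mapping.single i (Poly_Mapping.lookup m i)) = m"
    by (intro poly_mapping_eqI) (simp add: lookup_sum lookup_single when_def)
  then show ?thesis by (simp add: pow prod mconst_def mult_single)
qed

lemma mpoly_expansion:
  "p = (\<Sum>m\<in>Poly_Mapping.keys p. Poly_Mapping.single m (Poly_Mapping.lookup p m))"
  by (intro poly_mapping_eqI) (auto simp: lookup_sum lookup_single when_def in_keys_iff)

lemma mpoly_induct [case_names const var add mult]:
  fixes p :: "('v::finite, 'c::comm_ring_1) mpoly"
  assumes const: "\<And>c. P (mconst c)" and var: "\<And>i. P (mvar i)"
    and add: "\<And>p q. P p \<Longrightarrow> P q \<Longrightarrow> P (p + q)" and mult: "\<And>p q. P p \<Longrightarrow> P q \<Longrightarrow> P (p * q)"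
  shows "P p"
proof -
  have zero: "P 0" using const[of 0] by (simp add: mconst_def)
  have one: "P 1" using const[of 1] by (simp add: mconst_def)
  have pow: "P (p ^ n)" if "P p" for p n using that by (induction n) (auto intro: one mult)
  have prod: "P (prod f A)" if "\<And>i. P (f i)" for f :: "'v \<Rightarrow> _" and A
    using that by (induction A rule: infinite_finite_induct) (auto intro: one mult)
  have sum: "P (sum f A)" if "\<And>i. P (f i)" for f :: "('v \<Rightarrow>\<^sub>0 nat) \<Rightarrow> _" and A
    using that by (induction A rule: infinite_finite_induct) (auto intro: zero add)
  have "P (Poly_Mapping.single m c)" for m c
    unfolding mpoly_monomial by (intro mult const prod pow var)
  then show ?thesis by (subst mpoly_expansion) (rule sum)
qed

lemma eval_poly_superset:
  assumes "finite A" "Poly_Mapping.keys p \<subseteq> A" "\<phi> 0 = 0"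
  shows "eval_poly \<phi> x p = (\<Sum>m\<in>A. \<phi> (Poly_Mapping.lookup p m) * (\<Prod>i\<in>UNIV. x i ^ Poly_Mapping.lookup m i))"
  unfolding eval_poly_def using assms
  by (intro sum.mono_neutral_left) (auto simp: in_keys_iff)

lemma eval_poly_hom:
  fixes \<phi> :: "'c::comm_ring_1 \<Rightarrow> 's::comm_ring_1" and x :: "'v::finite \<Rightarrow> 's"
  assumes \<phi>: "unital_hom \<phi>"
  shows "unital_hom (eval_poly \<phi> x)"
    and "eval_poly \<phi> x (mconst c) = \<phi> c" and "eval_poly \<phi> x (mvar i) = x i"
proof -
  note h = unital_homD[OF \<phi>]
  have single: "eval_poly \<phi> x (Poly_Mapping.single m c) = \<phi> c * (\<Prod>i\<in>UNIV. x i ^ Poly_Mapping.lookup m i)" for m c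
    by (cases "c = 0") (auto simp: eval_poly_def h)
  show const: "eval_poly \<phi> x (mconst c) = \<phi> c" for c by (simp add: mconst_def single)
  have "(\<Prod>j\<in>UNIV. x j ^ Poly_Mapping.lookup (Poly_Mapping.single i 1) j) = (\<Prod>j\<in>UNIV. if j = i then x i else 1)"
    by (intro prod.cong) (auto simp: lookup_single when_def)
  then show "eval_poly \<phi> x (mvar i) = x i"
    by (simp add: mvar_def single h)
  have add: "eval_poly \<phi> x (p + q) = eval_poly \<phi> x p + eval_poly \<phi> x q" for p q
  proof -
    let ?A = "Poly_Mapping.keys p \<union> Poly_Mapping.keys q"
    have "Poly_Mapping.keys (p + q) \<subseteq> ?A" by (rule keys_add)
    then show ?thesis
      using eval_poly_superset[of ?A "p + q" \<phi> x] eval_poly_superset[of ?A p \<phi> x]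
        eval_poly_superset[of ?A q \<phi> x]
      by (simp add: h lookup_add distrib_right sum.distrib)
  qed
  have zero: "eval_poly \<phi> x 0 = 0" by (simp add: eval_poly_def)
  have sum: "eval_poly \<phi> x (sum f A) = (\<Sum>i\<in>A. eval_poly \<phi> x (f i))" for f :: "('v \<Rightarrow>\<^sub>0 nat) \<Rightarrow> _" and A
    by (induction A rule: infinite_finite_induct) (simp_all add: add zero)
  have mult: "eval_poly \<phi> x (p * q) = eval_poly \<phi> x p * eval_poly \<phi> x q" for p q
  proof -
    have "p * q = (\<Sum>m\<in>Poly_Mapping.keys p. \<Sum>n\<in>Poly_Mapping.keys q.
        Poly_Mapping.single m (Poly_Mapping.lookup p m) * Poly_Mapping.single n (Poly_Mapping.lookup q n))"
      by (subst (1) mpoly_expansion[of p], subst (1) mpoly_expansion[of q]) (simp add: sum_product)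
    also have "eval_poly \<phi> x \<dots> = (\<Sum>m\<in>Poly_Mapping.keys p. \<Sum>n\<in>Poly_Mapping.keys q.
        eval_poly \<phi> x (Poly_Mapping.single m (Poly_Mapping.lookup p m)) *
        eval_poly \<phi> x (Poly_Mapping.single n (Poly_Mapping.lookup q n)))"
      by (simp add: sum mult_single single h lookup_add power_add prod.distrib mult_ac)
    also have "\<dots> = eval_poly \<phi> x p * eval_poly \<phi> x q"
      unfolding eval_poly_def[of \<phi> x p] eval_poly_def[of \<phi> x q] by (simp add: sum_product single)
    finally show ?thesis .
  qed
  have "eval_poly \<phi> x 1 = 1" using const[of 1] by (simp add: mconst_def h)
  with add mult show "unital_hom (eval_poly \<phi> x)" by (simp add: unital_hom_def)
qed

lemma hom_eq_eval_poly:
  assumes F: "unital_hom F"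
  shows "F p = eval_poly (\<lambda>c. F (mconst c)) (\<lambda>i. F (mvar i)) p"
proof -
  have h: "unital_hom (\<lambda>c. F (mconst c))"
    by (simp add: unital_hom_def unital_homD[OF F] unital_homD[OF mconst_hom])
  show ?thesis
    by (induction p rule: mpoly_induct)
      (simp_all add: eval_poly_hom[OF h] unital_homD[OF F] unital_homD[OF eval_poly_hom(1)[OF h]])
qed

lemma mpoly_generated: "adjoin_list (range mconst) (map mvar vs) = (UNIV :: ('v::finite, 'c::comm_ring_1) mpoly set)"
  if vs: "set vs = (UNIV :: 'v set)"
proof -
  have sub: "subring_set (range (mconst :: 'c \<Rightarrow> ('v, 'c) mpoly))"
    by (rule subring_image[OF subring_set_UNIV]) (use unital_homD[OF mconst_hom] in auto)
  let ?A = "adjoin_list (range mconst) (map mvar vs) :: ('v, 'c) mpoly set"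
  note closed = subring_set_closed[OF subring_adjoin_list[OF sub]]
  have "p \<in> ?A" for p
  proof (induction p rule: mpoly_induct)
    case (const c)
    then show ?case using subset_adjoin_list[OF sub] by blast
  next
    case (var i)
    have "mvar i \<in> set (map mvar vs)" using vs by auto
    then show ?case using gens_in_adjoin_list[OF sub, of "map mvar vs"] by blast
  qed (auto intro: closed)
  then show ?thesis by auto
qed

section \<open>The Nullstellensatz\<close>

text \<open>
  A prime \<open>P\<close> containing \<open>Q\<close> but not \<open>h\<close> exists.  The constants meet \<open>P\<close> only in \<open>0\<close>, so the identity of
  \<open>K\<close> is a point there; it extends to a point of the whole polynomial ring that kills \<open>P\<close> but not \<open>h\<close>,
  and such a point is evaluation at its values on the variables.
\<close>

theorem nullstellensatz:
  fixes Q :: "('v::finite, 'k::alg_closed_field) mpoly set"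
  assumes Q: "ideal_in UNIV Q" and h: "\<And>n::nat. h ^ n \<notin> Q"
  shows "\<exists>x. (\<forall>q\<in>Q. eval_poly id x q = 0) \<and> eval_poly id x h \<noteq> 0"
proof -
  obtain P where P: "prime_set P" "Q \<subseteq> P" "h \<notin> P"
    using exists_prime_avoiding_powers[OF Q h] by blast
  obtain vs where vs: "set vs = (UNIV :: 'v set)" using finite_list[OF finite_UNIV] by blast
  let ?B = "range (mconst :: 'k \<Rightarrow> ('v, 'k) mpoly)"
  have mc_hom: "unital_hom (mconst :: 'k \<Rightarrow> ('v, 'k) mpoly)" by (rule mconst_hom)
  note mc = unital_homD[OF mc_hom]
  have B: "subring_set ?B" by (rule subring_image[OF subring_set_UNIV]) (use mc in auto)
  have inj: "mconst c = (mconst d :: ('v, 'k) mpoly) \<longleftrightarrow> c = d" for c d :: 'k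
    by (metis mconst_def lookup_single_eq)
  define \<phi> where "\<phi> = inv_into UNIV (mconst :: 'k \<Rightarrow> ('v, 'k) mpoly)"
  have \<phi>: "\<phi> (mconst c) = c" for c
    unfolding \<phi>_def by (rule inv_f_f) (simp add: inj_def inj)
  have prime0: "c = 0" if "mconst c \<in> P" for c
  proof (rule ccontr)
    assume "c \<noteq> 0"
    then have "mconst (inverse c) * mconst c = (1 :: ('v, 'k) mpoly)"
      using mc(3)[of "inverse c" c] mc(1) by simp
    then show False using prime_setD(7)[OF P(1) that, of "mconst (inverse c)"] prime_setD(2)[OF P(1)] by simp
  qed
  have pt: "point_on ?B P \<phi>"
    unfolding point_on_def
  proof (intro conjI ballI)
    show "\<phi> 1 = 1" using \<phi>[of 1] mc(1) by simp
  next
    fix x y assume "x \<in> ?B" "y \<in> ?B"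
    then show "\<phi> (x + y) = \<phi> x + \<phi> y" "\<phi> (x * y) = \<phi> x * \<phi> y"
      using \<phi> mc(2,3) by (auto simp flip: mc(2,3))
  next
    fix x assume "x \<in> ?B \<inter> P"
    then show "\<phi> x = 0" using prime0 \<phi> by auto
  qed
  have "\<exists>b\<in>?B. b \<notin> P \<and> (\<forall>\<phi> :: _ \<Rightarrow> 'k. point_on ?B P \<phi> \<and> \<phi> b \<noteq> 0 \<longrightarrow>
    (\<exists>\<psi>. point_on UNIV P \<psi> \<and> \<psi> h \<noteq> 0 \<and> (\<forall>y\<in>?B. \<psi> y = \<phi> y)))"
    by (rule extend_point_list[OF P(1) B, of h "map mvar vs", unfolded mpoly_generated[OF vs]])
      (use P(3) in auto)
  then obtain b where b: "b \<in> ?B" "b \<notin> P" "\<forall>\<phi> :: _ \<Rightarrow> 'k. point_on ?B P \<phi> \<and> \<phi> b \<noteq> 0 \<longrightarrow>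
    (\<exists>\<psi>. point_on UNIV P \<psi> \<and> \<psi> h \<noteq> 0 \<and> (\<forall>y\<in>?B. \<psi> y = \<phi> y))"
    by blast
  have "\<phi> b \<noteq> 0"
  proof
    assume "\<phi> b = 0"
    then have "b = mconst 0" using b(1) \<phi> by auto
    then show False using b(2) prime_setD(4)[OF P(1)] mc(4) by simp
  qed
  then obtain \<psi> :: "_ \<Rightarrow> 'k" where \<psi>: "point_on UNIV P \<psi>" "\<psi> h \<noteq> 0" "\<forall>y\<in>?B. \<psi> y = \<phi> y"
    using b(3) pt by blast
  have hom: "unital_hom \<psi>" using \<psi>(1) by (auto simp: point_on_def unital_hom_def)
  have id: "(\<lambda>c. \<psi> (mconst c)) = id" using \<psi>(3) \<phi> by auto
  have "\<psi> p = eval_poly id (\<lambda>i. \<psi> (mvar i)) p" for p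
    using hom_eq_eval_poly[OF hom, of p] unfolding id .
  moreover have "\<psi> q = 0" if "q \<in> Q" for q using that P(2) point_onD(4)[OF \<psi>(1)] by blast
  ultimately show ?thesis using \<psi>(2) by metis
qed

section \<open>The Hilbert basis theorem\<close>

definition span_in :: "'a::comm_ring_1 set \<Rightarrow> 'a set \<Rightarrow> 'a set" where
  "span_in B F = {\<Sum>f\<in>F. b f * f | b. \<forall>f\<in>F. b f \<in> B}"

definition noetherian_set :: "'a::comm_ring_1 set \<Rightarrow> bool" where
  "noetherian_set B \<longleftrightarrow> (\<forall>I. ideal_in B I \<longrightarrow> (\<exists>F. finite F \<and> F \<subseteq> I \<and> I \<subseteq> span_in B F))"

lemma noetherian_setD:
  "noetherian_set B \<Longrightarrow> ideal_in B I \<Longrightarrow> \<exists>F. finite F \<and> F \<subseteq> I \<and> I \<subseteq> span_in B F"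
  by (simp add: noetherian_set_def)

lemma span_in_least:
  assumes "ideal_in B I" "F \<subseteq> I"
  shows "span_in B F \<subseteq> I"
  using assms by (auto simp: span_in_def intro!: ideal_in_sum[OF assms(1)] ideal_inD(4)[OF assms(1)])

lemma ideal_span_in:
  assumes "subring_set B" "F \<subseteq> B"
  shows "ideal_in B (span_in B F)"
  unfolding ideal_in_def
proof (intro conjI ballI)
  note closed = subring_set_closed[OF assms(1)]
  show "span_in B F \<subseteq> B"
    using assms(2) by (auto simp: span_in_def intro!: subring_set_sum[OF assms(1)] closed)
  show "0 \<in> span_in B F" unfolding span_in_def using closed by (force intro: exI[of _ "\<lambda>_. 0"])
  fix x assume "x \<in> span_in B F"
  then obtain b where b: "x = (\<Sum>f\<in>F. b f * f)" "\<forall>f\<in>F. b f \<in> B" by (auto simp: span_in_def)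
  { fix y assume "y \<in> span_in B F"
    then obtain c where c: "y = (\<Sum>f\<in>F. c f * f)" "\<forall>f\<in>F. c f \<in> B" by (auto simp: span_in_def)
    have "x + y = (\<Sum>f\<in>F. (b f + c f) * f)" by (simp add: b c distrib_right sum.distrib)
    then show "x + y \<in> span_in B F" using b c closed unfolding span_in_def
      by (intro CollectI exI[of _ "\<lambda>f. b f + c f"]) auto }
  { fix d assume "d \<in> B"
    moreover have "d * x = (\<Sum>f\<in>F. (d * b f) * f)" by (simp add: b sum_distrib_left mult.assoc)
    ultimately show "d * x \<in> span_in B F" using b closed unfolding span_in_def
      by (intro CollectI exI[of _ "\<lambda>f. d * b f"]) auto }
qed

lemma span_in_superset:
  assumes "subring_set B" "finite F"
  shows "F \<subseteq> span_in B F"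
proof
  fix f assume f: "f \<in> F"
  have "(\<Sum>g\<in>F. (if g = f then 1 else 0) * g) = (\<Sum>g\<in>F. if g = f then f else 0)"
    by (intro sum.cong) auto
  then have "(\<Sum>g\<in>F. (if g = f then 1 else 0) * g) = f" using assms(2) f by simp
  then show "f \<in> span_in B F" using subring_set_closed[OF assms(1)] unfolding span_in_def
    by (intro CollectI exI[of _ "\<lambda>g. if g = f then 1 else 0"]) auto
qed

lemma span_in_mono:
  assumes "subring_set B" "finite G" "F \<subseteq> G" "G \<subseteq> B"
  shows "span_in B F \<subseteq> span_in B G"
  using span_in_least[OF ideal_span_in[OF assms(1,4)]] span_in_superset[OF assms(1,2)] assms(3) by blast

text \<open>
  The ascending chain condition, in the form in which it is applied to leading coefficients.
\<close>

lemma noetherian_sequence: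
  assumes noeth: "noetherian_set B" and B: "subring_set B" and c: "\<And>n::nat. c n \<in> B"
  shows "\<exists>m. c m \<in> span_in B (c ` {..<m})"
proof -
  define I where "I = (\<Union>m. span_in B (c ` {..<m}))"
  note id = ideal_span_in[OF B]
  have cB: "c ` A \<subseteq> B" for A using c by auto
  have mono: "span_in B (c ` {..<m}) \<subseteq> span_in B (c ` {..<n})" if "m \<le> n" for m n
    using that by (intro span_in_mono B cB) auto
  have "ideal_in B I"
    unfolding ideal_in_def
  proof (intro conjI ballI)
    show "I \<subseteq> B" "0 \<in> I" using ideal_inD(1,2)[OF id[OF cB]] by (auto simp: I_def)
    fix x assume "x \<in> I"
    then obtain m where m: "x \<in> span_in B (c ` {..<m})" by (auto simp: I_def)
    { fix y assume "y \<in> I"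
      then obtain n where n: "y \<in> span_in B (c ` {..<n})" by (auto simp: I_def)
      have "x + y \<in> span_in B (c ` {..<max m n})"
        using mono[of m "max m n"] mono[of n "max m n"] m n by (intro ideal_inD(3)[OF id[OF cB]]) auto
      then show "x + y \<in> I" by (auto simp: I_def) }
    { fix b assume "b \<in> B"
      then show "b * x \<in> I" using ideal_inD(4)[OF id[OF cB] _ m] by (auto simp: I_def) }
  qed
  then obtain F where F: "finite F" "F \<subseteq> I" "I \<subseteq> span_in B F"
    using noeth by (auto simp: noetherian_set_def)
  have "\<exists>m. F \<subseteq> span_in B (c ` {..<m})"
    using F(1,2)
  proof (induction F)
    case (insert x F)
    then obtain m n where mn: "F \<subseteq> span_in B (c ` {..<m})" "x \<in> span_in B (c ` {..<n})"
      by (auto simp: I_def)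
    then have "insert x F \<subseteq> span_in B (c ` {..<max m n})"
      using mono[of m "max m n"] mono[of n "max m n"] by auto
    then show ?case by blast
  qed auto
  then obtain m where "F \<subseteq> span_in B (c ` {..<m})" by blast
  then have "I \<subseteq> span_in B (c ` {..<m})"
    using F(3) span_in_least[OF id[OF cB]] by blast
  moreover have "c m \<in> I"
    using span_in_superset[OF B, of "c ` {..<Suc m}"] unfolding I_def by fastforce
  ultimately show ?thesis by blast
qed

text \<open>
  If \<open>I\<close> were not finitely generated, one could choose \<open>f\<^sub>0, f\<^sub>1, \<dots>\<close> in \<open>I\<close>, each of least degree outside
  the ideal of its predecessors.  Some leading coefficient is a combination of the earlier ones, and
  cancelling with it yields an element of smaller degree that is still outside that ideal.
\<close>

theorem hilbert_basis:
  assumes noeth: "noetherian_set B" and B: "subring_set B"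
  shows "noetherian_set (polys B)"
  unfolding noetherian_set_def
proof (intro allI impI, rule ccontr)
  fix I assume I: "ideal_in (polys B) I" and no: "\<not> (\<exists>F. finite F \<and> F \<subseteq> I \<and> I \<subseteq> span_in (polys B) F)"
  note PB = subring_polys[OF B]
  have "\<exists>p. p \<in> I \<and> p \<notin> span_in (polys B) F \<and>
      (\<forall>q. q \<in> I \<and> q \<notin> span_in (polys B) F \<longrightarrow> degree p \<le> degree q)"
    if F: "finite F" "F \<subseteq> I" for F
  proof -
    obtain q where "q \<in> I \<and> q \<notin> span_in (polys B) F" using no F by blast
    then show ?thesis
      using arg_min_nat_lemma[of "\<lambda>p. p \<in> I \<and> p \<notin> span_in (polys B) F" q degree] by blast
  qed
  then obtain pick where pick: "\<And>F. finite F \<Longrightarrow> F \<subseteq> I \<Longrightarrow> pick F \<in> I \<and> pick F \<notin> span_in (polys B) F \<and>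
      (\<forall>q. q \<in> I \<and> q \<notin> span_in (polys B) F \<longrightarrow> degree (pick F) \<le> degree q)"
    by metis
  define S where "S = rec_nat {} (\<lambda>_ F. insert (pick F) F)"
  define f where "f n = pick (S n)" for n
  have S_simps: "S 0 = {}" "S (Suc n) = insert (f n) (S n)" for n by (simp_all add: S_def f_def)
  have S: "finite (S n) \<and> S n \<subseteq> I" for n
    by (induction n) (use pick in \<open>auto simp: S_simps f_def\<close>)
  have f: "f n \<in> I" "f n \<notin> span_in (polys B) (S n)"
    "q \<in> I \<Longrightarrow> q \<notin> span_in (polys B) (S n) \<Longrightarrow> degree (f n) \<le> degree q" for n q
    using pick[of "S n"] S by (auto simp: f_def)
  have Seq: "S n = f ` {..<n}" for n by (induction n) (auto simp: S_simps lessThan_Suc)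
  have IB: "I \<subseteq> polys B" using ideal_inD(1)[OF I] .
  have mono: "span_in (polys B) (S m) \<subseteq> span_in (polys B) (S n)" if "m \<le> n" for m n
    using that S IB by (intro span_in_mono[OF PB]) (auto simp: Seq)
  have deg: "degree (f m) \<le> degree (f n)" if "m \<le> n" for m n
    using f(3)[of "f n" m] f(1,2)[of n] mono[OF that] by blast
  obtain m where "lead_coeff (f m) \<in> span_in B ((\<lambda>n. lead_coeff (f n)) ` {..<m})"
    using noetherian_sequence[OF noeth B, of "\<lambda>n. lead_coeff (f n)"] f(1) IB by (auto intro: polysD)
  moreover have "span_in B ((\<lambda>n. lead_coeff (f n)) ` {..<m}) \<subseteq>
      {\<Sum>n<m. b n * lead_coeff (f n) | b. \<forall>n<m. b n \<in> B}"
  proof -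
    have "ideal_in B {\<Sum>n<m. b n * lead_coeff (f n) | b. \<forall>n<m. b n \<in> B}" (is "ideal_in B ?J")
      unfolding ideal_in_def
    proof (intro conjI ballI)
      note closed = subring_set_closed[OF B]
      show "?J \<subseteq> B" using f(1) IB by (auto intro!: subring_set_sum[OF B] closed polysD)
      show "0 \<in> ?J" using closed by (force intro: exI[of _ "\<lambda>_. 0"])
      fix x assume "x \<in> ?J"
      then obtain b where b: "x = (\<Sum>n<m. b n * lead_coeff (f n))" "\<forall>n<m. b n \<in> B" by auto
      { fix y assume "y \<in> ?J"
        then obtain c where c: "y = (\<Sum>n<m. c n * lead_coeff (f n))" "\<forall>n<m. c n \<in> B" by auto
        show "x + y \<in> ?J" using b c closed
          by (intro CollectI exI[of _ "\<lambda>n. b n + c n"]) (auto simp: distrib_right sum.distrib) }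
      { fix d assume "d \<in> B"
        then show "d * x \<in> ?J" using b closed
          by (intro CollectI exI[of _ "\<lambda>n. d * b n"]) (auto simp: sum_distrib_left mult.assoc) }
    qed
    moreover have "(\<lambda>n. lead_coeff (f n)) ` {..<m} \<subseteq> ?J"
    proof clarify
      fix n assume "n < m"
      then show "\<exists>b. lead_coeff (f n) = (\<Sum>n<m. b n * lead_coeff (f n)) \<and> (\<forall>n<m. b n \<in> B)"
        using subring_set_closed[OF B] by (intro exI[of _ "\<lambda>i. if i = n then 1 else 0"]) (auto simp: if_distrib[of "\<lambda>x. x * _"] cong: if_cong)
    qed
    ultimately show ?thesis by (rule span_in_least)
  qed
  ultimately obtain b where b: "lead_coeff (f m) = (\<Sum>n<m. b n * lead_coeff (f n))" "\<forall>n<m. b n \<in> B" by auto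
  \<comment> \<open>The combination of the earlier polynomials, shifted to equal degree, that cancels the leading term.\<close>
  define g where "g = (\<Sum>n<m. monom (b n) (degree (f m) - degree (f n)) * f n)"
  have g: "g \<in> span_in (polys B) (S m)"
    unfolding g_def
  proof (rule ideal_in_sum[OF ideal_span_in[OF PB]])
    show "S m \<subseteq> polys B" using S IB by blast
    fix n assume "n \<in> {..<m}"
    then show "monom (b n) (degree (f m) - degree (f n)) * f n \<in> span_in (polys B) (S m)"
      using S IB b(2) span_in_superset[OF PB, of "S m"]
      by (intro ideal_inD(4)[OF ideal_span_in[OF PB]] monom_polys B) (auto simp: Seq)
  qed
  have gI: "g \<in> I" using g span_in_least[OF I] S by blast
  have fg: "f m - g \<in> I" using ideal_in_diff[OF PB I f(1) gI] .
  have "f m - g \<notin> span_in (polys B) (S m)"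
  proof
    assume "f m - g \<in> span_in (polys B) (S m)"
    then have "(f m - g) + g \<in> span_in (polys B) (S m)"
      using g S IB by (intro ideal_inD(3)[OF ideal_span_in[OF PB]]) auto
    then show False using f(2) by simp
  qed
  then have le: "degree (f m) \<le> degree (f m - g)" using f(3) fg by blast
  have gdeg: "degree g \<le> degree (f m)"
    unfolding g_def
  proof (intro degree_sum_le)
    fix n assume "n \<in> {..<m}"
    then have "degree (f n) \<le> degree (f m)" using deg by auto
    moreover have "degree (monom (b n) (degree (f m) - degree (f n)) * f n)
        \<le> (degree (f m) - degree (f n)) + degree (f n)"
      by (rule order_trans[OF degree_mult_le]) (intro add_mono degree_monom_le order_refl)
    ultimately show "degree (monom (b n) (degree (f m) - degree (f n)) * f n) \<le> degree (f m)" by simp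
  qed auto
  have "coeff g (degree (f m)) = (\<Sum>n<m. b n * lead_coeff (f n))"
    unfolding g_def coeff_sum
  proof (intro sum.cong refl)
    fix n assume "n \<in> {..<m}"
    then have "degree (f n) \<le> degree (f m)" using deg by auto
    then show "coeff (monom (b n) (degree (f m) - degree (f n)) * f n) (degree (f m)) = b n * lead_coeff (f n)"
      by (subst coeff_monom_mult) auto
  qed
  then have top: "coeff (f m - g) (degree (f m)) = 0" using b(1) by simp
  have "degree (f m - g) \<le> degree (f m)" using gdeg by (intro degree_diff_le) auto
  with le have "degree (f m - g) = degree (f m)" by simp
  then have "f m - g = 0" using top by (metis leading_coeff_0_iff)
  then show False using g f(2)[of m] by simp
qed

lemma noetherian_image:
  assumes noeth: "noetherian_set B" and B: "subring_set B" and h: "unital_hom h"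
  shows "noetherian_set (h ` B)"
  unfolding noetherian_set_def
proof (intro allI impI)
  fix I assume I: "ideal_in (h ` B) I"
  have hB: "subring_set (h ` B)" by (rule subring_image[OF B]) (use unital_homD[OF h] in auto)
  have "ideal_in B {x \<in> B. h x \<in> I}"
    unfolding ideal_in_def using ideal_inD[OF I] subring_set_closed[OF B] unital_homD[OF h] by auto
  from noetherian_setD[OF noeth this]
  obtain F where F: "finite F" "F \<subseteq> {x \<in> B. h x \<in> I}" "{x \<in> B. h x \<in> I} \<subseteq> span_in B F"
    by (elim exE conjE)
  have "h x \<in> span_in (h ` B) (h ` F)" if "x \<in> span_in B F" for x
  proof -
    obtain b where b: "x = (\<Sum>f\<in>F. b f * f)" "\<forall>f\<in>F. b f \<in> B" using \<open>x \<in> span_in B F\<close> by (auto simp: span_in_def)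
    have sub: "h ` F \<subseteq> h ` B" using F by auto
    have "(\<Sum>f\<in>F. h (b f) * h f) \<in> span_in (h ` B) (h ` F)"
      using b(2) span_in_superset[OF hB finite_imageI[OF F(1)], of h]
      by (intro ideal_in_sum[OF ideal_span_in[OF hB sub]] ideal_inD(4)[OF ideal_span_in[OF hB sub]]) auto
    then show ?thesis by (simp add: b(1) unital_homD[OF h])
  qed
  then have "I \<subseteq> span_in (h ` B) (h ` F)" using F(3) ideal_inD(1)[OF I] by blast
  then show "\<exists>F. finite F \<and> F \<subseteq> I \<and> I \<subseteq> span_in (h ` B) F"
    using F(1,2) by (intro exI[of _ "h ` F"]) auto
qed

lemma noetherian_field_image:
  fixes h :: "'k::field \<Rightarrow> 'a::comm_ring_1"
  assumes h: "unital_hom h"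
  shows "noetherian_set (range h)"
  unfolding noetherian_set_def
proof (intro allI impI)
  fix I assume I: "ideal_in (range h) I"
  show "\<exists>F. finite F \<and> F \<subseteq> I \<and> I \<subseteq> span_in (range h) F"
  proof (cases "I \<subseteq> {0}")
    case True
    then show ?thesis by (intro exI[of _ "{}"]) (auto simp: span_in_def)
  next
    case False
    then obtain x where x: "x \<in> I" "x \<noteq> 0" by blast
    then obtain c where c: "x = h c" using ideal_inD(1)[OF I] by blast
    then have "c \<noteq> 0" using x(2) unital_homD[OF h] by auto
    then have "h (inverse c) * x = 1" using unital_homD(3)[OF h, of "inverse c" c] c unital_homD(1)[OF h] by simp
    then have "1 \<in> I" using ideal_inD(4)[OF I _ x(1), of "h (inverse c)"] by auto
    moreover have "I \<subseteq> span_in (range h) {1}" using ideal_inD(1)[OF I] by (auto simp: span_in_def)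
    ultimately show ?thesis by (intro exI[of _ "{1}"]) auto
  qed
qed

lemma noetherian_adjoin_list:
  assumes "noetherian_set B" "subring_set B"
  shows "noetherian_set (adjoin_list B xs)"
proof (induction xs)
  case (Cons x xs)
  have "unital_hom (\<lambda>p. poly p x)" by (simp add: unital_hom_def)
  then show ?case
    unfolding adjoin_list.simps adjoin_def
    by (intro noetherian_image subring_polys hilbert_basis subring_adjoin_list Cons.IH assms(2))
qed (use assms in simp)

section \<open>Nil ideals of Noetherian rings\<close>

text \<open>
  Induction on the number of generators.  Suppose that products of \<open>k\<close> elements vanish for the
  ideal generated by \<open>F\<close>, and that \<open>y\<^sup>e = 0\<close>.  Modulo \<open>y\<close>, a product of \<open>k\<close> elements of the ideal generated by
  \<open>F\<close> and \<open>y\<close> is a product of \<open>k\<close> elements of the former ideal, so it is a multiple of \<open>y\<close>; hence a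
  product of \<open>e * k\<close> elements is a multiple of \<open>y\<^sup>e\<close>.
\<close>

lemma nil_ideal_product_zero:
  assumes noeth: "noetherian_set B" and B: "subring_set B" and I: "ideal_in B I"
    and nil: "\<And>x. x \<in> I \<Longrightarrow> \<exists>k::nat. x ^ k = 0"
  shows "\<exists>k. \<forall>xs. length xs = k \<and> set xs \<subseteq> I \<longrightarrow> prod_list xs = 0"
proof -
  have BI: "I \<subseteq> B" using ideal_inD(1)[OF I] .
  note closed = subring_set_closed[OF B]
  have prod_closed: "prod_list xs \<in> B" if "set xs \<subseteq> B" for xs
    using that by (induction xs) (auto intro: closed)
  have key: "\<exists>k. \<forall>xs. length xs = k \<and> set xs \<subseteq> span_in B F \<longrightarrow> prod_list xs = 0" if "finite F" "F \<subseteq> I" for F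
    using that
  proof (induction F)
    case empty
    have "prod_list xs = 0" if "length xs = 1" "set xs \<subseteq> span_in B {}" for xs
      using that by (auto simp: span_in_def length_Suc_conv)
    then show ?case by blast
  next
    case (insert y F)
    then obtain k where k: "\<And>xs. length xs = k \<Longrightarrow> set xs \<subseteq> span_in B F \<Longrightarrow> prod_list xs = 0" by blast
    obtain e where e: "y ^ e = 0" using nil insert.prems by blast
    have split: "\<exists>u\<in>span_in B F. \<exists>c\<in>B. x = u + c * y" if "x \<in> span_in B (insert y F)" for x
    proof -
      obtain b where b: "x = (\<Sum>f\<in>insert y F. b f * f)" "\<forall>f\<in>insert y F. b f \<in> B"
        using \<open>x \<in> _\<close> by (auto simp: span_in_def)
      then have "x = (\<Sum>f\<in>F. b f * f) + b y * y" using insert.hyps by simp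
      then show ?thesis using b(2) by (intro bexI[of _ "\<Sum>f\<in>F. b f * f"] bexI[of _ "b y"]) (auto simp: span_in_def)
    qed
    have sF: "span_in B F \<subseteq> B" using ideal_inD(1)[OF ideal_span_in[OF B]] insert.prems BI by blast
    have yB: "y \<in> B" using insert.prems BI by blast
    have block: "\<exists>us. length us = length xs \<and> set us \<subseteq> span_in B F \<and> (\<exists>c\<in>B. prod_list xs = prod_list us + c * y)"
      if "set xs \<subseteq> span_in B (insert y F)" for xs
      using that
    proof (induction xs)
      case Nil
      then show ?case using closed(1) by (intro exI[of _ "[]"] conjI bexI[of _ 0]) auto
    next
      case (Cons x xs)
      then obtain us c where us: "length us = length xs" "set us \<subseteq> span_in B F" "c \<in> B" "prod_list xs = prod_list us + c * y"
        by auto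
      have "x \<in> span_in B (insert y F)" using Cons.prems by simp
      from split[OF this] obtain u d where u: "u \<in> span_in B F" "d \<in> B" "x = u + d * y" by blast
      have "prod_list (x # xs) = prod_list (u # us) + (u * c + d * prod_list us + d * c * y) * y"
        by (simp add: us u algebra_simps)
      moreover have "u * c + d * prod_list us + d * c * y \<in> B"
        using us u sF yB by (intro closed prod_closed) auto
      ultimately show ?case using us u by (intro exI[of _ "u # us"]) auto
    qed
    have blocks: "\<exists>c\<in>B. prod_list xs = c * y ^ j" if "set xs \<subseteq> span_in B (insert y F)" "length xs = j * k" for j xs
      using that
    proof (induction j arbitrary: xs)
      case 0
      then show ?case using closed by auto
    next
      case (Suc j)
      have "set (take k xs) \<subseteq> span_in B (insert y F)" using Suc.prems(1) set_take_subset by fast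
      then obtain us c where us: "length us = length (take k xs)" "set us \<subseteq> span_in B F" "c \<in> B"
        "prod_list (take k xs) = prod_list us + c * y" using block by blast
      have "prod_list us = 0" using us Suc.prems by (intro k) auto
      then have t: "prod_list (take k xs) = c * y" using us by simp
      obtain d where d: "d \<in> B" "prod_list (drop k xs) = d * y ^ j"
        using Suc.IH[of "drop k xs"] Suc.prems set_drop_subset[of k xs] by auto
      have "prod_list xs = prod_list (take k xs) * prod_list (drop k xs)"
        by (metis append_take_drop_id prod_list.append)
      then show ?case using t d us(3) closed by (intro bexI[of _ "c * d"]) (auto simp: algebra_simps)
    qed
    have "\<forall>xs. length xs = e * k \<and> set xs \<subseteq> span_in B (insert y F) \<longrightarrow> prod_list xs = 0"
      using blocks[of _ e] e by fastforce
    then show ?case by blast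
  qed
  obtain F where "finite F" "F \<subseteq> I" "I \<subseteq> span_in B F" 
    using noetherian_setD[OF noeth I] by (elim exE conjE)
  then show ?thesis using key[of F] by (meson subset_trans)
qed


section \<open>Tensor products of algebras\<close>

lemma frag_extend_fun_diff:
  "frag_extend (\<lambda>p. f p - g p) u = frag_extend f u - frag_extend g u"
  using subset_UNIV[of "Poly_Mapping.keys u"]
  by (induction u rule: frag_induction) (auto simp: frag_extend_diff)

text \<open>
  The map on formal sums through which \<open>tensor_lift\<close> is defined on cosets.
\<close>

definition frag_lift :: "('k, 't) module \<Rightarrow> ('a \<Rightarrow> 'b \<Rightarrow> 't) \<Rightarrow> (('a \<times> 'b) \<Rightarrow>\<^sub>0 int) \<Rightarrow> 't" where
  "frag_lift T \<beta> u = (\<Oplus>\<^bsub>T\<^esub>p\<in>Poly_Mapping.keys u.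
     add_pow T (Poly_Mapping.lookup u p) (\<beta> (fst p) (snd p)))"

lemma tensor_lift_eq: "tensor_lift T \<beta> t = the_elem (frag_lift T \<beta> ` t)"
  by (simp add: tensor_lift_def frag_lift_def)

lemma cring_same_operations:
  assumes "cring Q" and eq: "carrier T = carrier Q" "mult T = mult Q" "one T = one Q"
    "zero T = zero Q" "add T = add Q"
  shows "cring T"
proof -
  interpret Q: cring Q by fact
  show ?thesis
  proof (rule cringI)
    show "abelian_group T"
      by (rule abelian_groupI) (auto simp: eq Q.a_ac intro: Q.l_neg)
    show "comm_monoid T"
      by (rule comm_monoidI) (auto simp: eq Q.m_ac)
  qed (auto simp: eq Q.l_distr)
qed

lemma (in abelian_group) minus_eq_zero_iff:
  "x \<in> carrier G \<Longrightarrow> y \<in> carrier G \<Longrightarrow> x \<ominus> y = \<zero> \<longleftrightarrow> x = y"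
  by (metis a_minus_def a_inv_closed add.inv_equality add.inv_inv r_neg)

lemma (in abelian_group) add_minus_cancel:
  "x \<in> carrier G \<Longrightarrow> y \<in> carrier G \<Longrightarrow> (x \<oplus> y) \<ominus> x \<ominus> y = \<zero>"
proof -
  assume xy: "x \<in> carrier G" "y \<in> carrier G"
  then have "(x \<oplus> y) \<ominus> x = y \<oplus> (x \<oplus> \<ominus> x)" by (simp add: a_minus_def a_ac)
  then show ?thesis using xy by (simp add: r_neg minus_eq_zero_iff)
qed

text \<open>
  The records \<open>formal_tensors\<close> and \<open>tensor_product\<close> are shown to be rings; generated ideals and
  quotients have their intended meaning only after this is known.
\<close>

locale algebra_pair = A: algebra K A + B: algebra K B
  for K :: "('k, 'k) module" and A :: "('k, 'a) module" and B :: "('k, 'b) module"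
begin

abbreviation "F \<equiv> formal_tensors A B"
abbreviation "I \<equiv> tensor_ideal K A B"
abbreviation "T \<equiv> tensor_product K A B"
abbreviation "pure \<equiv> pure_tensor K A B"

lemma formal_simps:
  "carrier F = {u. Poly_Mapping.keys u \<subseteq> carrier A \<times> carrier B}"
  "one F = frag_of (\<one>\<^bsub>A\<^esub>, \<one>\<^bsub>B\<^esub>)" "zero F = 0" "add F = (+)"
  by (simp_all add: formal_tensors_def)

lemma formal_mult_of:
  "frag_of (a, b) \<otimes>\<^bsub>F\<^esub> frag_of (a', b') = frag_of (a \<otimes>\<^bsub>A\<^esub> a', b \<otimes>\<^bsub>B\<^esub> b')"
  by (simp add: formal_tensors_def)

lemma formal_mult_diff:
  "(u - u') \<otimes>\<^bsub>F\<^esub> v = (u \<otimes>\<^bsub>F\<^esub> v) - (u' \<otimes>\<^bsub>F\<^esub> v)"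
  "u \<otimes>\<^bsub>F\<^esub> (v - v') = (u \<otimes>\<^bsub>F\<^esub> v) - (u \<otimes>\<^bsub>F\<^esub> v')"
  "u \<otimes>\<^bsub>F\<^esub> 0 = 0" "0 \<otimes>\<^bsub>F\<^esub> v = 0"
  by (simp_all add: formal_tensors_def frag_extend_diff frag_extend_fun_diff frag_extend_eq_0)

text \<open>
  All structure on formal sums is biadditive, so identities need only be checked on pairs.
\<close>

lemma formal_induct [consumes 1, case_names zero of diff]:
  assumes "u \<in> carrier F" "P 0" "\<And>a b. a \<in> carrier A \<Longrightarrow> b \<in> carrier B \<Longrightarrow> P (frag_of (a, b))"
    "\<And>u v. u \<in> carrier F \<Longrightarrow> v \<in> carrier F \<Longrightarrow> P u \<Longrightarrow> P v \<Longrightarrow> P (u - v)"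
  shows "P u"
proof -
  have closed: "u - v \<in> carrier F" if "u \<in> carrier F" "v \<in> carrier F" for u v
    using that keys_diff[of u v] by (auto simp: formal_simps)
  have "Poly_Mapping.keys u \<subseteq> carrier A \<times> carrier B" using assms(1) by (simp add: formal_simps)
  then have "u \<in> carrier F \<and> P u"
    by (induction u rule: frag_induction)
      (use assms closed in \<open>auto simp: formal_simps\<close>)
  then show ?thesis ..
qed

lemma formal_diff_closed: "u \<in> carrier F \<Longrightarrow> v \<in> carrier F \<Longrightarrow> u - v \<in> carrier F"
  using keys_diff[of u v] by (auto simp: formal_simps)

lemma formal_of_closed: "a \<in> carrier A \<Longrightarrow> b \<in> carrier B \<Longrightarrow> frag_of (a, b) \<in> carrier F"
  by (simp add: formal_simps)

lemma formal_cring: "cring F"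
proof (rule cringI)
  have mult_closed: "u \<otimes>\<^bsub>F\<^esub> v \<in> carrier F" if "u \<in> carrier F" "v \<in> carrier F" for u v
    using that(1)
  proof (induction u rule: formal_induct)
    case zero
    then show ?case by (simp add: formal_mult_diff formal_simps)
  next
    case (of a b)
    show ?case using that(2)
    proof (induction v rule: formal_induct)
      case zero
      then show ?case by (simp add: formal_mult_diff formal_simps)
    qed (use of in \<open>simp_all add: formal_mult_of formal_mult_diff formal_of_closed formal_diff_closed\<close>)
  qed (simp add: formal_mult_diff formal_diff_closed)
  show "abelian_group F"
  proof (rule abelian_groupI)
    fix u v assume "u \<in> carrier F" "v \<in> carrier F"
    then show "u \<oplus>\<^bsub>F\<^esub> v \<in> carrier F" using keys_add[of u v] by (auto simp: formal_simps)
  next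
    fix u assume "u \<in> carrier F"
    then show "\<exists>v\<in>carrier F. v \<oplus>\<^bsub>F\<^esub> u = \<zero>\<^bsub>F\<^esub>"
      by (intro bexI[of _ "- u"]) (auto simp: formal_simps)
  qed (auto simp: formal_simps)
  show "comm_monoid F"
  proof (rule comm_monoidI)
    fix u v assume uv: "u \<in> carrier F" "v \<in> carrier F"
    show "u \<otimes>\<^bsub>F\<^esub> v \<in> carrier F" using mult_closed uv .
    show "u \<otimes>\<^bsub>F\<^esub> v = v \<otimes>\<^bsub>F\<^esub> u" using uv(1)
    proof (induction u rule: formal_induct)
      case (of a b)
      show ?case using uv(2)
        by (induction v rule: formal_induct)
          (use of in \<open>simp_all add: formal_mult_diff formal_mult_of A.m_comm B.m_comm\<close>)
    qed (simp_all add: formal_mult_diff)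
    fix w assume w: "w \<in> carrier F"
    show "(u \<otimes>\<^bsub>F\<^esub> v) \<otimes>\<^bsub>F\<^esub> w = u \<otimes>\<^bsub>F\<^esub> (v \<otimes>\<^bsub>F\<^esub> w)" using uv(1)
    proof (induction u rule: formal_induct)
      case o1: (of a b)
      show ?case using uv(2)
      proof (induction v rule: formal_induct)
        case o2: (of a' b')
        show ?case using w
          by (induction w rule: formal_induct)
            (use o1 o2 in \<open>simp_all add: formal_mult_diff formal_mult_of A.m_assoc B.m_assoc\<close>)
      qed (simp_all add: formal_mult_diff)
    qed (simp_all add: formal_mult_diff)
  next
    fix u assume "u \<in> carrier F"
    then show "\<one>\<^bsub>F\<^esub> \<otimes>\<^bsub>F\<^esub> u = u"
      by (induction u rule: formal_induct)
        (simp_all add: formal_mult_diff formal_mult_of formal_simps(2))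
  qed (auto simp: formal_simps)
  fix u v w assume "u \<in> carrier F" "v \<in> carrier F" "w \<in> carrier F"
  have "(u - (0 - v)) \<otimes>\<^bsub>F\<^esub> w = u \<otimes>\<^bsub>F\<^esub> w - (0 - v \<otimes>\<^bsub>F\<^esub> w)"
    by (simp only: formal_mult_diff)
  then show "(u \<oplus>\<^bsub>F\<^esub> v) \<otimes>\<^bsub>F\<^esub> w = u \<otimes>\<^bsub>F\<^esub> w \<oplus>\<^bsub>F\<^esub> v \<otimes>\<^bsub>F\<^esub> w"
    by (simp add: formal_simps)
qed

sublocale F: cring F by (rule formal_cring)

lemma relations_closed: "tensor_relations K A B \<subseteq> carrier F"
  unfolding tensor_relations_def
  by (auto intro!: formal_diff_closed formal_of_closed)

lemma tensor_ideal: "ideal I F"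
  unfolding tensor_ideal_def by (rule F.genideal_ideal[OF relations_closed])

sublocale I: ideal I F by (rule tensor_ideal)

lemma tensor_simps:
  "carrier T = carrier (F Quot I)" "mult T = mult (F Quot I)" "one T = one (F Quot I)"
  "zero T = zero (F Quot I)" "add T = add (F Quot I)"
  "c \<odot>\<^bsub>T\<^esub> t = pure (c \<odot>\<^bsub>A\<^esub> \<one>\<^bsub>A\<^esub>) \<one>\<^bsub>B\<^esub> \<otimes>\<^bsub>T\<^esub> t"
  by (simp_all add: tensor_product_def Let_def)

lemma tensor_cring: "cring T"
  by (rule cring_same_operations[OF I.quotient_is_cring[OF formal_cring]]) (rule tensor_simps)+

sublocale T: cring T by (rule tensor_cring)

abbreviation coset where "coset u \<equiv> I +>\<^bsub>F\<^esub> u"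

lemma coset_hom: "coset \<in> ring_hom F T"
  using I.rcos_ring_hom by (simp add: ring_hom_def tensor_simps)

lemma coset_closed: "u \<in> carrier F \<Longrightarrow> coset u \<in> carrier T"
  using coset_hom by (auto simp: ring_hom_def)

lemma coset_simps:
  assumes "u \<in> carrier F" "v \<in> carrier F"
  shows "coset u \<in> carrier T" "coset (u \<otimes>\<^bsub>F\<^esub> v) = coset u \<otimes>\<^bsub>T\<^esub> coset v"
    "coset (u + v) = coset u \<oplus>\<^bsub>T\<^esub> coset v" "coset (u - v) = coset u \<ominus>\<^bsub>T\<^esub> coset v"
    "coset \<one>\<^bsub>F\<^esub> = \<one>\<^bsub>T\<^esub>" "coset 0 = \<zero>\<^bsub>T\<^esub>"
proof -
  show cl: "coset u \<in> carrier T" and "coset (u \<otimes>\<^bsub>F\<^esub> v) = coset u \<otimes>\<^bsub>T\<^esub> coset v"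
    and add: "coset (u + v) = coset u \<oplus>\<^bsub>T\<^esub> coset v" and "coset \<one>\<^bsub>F\<^esub> = \<one>\<^bsub>T\<^esub>"
    using coset_hom assms by (auto simp: ring_hom_def formal_simps(4))
  show "coset 0 = \<zero>\<^bsub>T\<^esub>"
    using ring_hom_zero[OF coset_hom F.ring_axioms T.ring_axioms] by (simp add: formal_simps)
  have d: "u - v \<in> carrier F" by (rule formal_diff_closed[OF assms])
  have "coset ((u - v) + v) = coset (u - v) \<oplus>\<^bsub>T\<^esub> coset v"
    using ring_hom_add[OF coset_hom d assms(2)] by (simp only: formal_simps(4))
  moreover have "coset v \<in> carrier T" "coset (u - v) \<in> carrier T"
    using coset_hom assms d by (auto simp: ring_hom_def)
  ultimately show "coset (u - v) = coset u \<ominus>\<^bsub>T\<^esub> coset v"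
    by (simp add: a_minus_def T.a_assoc T.r_neg)
qed

lemma tensor_obtain:
  assumes "t \<in> carrier T"
  obtains u where "u \<in> carrier F" "t = coset u"
  using assms by (auto simp: tensor_simps FactRing_def A_RCOSETS_def' a_r_coset_def')

lemma pure_eq: "pure a b = coset (frag_of (a, b))"
  by (simp add: pure_tensor_def)

lemma pure_closed [simp, intro]: "a \<in> carrier A \<Longrightarrow> b \<in> carrier B \<Longrightarrow> pure a b \<in> carrier T"
  unfolding pure_eq by (intro coset_closed formal_of_closed)

lemma pure_mult:
  assumes "a \<in> carrier A" "b \<in> carrier B" "a' \<in> carrier A" "b' \<in> carrier B"
  shows "pure a b \<otimes>\<^bsub>T\<^esub> pure a' b' = pure (a \<otimes>\<^bsub>A\<^esub> a') (b \<otimes>\<^bsub>B\<^esub> b')"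
  unfolding pure_eq using assms
  by (subst coset_simps(2)[symmetric]) (auto simp: formal_of_closed formal_mult_of)

lemma pure_one: "pure \<one>\<^bsub>A\<^esub> \<one>\<^bsub>B\<^esub> = \<one>\<^bsub>T\<^esub>"
  unfolding pure_eq using coset_simps(5) formal_simps(2) F.one_closed by metis

lemma coset_ideal: "u \<in> I \<Longrightarrow> coset u = \<zero>\<^bsub>T\<^esub>"
  using I.a_rcos_const by (simp add: tensor_simps FactRing_def)

lemma relation_coset:
  assumes "x - y - z \<in> tensor_relations K A B" "x \<in> carrier F" "y \<in> carrier F" "z \<in> carrier F"
  shows "coset x = coset y \<oplus>\<^bsub>T\<^esub> coset z"
proof -
  have "x - y - z \<in> I"
    using assms(1) F.genideal_self[OF relations_closed] unfolding tensor_ideal_def by blast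
  then have z: "coset (x - y - z) = \<zero>\<^bsub>T\<^esub>" by (rule coset_ideal)
  have "coset ((x - y - z) + (y + z)) = coset (x - y - z) \<oplus>\<^bsub>T\<^esub> coset (y + z)"
    using assms(2-4) F.a_closed[of y z] by (intro coset_simps(3) formal_diff_closed) (simp_all add: formal_simps(4))
  then show ?thesis using z coset_simps(3)[OF assms(3,4)] coset_closed[OF assms(3)] coset_closed[OF assms(4)]
    by simp
qed

lemma pure_add_left:
  assumes "a \<in> carrier A" "a' \<in> carrier A" "b \<in> carrier B"
  shows "pure (a \<oplus>\<^bsub>A\<^esub> a') b = pure a b \<oplus>\<^bsub>T\<^esub> pure a' b"
  unfolding pure_eq using assms
  by (intro relation_coset formal_of_closed) (auto simp: tensor_relations_def)

lemma pure_add_right: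
  assumes "a \<in> carrier A" "b \<in> carrier B" "b' \<in> carrier B"
  shows "pure a (b \<oplus>\<^bsub>B\<^esub> b') = pure a b \<oplus>\<^bsub>T\<^esub> pure a b'"
  unfolding pure_eq using assms
  by (intro relation_coset formal_of_closed) (auto simp: tensor_relations_def)

lemma pure_balanced:
  assumes "c \<in> carrier K" "a \<in> carrier A" "b \<in> carrier B"
  shows "pure (c \<odot>\<^bsub>A\<^esub> a) b = pure a (c \<odot>\<^bsub>B\<^esub> b)"
proof -
  have "frag_of (c \<odot>\<^bsub>A\<^esub> a, b) - frag_of (a, c \<odot>\<^bsub>B\<^esub> b) \<in> tensor_relations K A B"
    using assms unfolding tensor_relations_def by blast
  then have "frag_of (c \<odot>\<^bsub>A\<^esub> a, b) - frag_of (a, c \<odot>\<^bsub>B\<^esub> b) \<in> I"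
    using F.genideal_self[OF relations_closed] unfolding tensor_ideal_def by blast
  from coset_ideal[OF this] have "pure (c \<odot>\<^bsub>A\<^esub> a) b \<ominus>\<^bsub>T\<^esub> pure a (c \<odot>\<^bsub>B\<^esub> b) = \<zero>\<^bsub>T\<^esub>"
    unfolding pure_eq using assms by (subst (asm) coset_simps(4)) (auto intro!: formal_of_closed)
  then show ?thesis using assms by (subst (asm) T.minus_eq_zero_iff) auto
qed

lemma pure_zero:
  assumes "b \<in> carrier B"
  shows "pure \<zero>\<^bsub>A\<^esub> b = \<zero>\<^bsub>T\<^esub>"
  using pure_add_left[of "\<zero>\<^bsub>A\<^esub>" "\<zero>\<^bsub>A\<^esub>" b] assms T.add.r_cancel_one'[of "pure \<zero>\<^bsub>A\<^esub> b" "pure \<zero>\<^bsub>A\<^esub> b"]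
  by simp

lemma pure_minus_left:
  assumes "a \<in> carrier A" "b \<in> carrier B"
  shows "pure (\<ominus>\<^bsub>A\<^esub> a) b = \<ominus>\<^bsub>T\<^esub> pure a b"
  using pure_add_left[of "\<ominus>\<^bsub>A\<^esub> a" a b] assms pure_zero[of b]
  by (intro T.minus_equality[symmetric]) (simp_all add: A.l_neg)

lemma tensor_smult_closed:
  "c \<in> carrier K \<Longrightarrow> t \<in> carrier T \<Longrightarrow> c \<odot>\<^bsub>T\<^esub> t \<in> carrier T"
  by (simp add: tensor_simps(6))

text \<open>
  Differences suffice in place of sums and negatives, since the induction is applied to properties
  that hold for the zero tensor.
\<close>

lemma tensor_induct [consumes 1, case_names zero pure diff]:
  assumes "t \<in> carrier T" "P \<zero>\<^bsub>T\<^esub>" "\<And>a b. a \<in> carrier A \<Longrightarrow> b \<in> carrier B \<Longrightarrow> P (pure a b)"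
    "\<And>s t. s \<in> carrier T \<Longrightarrow> t \<in> carrier T \<Longrightarrow> P s \<Longrightarrow> P t \<Longrightarrow> P (s \<ominus>\<^bsub>T\<^esub> t)"
  shows "P t"
proof -
  obtain u where u: "u \<in> carrier F" "t = coset u" using assms(1) by (rule tensor_obtain)
  from u(1) have "P (coset u)"
  proof (induction u rule: formal_induct)
    case zero
    then show ?case using assms(2) coset_simps(6) F.zero_closed by metis
  qed (use assms(3,4) in \<open>auto simp: coset_simps pure_eq\<close>)
  then show ?thesis using u by simp
qed

end

text \<open>
  The universal property of the tensor product of algebras: a balanced biadditive map that is also
  multiplicative and unital induces a ring homomorphism, because its extension to formal sums kills
  the relations.
\<close>

locale balanced_map = algebra_pair K A B + T': cring T'
  for K :: "('k, 'k) module" and A :: "('k, 'a) module" and B :: "('k, 'b) module"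
    and T' :: "('k, 't) module" +
  fixes \<beta> :: "'a \<Rightarrow> 'b \<Rightarrow> 't"
  assumes \<beta>_closed: "a \<in> carrier A \<Longrightarrow> b \<in> carrier B \<Longrightarrow> \<beta> a b \<in> carrier T'"
    and \<beta>_add_left: "a \<in> carrier A \<Longrightarrow> a' \<in> carrier A \<Longrightarrow> b \<in> carrier B \<Longrightarrow>
      \<beta> (a \<oplus>\<^bsub>A\<^esub> a') b = \<beta> a b \<oplus>\<^bsub>T'\<^esub> \<beta> a' b"
    and \<beta>_add_right: "a \<in> carrier A \<Longrightarrow> b \<in> carrier B \<Longrightarrow> b' \<in> carrier B \<Longrightarrow>
      \<beta> a (b \<oplus>\<^bsub>B\<^esub> b') = \<beta> a b \<oplus>\<^bsub>T'\<^esub> \<beta> a b'"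
    and \<beta>_balanced: "c \<in> carrier K \<Longrightarrow> a \<in> carrier A \<Longrightarrow> b \<in> carrier B \<Longrightarrow>
      \<beta> (c \<odot>\<^bsub>A\<^esub> a) b = \<beta> a (c \<odot>\<^bsub>B\<^esub> b)"
    and \<beta>_mult: "a \<in> carrier A \<Longrightarrow> b \<in> carrier B \<Longrightarrow> a' \<in> carrier A \<Longrightarrow> b' \<in> carrier B \<Longrightarrow>
      \<beta> (a \<otimes>\<^bsub>A\<^esub> a') (b \<otimes>\<^bsub>B\<^esub> b') = \<beta> a b \<otimes>\<^bsub>T'\<^esub> \<beta> a' b'"
    and \<beta>_one: "\<beta> \<one>\<^bsub>A\<^esub> \<one>\<^bsub>B\<^esub> = \<one>\<^bsub>T'\<^esub>"
begin

declare \<beta>_closed [simp]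

lemma frag_lift_superset:
  assumes "finite D" "Poly_Mapping.keys u \<subseteq> D" "D \<subseteq> carrier A \<times> carrier B"
  shows "frag_lift T' \<beta> u = (\<Oplus>\<^bsub>T'\<^esub>p\<in>D. add_pow T' (Poly_Mapping.lookup u p) (\<beta> (fst p) (snd p)))"
  unfolding frag_lift_def using assms
  by (intro T'.add.finprod_mono_neutral_cong_left) (auto simp: in_keys_iff add_pow_def[of _ "0::int"] intro!: T'.add.int_pow_closed)

lemma frag_lift_closed: "u \<in> carrier F \<Longrightarrow> frag_lift T' \<beta> u \<in> carrier T'"
  unfolding frag_lift_def by (rule T'.finsum_closed) (auto simp: formal_simps intro!: \<beta>_closed T'.add.int_pow_closed)

lemma frag_lift_add:
  assumes "u \<in> carrier F" "v \<in> carrier F"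
  shows "frag_lift T' \<beta> (u + v) = frag_lift T' \<beta> u \<oplus>\<^bsub>T'\<^esub> frag_lift T' \<beta> v"
proof -
  let ?D = "Poly_Mapping.keys u \<union> Poly_Mapping.keys v"
  have D: "?D \<subseteq> carrier A \<times> carrier B" "finite ?D" using assms by (auto simp: formal_simps)
  have "frag_lift T' \<beta> (u + v) = (\<Oplus>\<^bsub>T'\<^esub>p\<in>?D. add_pow T' (Poly_Mapping.lookup u p) (\<beta> (fst p) (snd p))
      \<oplus>\<^bsub>T'\<^esub> add_pow T' (Poly_Mapping.lookup v p) (\<beta> (fst p) (snd p)))"
    unfolding frag_lift_superset[OF D(2) keys_add D(1)]
    using D(1) by (intro T'.finsum_cong') (auto simp: lookup_add T'.add.int_pow_mult intro!: \<beta>_closed T'.add.int_pow_closed)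
  also have "\<dots> = frag_lift T' \<beta> u \<oplus>\<^bsub>T'\<^esub> frag_lift T' \<beta> v"
    using D frag_lift_superset[OF D(2) _ D(1), of u] frag_lift_superset[OF D(2) _ D(1), of v]
    by (subst T'.finsum_addf) (auto intro!: \<beta>_closed T'.add.int_pow_closed)
  finally show ?thesis .
qed

lemma frag_lift_zero: "frag_lift T' \<beta> 0 = \<zero>\<^bsub>T'\<^esub>"
  by (simp add: frag_lift_def)

lemma frag_lift_diff:
  assumes "u \<in> carrier F" "v \<in> carrier F"
  shows "frag_lift T' \<beta> (u - v) = frag_lift T' \<beta> u \<ominus>\<^bsub>T'\<^esub> frag_lift T' \<beta> v"
proof -
  have d: "u - v \<in> carrier F" by (rule formal_diff_closed[OF assms])
  show ?thesis
    using frag_lift_add[OF d assms(2)] frag_lift_closed[OF d] frag_lift_closed[OF assms(2)]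
    by (simp add: a_minus_def T'.a_assoc T'.r_neg)
qed

lemma frag_lift_of:
  assumes "a \<in> carrier A" "b \<in> carrier B"
  shows "frag_lift T' \<beta> (frag_of (a, b)) = \<beta> a b"
  using \<beta>_closed[OF assms] by (simp add: frag_lift_def)

lemma frag_lift_mult:
  assumes "u \<in> carrier F" "v \<in> carrier F"
  shows "frag_lift T' \<beta> (u \<otimes>\<^bsub>F\<^esub> v) = frag_lift T' \<beta> u \<otimes>\<^bsub>T'\<^esub> frag_lift T' \<beta> v"
  using assms(1)
proof (induction u rule: formal_induct)
  case zero
  then show ?case using frag_lift_closed[OF assms(2)] by (simp add: formal_mult_diff frag_lift_zero)
next
  case (of a b)
  note ab = formal_of_closed[OF of]
  show ?case using assms(2)
  proof (induction v rule: formal_induct)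
    case zero
    then show ?case using frag_lift_closed[OF ab] by (simp add: formal_mult_diff frag_lift_zero)
  next
    case (of a' b')
    then show ?case using \<open>a \<in> carrier A\<close> \<open>b \<in> carrier B\<close>
      by (simp add: formal_mult_of frag_lift_of \<beta>_mult)
  next
    case (diff v w)
    then show ?case using ab
      by (simp add: formal_mult_diff frag_lift_diff frag_lift_closed T'.r_distr T'.r_minus a_minus_def)
  qed
next
  case (diff u w)
  then show ?case using assms(2)
    by (simp add: formal_mult_diff frag_lift_diff frag_lift_closed T'.l_distr T'.l_minus a_minus_def)
qed

lemma frag_lift_hom: "frag_lift T' \<beta> \<in> ring_hom F T'"
proof (rule ring_hom_memI)
  show "frag_lift T' \<beta> \<one>\<^bsub>F\<^esub> = \<one>\<^bsub>T'\<^esub>"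
    unfolding formal_simps(2) by (simp add: frag_lift_of \<beta>_one)
qed (simp_all add: frag_lift_closed frag_lift_mult frag_lift_add formal_simps(4))

lemma frag_lift_ideal:
  assumes "i \<in> I"
  shows "frag_lift T' \<beta> i = \<zero>\<^bsub>T'\<^esub>"
proof -
  have "ring_hom_ring F T' (frag_lift T' \<beta>)"
    by (rule ring_hom_ringI2[OF F.ring_axioms T'.ring_axioms frag_lift_hom])
  then have id: "ideal (a_kernel F T' (frag_lift T' \<beta>)) F" by (rule ring_hom_ring.kernel_is_ideal)
  have "tensor_relations K A B \<subseteq> a_kernel F T' (frag_lift T' \<beta>)"
  proof
    fix x assume x: "x \<in> tensor_relations K A B"
    have "frag_lift T' \<beta> x = \<zero>\<^bsub>T'\<^esub>"
      using x unfolding tensor_relations_def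
      by (auto simp: frag_lift_diff formal_of_closed formal_diff_closed frag_lift_of \<beta>_closed
          \<beta>_add_left \<beta>_add_right \<beta>_balanced T'.minus_eq_zero_iff[THEN iffD2] T'.add_minus_cancel)
    then show "x \<in> a_kernel F T' (frag_lift T' \<beta>)"
      using x relations_closed by (auto simp: a_kernel_def')
  qed
  then have "I \<subseteq> a_kernel F T' (frag_lift T' \<beta>)"
    unfolding tensor_ideal_def by (rule F.genideal_minimal[OF id])
  then show ?thesis using assms by (auto simp: a_kernel_def')
qed

lemma tensor_lift_coset:
  assumes "u \<in> carrier F"
  shows "tensor_lift T' \<beta> (coset u) = frag_lift T' \<beta> u"
proof -
  have "frag_lift T' \<beta> (i + u) = frag_lift T' \<beta> u" if "i \<in> I" for i
    using frag_lift_add[OF I.a_Hcarr[OF that] assms] frag_lift_ideal[OF that] frag_lift_closed[OF assms] by simp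
  moreover have "coset u = (\<lambda>i. i + u) ` I" by (auto simp: a_r_coset_def' formal_simps)
  moreover have "I \<noteq> {}" using I.zero_closed by blast
  ultimately have "frag_lift T' \<beta> ` coset u = {frag_lift T' \<beta> u}" by (force simp: image_image)
  then show ?thesis by (simp add: tensor_lift_eq)
qed

lemma tensor_lift_hom: "tensor_lift T' \<beta> \<in> ring_hom T T'"
proof (rule ring_hom_memI)
  fix s assume "s \<in> carrier T"
  then obtain u where u: "u \<in> carrier F" "s = coset u" by (rule tensor_obtain)
  then show "tensor_lift T' \<beta> s \<in> carrier T'" by (simp add: tensor_lift_coset frag_lift_closed)
  fix t assume "t \<in> carrier T"
  then obtain v where v: "v \<in> carrier F" "t = coset v" by (rule tensor_obtain)
  have "u \<otimes>\<^bsub>F\<^esub> v \<in> carrier F" "u + v \<in> carrier F"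
    using u v F.a_closed[of u v] by (auto simp: formal_simps(4))
  then show "tensor_lift T' \<beta> (s \<otimes>\<^bsub>T\<^esub> t) = tensor_lift T' \<beta> s \<otimes>\<^bsub>T'\<^esub> tensor_lift T' \<beta> t"
    "tensor_lift T' \<beta> (s \<oplus>\<^bsub>T\<^esub> t) = tensor_lift T' \<beta> s \<oplus>\<^bsub>T'\<^esub> tensor_lift T' \<beta> t"
    unfolding u(2) v(2) coset_simps(2,3)[OF u(1) v(1), symmetric]
    using u v by (simp_all add: tensor_lift_coset frag_lift_mult frag_lift_add)
next
  show "tensor_lift T' \<beta> \<one>\<^bsub>T\<^esub> = \<one>\<^bsub>T'\<^esub>"
    using tensor_lift_coset[OF F.one_closed] ring_hom_one[OF frag_lift_hom] coset_simps(5)[OF F.one_closed F.one_closed] by simp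
qed

lemma tensor_lift_pure: "a \<in> carrier A \<Longrightarrow> b \<in> carrier B \<Longrightarrow> tensor_lift T' \<beta> (pure a b) = \<beta> a b"
  by (simp add: pure_eq tensor_lift_coset formal_of_closed frag_lift_of)

end


section \<open>Rings of a type as records\<close>

lemma type_algebra_simps [simp]:
  "carrier (type_algebra s) = UNIV" "mult (type_algebra s) = (*)" "one (type_algebra s) = 1"
  "zero (type_algebra s) = 0" "add (type_algebra s) = (+)" "module.smult (type_algebra s) = s"
  by (simp_all add: type_algebra_def)

lemma type_algebra_UNIV: "(type_algebra s)\<lparr>carrier := UNIV\<rparr> = type_algebra s"
  by (simp add: type_algebra_def)

lemma cring_subset:
  assumes C: "subring_set C"
  shows "cring ((type_algebra s)\<lparr>carrier := C\<rparr>)"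
proof (rule cringI)
  note closed = subring_set_closed[OF C]
  show "abelian_group ((type_algebra s)\<lparr>carrier := C\<rparr>)"
    by (rule abelian_groupI) (auto simp: algebra_simps closed intro: bexI[of _ "- _"])
  show "comm_monoid ((type_algebra s)\<lparr>carrier := C\<rparr>)"
    by (rule comm_monoidI) (auto simp: algebra_simps closed)
qed (auto simp: algebra_simps)

lemma cring_type_algebra: "cring (type_algebra s)"
  using cring_subset[OF subring_set_UNIV, of s] by (simp add: type_algebra_UNIV)

interpretation type_algebra: cring "type_algebra s" for s
  by (rule cring_type_algebra)

lemma algebra_subset:
  assumes \<phi>: "unital_hom \<phi>" and s: "\<And>c x. s c x = \<phi> c * x" and C: "subring_set C" and sub: "range \<phi> \<subseteq> C"
  shows "algebra base_field ((type_algebra s)\<lparr>carrier := C\<rparr>)"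
  by (rule algebraI[OF cring_type_algebra cring_subset[OF C]])
    (use sub in \<open>auto simp: s algebra_simps unital_homD[OF \<phi>] intro!: subring_set_closed[OF C]\<close>)

lemma algebra_type_algebra:
  assumes "unital_hom \<phi>" and "\<And>c x. s c x = \<phi> c * x"
  shows "algebra base_field (type_algebra s)"
  using algebra_subset[OF assms subring_set_UNIV] by (simp add: type_algebra_UNIV)

text \<open>
  An algebra structure on a ring type is the same as a ring homomorphism from the field, and the
  scalar action is multiplication by its values.
\<close>

lemma algebra_structure_map:
  assumes "algebra base_field (type_algebra s)"
  shows "unital_hom (\<lambda>c. s c 1)" and "s c x = s c 1 * x"
proof -
  interpret algebra base_field "type_algebra s" by fact
  show eq: "s c x = s c 1 * x" for c x using smult_assoc2[of c 1 x] by simp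
  show "unital_hom (\<lambda>c. s c 1)"
    unfolding unital_hom_def
  proof (intro conjI allI)
    show "s 1 1 = 1" using smult_one[of 1] by simp
    fix c d
    show "s (c + d) 1 = s c 1 + s d 1" using smult_l_distr[of c d 1] by simp
    show "s (c * d) 1 = s c 1 * s d 1" using smult_assoc1[of c d 1] eq[of c "s d 1"] by simp
  qed
qed

lemma ideal_subset_iff:
  assumes C: "subring_set C"
  shows "ideal I ((type_algebra s)\<lparr>carrier := C\<rparr>) \<longleftrightarrow> ideal_in C I"
proof
  let ?R = "(type_algebra s)\<lparr>carrier := C\<rparr>"
  interpret R: cring ?R by (rule cring_subset[OF C])
  have minus: "a_inv ?R x = - x" if "x \<in> C" for x
    by (rule R.minus_equality) (use that subring_set_closed[OF C] in auto)
  {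
    assume "ideal I ?R"
    then interpret ideal I ?R .
    show "ideal_in C I"
      unfolding ideal_in_def using a_subset zero_closed a_closed I_l_closed by auto
  next
    assume I: "ideal_in C I"
    show "ideal I ?R"
    proof (rule idealI[OF R.ring_axioms])
      show "subgroup I (add_monoid ?R)"
      proof (rule subgroup.intro)
        fix x assume x: "x \<in> I"
        then have "m_inv (add_monoid ?R) x = - x"
          using minus[of x] ideal_inD(1)[OF I] by (auto simp only: a_inv_def)
        then show "m_inv (add_monoid ?R) x \<in> I" using ideal_in_minus[OF C I x] by (simp only:)
      qed (use ideal_inD[OF I] in auto)
    qed (use ideal_inD[OF I] in auto)
  }
qed

lemma ideal_type_algebra_iff: "ideal I (type_algebra s) \<longleftrightarrow> ideal_in UNIV I"
  using ideal_subset_iff[OF subring_set_UNIV, of I s] by (simp add: type_algebra_UNIV)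

section \<open>Values of polynomials in algebra records\<close>

lemma finsum_type_algebra: "finsum (type_algebra s) f A = sum f A"
  by (induction A rule: infinite_finite_induct) (auto simp: type_algebra.finsum_infinite)

lemma finprod_type_algebra: "finprod (type_algebra s) f A = prod f A"
  by (induction A rule: infinite_finite_induct) auto

lemma nat_pow_type_algebra: "x [^]\<^bsub>type_algebra s\<^esub> (n::nat) = x ^ n"
  by (induction n) (auto simp: mult.commute)

lemma poly_eval_type_algebra:
  assumes "algebra base_field (type_algebra s)"
  shows "poly_eval (type_algebra s) x f = eval_poly (\<lambda>c. s c 1) x f"
  unfolding poly_eval_def eval_poly_def finsum_type_algebra finprod_type_algebra nat_pow_type_algebra
  by (intro sum.cong refl) (simp only: type_algebra_simps, rule algebra_structure_map(2)[OF assms])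

lemma algebra_base_field: "algebra base_field (base_field :: ('k::field, 'k) module)"
  by (rule algebra_type_algebra[of id]) (auto simp: unital_hom_def)

lemma unital_hom_id: "unital_hom id"
  by (simp add: unital_hom_def)

lemma poly_eval_base_field: "poly_eval base_field x f = eval_poly id x f"
  using poly_eval_type_algebra[OF algebra_base_field, of x f] by (simp add: id_def)

section \<open>Coordinate rings\<close>

lemma regular_on_iff: "regular_on X h \<longleftrightarrow> (\<exists>f. \<forall>x\<in>X. h x = eval_poly id x f)"
  by (simp add: regular_on_def poly_eval_base_field)

lemma regular_on_ops:
  "regular_on X (\<lambda>_. c)"
  "regular_on X h \<Longrightarrow> regular_on X h' \<Longrightarrow> regular_on X (\<lambda>x. h x + h' x)"
  "regular_on X h \<Longrightarrow> regular_on X h' \<Longrightarrow> regular_on X (\<lambda>x. h x * h' x)"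
proof -
  note ev = eval_poly_hom[OF unital_hom_id]
  show "regular_on X (\<lambda>_. c)"
    unfolding regular_on_iff by (rule exI[of _ "mconst c"]) (simp add: ev)
  assume "regular_on X h" "regular_on X h'"
  then obtain f f' where "\<forall>x\<in>X. h x = eval_poly id x f" "\<forall>x\<in>X. h' x = eval_poly id x f'"
    by (auto simp: regular_on_iff)
  then show "regular_on X (\<lambda>x. h x + h' x)" "regular_on X (\<lambda>x. h x * h' x)"
    unfolding regular_on_iff
    by (auto intro: exI[of _ "f + f'"] exI[of _ "f * f'"] simp: unital_homD[OF ev(1)])
qed

lemma regular_on_cong: "(\<And>x. x \<in> X \<Longrightarrow> h x = h' x) \<Longrightarrow> regular_on X h \<longleftrightarrow> regular_on X h'"
  by (simp add: regular_on_def)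

lemma coordinate_ring_closed:
  assumes "regular_on X h"
  shows "restrict h X \<in> carrier (coordinate_ring X)"
  using assms by (auto simp: coordinate_ring_def cong: regular_on_cong)

lemma coordinate_ring_simps:
  "one (coordinate_ring X) = (\<lambda>x\<in>X. 1)" "zero (coordinate_ring X) = (\<lambda>x\<in>X. 0)"
  "h \<otimes>\<^bsub>coordinate_ring X\<^esub> h' = (\<lambda>x\<in>X. h x * h' x)" "h \<oplus>\<^bsub>coordinate_ring X\<^esub> h' = (\<lambda>x\<in>X. h x + h' x)"
  "c \<odot>\<^bsub>coordinate_ring X\<^esub> h = (\<lambda>x\<in>X. c * h x)"
  "h \<in> carrier (coordinate_ring X) \<longleftrightarrow> h \<in> extensional X \<and> regular_on X h"
  by (simp_all add: coordinate_ring_def)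

lemma algebra_coordinate_ring: "algebra base_field (coordinate_ring X)"
proof -
  let ?A = "coordinate_ring X"
  have ext: "h = h'" if "h \<in> carrier ?A" "h' \<in> carrier ?A" "\<And>x. x \<in> X \<Longrightarrow> h x = h' x" for h h'
    using that by (auto simp: coordinate_ring_simps intro: extensionalityI)
  have closed: "h \<oplus>\<^bsub>?A\<^esub> h' \<in> carrier ?A" "h \<otimes>\<^bsub>?A\<^esub> h' \<in> carrier ?A" "c \<odot>\<^bsub>?A\<^esub> h \<in> carrier ?A"
    "one ?A \<in> carrier ?A" "zero ?A \<in> carrier ?A"
    if "h \<in> carrier ?A" "h' \<in> carrier ?A" for h h' c
    using that by (auto simp only: coordinate_ring_simps(1-5) intro!: coordinate_ring_closed regular_on_ops)
      (simp_all add: coordinate_ring_simps)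
  have "(\<lambda>x\<in>X. 0) \<in> carrier ?A" "(\<lambda>x\<in>X. 1) \<in> carrier ?A"
    by (auto intro: coordinate_ring_closed regular_on_ops)
  note cl = closed closed(4,5)[OF this]
  show ?thesis
  proof (rule algebraI[OF cring_type_algebra])
    show "cring ?A"
    proof (rule cringI)
      show "abelian_group ?A"
      proof (rule abelian_groupI)
        fix h assume "h \<in> carrier ?A"
        then show "\<exists>h'\<in>carrier ?A. h' \<oplus>\<^bsub>?A\<^esub> h = zero ?A"
          by (intro bexI[of _ "(-1) \<odot>\<^bsub>?A\<^esub> h"] ext cl) (auto simp: coordinate_ring_simps(1-5))
      qed ((intro ext cl; simp add: coordinate_ring_simps(1-5) algebra_simps cl)+)
      show "comm_monoid ?A"
        by (rule comm_monoidI) ((intro ext cl; simp add: coordinate_ring_simps(1-5) algebra_simps cl)+)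
    qed (intro ext cl; simp add: coordinate_ring_simps(1-5) algebra_simps cl)
  qed ((intro ext cl; simp add: coordinate_ring_simps(1-5) algebra_simps cl)+)
qed

section \<open>Tensors as functions on the group\<close>

locale coord = B: algebra base_field B
  for G :: "('m::finite \<Rightarrow> 'k::field) monoid" and B :: "('k, 'b) module"

sublocale coord \<subseteq> algebra_pair base_field "coordinate_ring (carrier G)" B
  by (intro algebra_pair.intro algebra_coordinate_ring B.algebra_axioms)

context coord
begin

abbreviation "KG \<equiv> coordinate_ring (carrier G)"

lemma coord_eqs: "coord_tensor G B = T" "coord_pure G B = pure" "coord_incl G B b = pure \<one>\<^bsub>KG\<^esub> b"
  by (simp_all add: coord_tensor_def coord_pure_def coord_incl_def fun_eq_iff)

lemma incl_hom: "coord_incl G B \<in> ring_hom B T"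
  by (rule ring_hom_memI) (auto simp: coord_eqs pure_mult pure_add_right pure_one)

lemma eval_balanced:
  assumes \<sigma>: "\<sigma> \<in> carrier G"
  shows "balanced_map base_field KG B B (\<lambda>h b. h \<sigma> \<odot>\<^bsub>B\<^esub> b)"
proof (unfold_locales, goal_cases)
  case (5 h b h' b')
  have "(h \<sigma> \<odot>\<^bsub>B\<^esub> b) \<otimes>\<^bsub>B\<^esub> (h' \<sigma> \<odot>\<^bsub>B\<^esub> b') = h \<sigma> \<odot>\<^bsub>B\<^esub> (b \<otimes>\<^bsub>B\<^esub> (h' \<sigma> \<odot>\<^bsub>B\<^esub> b'))"
    using 5 by (intro B.smult_assoc2) auto
  also have "b \<otimes>\<^bsub>B\<^esub> (h' \<sigma> \<odot>\<^bsub>B\<^esub> b') = (h' \<sigma> \<odot>\<^bsub>B\<^esub> b') \<otimes>\<^bsub>B\<^esub> b"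
    using 5 by (intro B.m_comm) auto
  also have "\<dots> = h' \<sigma> \<odot>\<^bsub>B\<^esub> (b' \<otimes>\<^bsub>B\<^esub> b)"
    using 5 by (intro B.smult_assoc2) auto
  also have "b' \<otimes>\<^bsub>B\<^esub> b = b \<otimes>\<^bsub>B\<^esub> b'"
    using 5 by (intro B.m_comm) auto
  finally have "(h \<sigma> \<odot>\<^bsub>B\<^esub> b) \<otimes>\<^bsub>B\<^esub> (h' \<sigma> \<odot>\<^bsub>B\<^esub> b') = h \<sigma> \<odot>\<^bsub>B\<^esub> (h' \<sigma> \<odot>\<^bsub>B\<^esub> (b \<otimes>\<^bsub>B\<^esub> b'))" .
  then show ?case using 5 \<sigma> B.smult_assoc1[of "h \<sigma>" "h' \<sigma>" "b \<otimes>\<^bsub>B\<^esub> b'"]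
    by (simp add: coordinate_ring_simps(1-5))
next
  case (4 c h b)
  then show ?case using \<sigma> B.smult_assoc1[of "h \<sigma>" c b] by (simp add: coordinate_ring_simps(1-5) mult.commute)
next
  case (2 h h' b)
  then show ?case using \<sigma> B.smult_l_distr[of "h \<sigma>" "h' \<sigma>" b] by (simp add: coordinate_ring_simps(1-5))
qed (use \<sigma> B.smult_r_distr B.smult_one[OF B.one_closed] in \<open>auto simp: coordinate_ring_simps(1-5)\<close>)

lemma eval_hom: "\<sigma> \<in> carrier G \<Longrightarrow> coord_eval B \<sigma> \<in> ring_hom T B"
  using balanced_map.tensor_lift_hom[OF eval_balanced] by (simp add: coord_eval_def[abs_def])

lemma eval_pure:
  "\<sigma> \<in> carrier G \<Longrightarrow> h \<in> carrier KG \<Longrightarrow> b \<in> carrier B \<Longrightarrow> coord_eval B \<sigma> (pure h b) = h \<sigma> \<odot>\<^bsub>B\<^esub> b"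
  using balanced_map.tensor_lift_pure[OF eval_balanced] by (simp add: coord_eval_def)

lemma eval_simps:
  assumes "\<sigma> \<in> carrier G" "s \<in> carrier T" "t \<in> carrier T"
  shows "coord_eval B \<sigma> s \<in> carrier B"
    "coord_eval B \<sigma> (s \<oplus>\<^bsub>T\<^esub> t) = coord_eval B \<sigma> s \<oplus>\<^bsub>B\<^esub> coord_eval B \<sigma> t"
    "coord_eval B \<sigma> (s \<otimes>\<^bsub>T\<^esub> t) = coord_eval B \<sigma> s \<otimes>\<^bsub>B\<^esub> coord_eval B \<sigma> t"
    "coord_eval B \<sigma> (s \<ominus>\<^bsub>T\<^esub> t) = coord_eval B \<sigma> s \<ominus>\<^bsub>B\<^esub> coord_eval B \<sigma> t"
    "coord_eval B \<sigma> (c \<odot>\<^bsub>T\<^esub> t) = c \<odot>\<^bsub>B\<^esub> coord_eval B \<sigma> t"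
proof -
  interpret h: ring_hom_ring T B "coord_eval B \<sigma>"
    by (rule ring_hom_ringI2[OF T.ring_axioms B.ring_axioms eval_hom[OF assms(1)]])
  show "coord_eval B \<sigma> s \<in> carrier B"
    "coord_eval B \<sigma> (s \<oplus>\<^bsub>T\<^esub> t) = coord_eval B \<sigma> s \<oplus>\<^bsub>B\<^esub> coord_eval B \<sigma> t"
    "coord_eval B \<sigma> (s \<otimes>\<^bsub>T\<^esub> t) = coord_eval B \<sigma> s \<otimes>\<^bsub>B\<^esub> coord_eval B \<sigma> t"
    "coord_eval B \<sigma> (s \<ominus>\<^bsub>T\<^esub> t) = coord_eval B \<sigma> s \<ominus>\<^bsub>B\<^esub> coord_eval B \<sigma> t"
    using assms by (auto simp: a_minus_def)
  have c1: "c \<odot>\<^bsub>KG\<^esub> \<one>\<^bsub>KG\<^esub> \<in> carrier KG" by (simp add: A.smult_closed)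
  have "coord_eval B \<sigma> (pure (c \<odot>\<^bsub>KG\<^esub> \<one>\<^bsub>KG\<^esub>) \<one>\<^bsub>B\<^esub>) = c \<odot>\<^bsub>B\<^esub> \<one>\<^bsub>B\<^esub>"
    using assms(1) by (subst eval_pure[OF assms(1) c1]) (simp_all add: coordinate_ring_simps(1-5))
  moreover have "pure (c \<odot>\<^bsub>KG\<^esub> \<one>\<^bsub>KG\<^esub>) \<one>\<^bsub>B\<^esub> \<in> carrier T" using c1 by simp
  ultimately show "coord_eval B \<sigma> (c \<odot>\<^bsub>T\<^esub> t) = c \<odot>\<^bsub>B\<^esub> coord_eval B \<sigma> t"
    unfolding tensor_simps(6) using assms(3) B.smult_assoc2[of c "\<one>\<^bsub>B\<^esub>" "coord_eval B \<sigma> t"]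
    by simp
qed

lemma eval_constants:
  assumes "\<sigma> \<in> carrier G"
  shows "coord_eval B \<sigma> \<zero>\<^bsub>T\<^esub> = \<zero>\<^bsub>B\<^esub>" "coord_eval B \<sigma> \<one>\<^bsub>T\<^esub> = \<one>\<^bsub>B\<^esub>"
  using ring_hom_zero[OF eval_hom[OF assms] T.ring_axioms B.ring_axioms] ring_hom_one[OF eval_hom[OF assms]]
  by simp_all

lemma eval_incl: "\<sigma> \<in> carrier G \<Longrightarrow> b \<in> carrier B \<Longrightarrow> coord_eval B \<sigma> (coord_incl G B b) = b"
  using B.smult_one[of b] by (simp add: coord_eqs eval_pure) (simp add: coordinate_ring_simps(1-5))

fun tensor_sum where
  "tensor_sum [] = \<zero>\<^bsub>T\<^esub>"
| "tensor_sum ((h, b) # ps) = pure h b \<oplus>\<^bsub>T\<^esub> tensor_sum ps"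

lemma tensor_sum_closed: "set ps \<subseteq> carrier KG \<times> carrier B \<Longrightarrow> tensor_sum ps \<in> carrier T"
  by (induction ps rule: tensor_sum.induct) auto

lemma tensor_sum_append:
  "set ps \<subseteq> carrier KG \<times> carrier B \<Longrightarrow> set qs \<subseteq> carrier KG \<times> carrier B \<Longrightarrow>
    tensor_sum (ps @ qs) = tensor_sum ps \<oplus>\<^bsub>T\<^esub> tensor_sum qs"
  by (induction ps rule: tensor_sum.induct) (auto simp: tensor_sum_closed T.a_assoc)

lemma tensor_sum_minus:
  "set ps \<subseteq> carrier KG \<times> carrier B \<Longrightarrow>
    tensor_sum (map (\<lambda>(h, b). (\<ominus>\<^bsub>KG\<^esub> h, b)) ps) = \<ominus>\<^bsub>T\<^esub> tensor_sum ps"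
  by (induction ps rule: tensor_sum.induct) (auto simp: tensor_sum_closed pure_minus_left T.minus_add)

lemma tensor_obtain_sum:
  assumes "t \<in> carrier T"
  shows "\<exists>ps. set ps \<subseteq> carrier KG \<times> carrier B \<and> t = tensor_sum ps"
  using assms
proof (induction t rule: tensor_induct)
  case zero
  then show ?case by (intro exI[of _ "[]"]) simp
next
  case (pure h b)
  then show ?case by (intro exI[of _ "[(h, b)]"]) simp
next
  case (diff s t)
  then obtain ps qs where ps: "set ps \<subseteq> carrier KG \<times> carrier B" "s = tensor_sum ps"
    and qs: "set qs \<subseteq> carrier KG \<times> carrier B" "t = tensor_sum qs" by blast
  let ?qs = "map (\<lambda>(h, b). (\<ominus>\<^bsub>KG\<^esub> h, b)) qs"
  have qs': "set ?qs \<subseteq> carrier KG \<times> carrier B" using qs(1) by auto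
  have "s \<ominus>\<^bsub>T\<^esub> t = tensor_sum (ps @ ?qs)"
    unfolding tensor_sum_append[OF ps(1) qs'] tensor_sum_minus[OF qs(1)] ps(2) qs(2) a_minus_def ..
  moreover have "set (ps @ ?qs) \<subseteq> carrier KG \<times> carrier B" using ps(1) qs' by simp
  ultimately show ?case by blast
qed

fun value_sum where
  "value_sum w [] = \<zero>\<^bsub>B\<^esub>"
| "value_sum w ((h, b) # ps) = (w h \<odot>\<^bsub>B\<^esub> b) \<oplus>\<^bsub>B\<^esub> value_sum w ps"

lemma value_sum_closed: "set ps \<subseteq> carrier KG \<times> carrier B \<Longrightarrow> value_sum w ps \<in> carrier B"
  by (induction ps) auto

lemma value_sum_scale:
  "set ps \<subseteq> carrier KG \<times> carrier B \<Longrightarrow> value_sum (\<lambda>h. c * w h) ps = c \<odot>\<^bsub>B\<^esub> value_sum w ps"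
proof (induction ps)
  case (Cons p ps)
  obtain h b where p: "p = (h, b)" by fastforce
  show ?case using Cons B.smult_assoc1[of c "w h" b] B.smult_r_distr[of c "w h \<odot>\<^bsub>B\<^esub> b" "value_sum w ps"]
    by (simp add: p value_sum_closed)
qed simp

lemma eval_tensor_sum:
  assumes "\<sigma> \<in> carrier G" "set ps \<subseteq> carrier KG \<times> carrier B"
  shows "coord_eval B \<sigma> (tensor_sum ps) = value_sum (\<lambda>h. h \<sigma>) ps"
  using assms(2)
  by (induction ps rule: tensor_sum.induct)
    (auto simp: eval_simps eval_constants assms(1) eval_pure
      tensor_sum_closed)

text \<open>
  Induction on the number of summands.  If \<open>h(\<sigma>) \<noteq> 0\<close> for the first summand \<open>h \<otimes> b\<close>, then vanishing at
  \<open>\<sigma>\<close> writes \<open>b\<close> as \<open>- \<Sum> (k(\<sigma>) / h(\<sigma>)) d\<close> over the other summands \<open>k \<otimes> d\<close>.  Inserting this replaces each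
  \<open>k\<close> by \<open>k - (k(\<sigma>) / h(\<sigma>)) h\<close> and removes the first summand without changing the tensor.
\<close>

lemma tensor_sum_eq_zero:
  assumes "set ps \<subseteq> carrier KG \<times> carrier B" "\<And>\<sigma>. \<sigma> \<in> carrier G \<Longrightarrow> coord_eval B \<sigma> (tensor_sum ps) = \<zero>\<^bsub>B\<^esub>"
  shows "tensor_sum ps = \<zero>\<^bsub>T\<^esub>"
  using assms
proof (induction "length ps" arbitrary: ps)
  case (Suc n)
  then obtain h b qs where ps: "ps = (h, b) # qs" "length qs = n" by (cases ps) auto
  have h: "h \<in> carrier KG" and b: "b \<in> carrier B" and qs: "set qs \<subseteq> carrier KG \<times> carrier B"
    using Suc.prems(1) ps by auto
  show ?case
  proof (cases "\<exists>\<sigma>\<in>carrier G. h \<sigma> \<noteq> 0")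
    case False
    then have "h = \<zero>\<^bsub>KG\<^esub>" using h by (intro extensionalityI[of _ "carrier G"]) (auto simp: coordinate_ring_simps)
    then have eq: "tensor_sum ps = tensor_sum qs" using pure_zero[OF b] tensor_sum_closed[OF qs] ps by simp
    then show ?thesis using Suc.hyps(1)[of qs] ps qs Suc.prems(2) by simp
  next
    case True
    then obtain \<sigma> where \<sigma>: "\<sigma> \<in> carrier G" "h \<sigma> \<noteq> 0" by blast
    \<comment> \<open>Subtracting \<open>w k\<close> times \<open>h\<close> makes \<open>k\<close> vanish at \<open>\<sigma>\<close>; \<open>m\<close> does this to a summand.\<close>
    define w where "w k = k \<sigma> / h \<sigma>" for k :: "('m \<Rightarrow> 'k) \<Rightarrow> 'k"
    define m where "m = (\<lambda>(k :: ('m \<Rightarrow> 'k) \<Rightarrow> 'k, d :: 'b). (k \<ominus>\<^bsub>KG\<^esub> (w k \<odot>\<^bsub>KG\<^esub> h), d))"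
    have mqs: "set (map m qs) \<subseteq> carrier KG \<times> carrier B"
      using qs h by (auto simp: m_def A.smult_closed)
    have "h \<sigma> \<odot>\<^bsub>B\<^esub> (b \<oplus>\<^bsub>B\<^esub> value_sum w qs) = \<zero>\<^bsub>B\<^esub>"
    proof -
      have "(\<lambda>k. h \<sigma> * w k) = (\<lambda>k. k \<sigma>)" using \<sigma> by (auto simp: w_def)
      then have "h \<sigma> \<odot>\<^bsub>B\<^esub> value_sum w qs = value_sum (\<lambda>k. k \<sigma>) qs" using value_sum_scale[OF qs, of "h \<sigma>" w] by simp
      then have "h \<sigma> \<odot>\<^bsub>B\<^esub> (b \<oplus>\<^bsub>B\<^esub> value_sum w qs) = value_sum (\<lambda>k. k \<sigma>) ps"
        using B.smult_r_distr[of "h \<sigma>" b "value_sum w qs"] b value_sum_closed[OF qs] ps by simp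
      then show ?thesis using eval_tensor_sum[OF \<sigma>(1) Suc.prems(1)] Suc.prems(2)[OF \<sigma>(1)] by simp
    qed
    then have "inverse (h \<sigma>) \<odot>\<^bsub>B\<^esub> (h \<sigma> \<odot>\<^bsub>B\<^esub> (b \<oplus>\<^bsub>B\<^esub> value_sum w qs)) = \<zero>\<^bsub>B\<^esub>"
      by (simp add: B.smult_r_null)
    then have zero: "b \<oplus>\<^bsub>B\<^esub> value_sum w qs = \<zero>\<^bsub>B\<^esub>"
      using \<sigma>(2) b value_sum_closed[OF qs, of w] B.smult_one[of "b \<oplus>\<^bsub>B\<^esub> value_sum w qs"]
        B.smult_assoc1[of "inverse (h \<sigma>)" "h \<sigma>" "b \<oplus>\<^bsub>B\<^esub> value_sum w qs"] by simp
    have "tensor_sum (map m qs') \<oplus>\<^bsub>T\<^esub> pure h (value_sum w qs') = tensor_sum qs'"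
      if "set qs' \<subseteq> carrier KG \<times> carrier B" for qs'
      using that
    proof (induction qs')
      case Nil
      have "pure h \<zero>\<^bsub>B\<^esub> = \<zero>\<^bsub>T\<^esub>"
        using pure_balanced[of 0 h "\<zero>\<^bsub>B\<^esub>"] pure_zero[of "\<zero>\<^bsub>B\<^esub>"] h A.smult_l_null[of h] B.smult_l_null[of "\<zero>\<^bsub>B\<^esub>"] by simp
      then show ?case by simp
    next
      case (Cons p qs')
      obtain k d where p: "p = (k, d)" by fastforce
      have k: "k \<in> carrier KG" and d: "d \<in> carrier B" and qs': "set qs' \<subseteq> carrier KG \<times> carrier B"
        using Cons.prems p by auto
      have mqs': "set (map m qs') \<subseteq> carrier KG \<times> carrier B"
        using qs' h by (auto simp: m_def A.smult_closed)
      have wh: "w k \<odot>\<^bsub>KG\<^esub> h \<in> carrier KG" using h by (simp add: A.smult_closed)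
      let ?x = "tensor_sum (map m qs')" and ?y = "pure h (value_sum w qs')" and ?z = "pure (w k \<odot>\<^bsub>KG\<^esub> h) d"
      have c: "?x \<in> carrier T" "?y \<in> carrier T" "?z \<in> carrier T" "pure (k \<ominus>\<^bsub>KG\<^esub> (w k \<odot>\<^bsub>KG\<^esub> h)) d \<in> carrier T"
        using tensor_sum_closed[OF mqs'] h value_sum_closed[OF qs'] wh d k by auto
      have "k = (k \<ominus>\<^bsub>KG\<^esub> (w k \<odot>\<^bsub>KG\<^esub> h)) \<oplus>\<^bsub>KG\<^esub> (w k \<odot>\<^bsub>KG\<^esub> h)"
        using k wh by (simp add: a_minus_def A.a_assoc A.l_neg)
      then have kd: "pure k d = pure (k \<ominus>\<^bsub>KG\<^esub> (w k \<odot>\<^bsub>KG\<^esub> h)) d \<oplus>\<^bsub>T\<^esub> ?z"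
        using pure_add_left[of "k \<ominus>\<^bsub>KG\<^esub> (w k \<odot>\<^bsub>KG\<^esub> h)" "w k \<odot>\<^bsub>KG\<^esub> h" d] k wh d by simp
      have hv: "pure h (value_sum w (p # qs')) = ?z \<oplus>\<^bsub>T\<^esub> ?y"
        using pure_add_right[of h "w k \<odot>\<^bsub>B\<^esub> d" "value_sum w qs'"] pure_balanced[of "w k" h d] h d value_sum_closed[OF qs', of w]
        by (simp add: p)
      show ?case
        unfolding hv using c Cons.IH[OF qs'] by (simp add: p m_def kd T.a_ac flip: Cons.IH[OF qs'])
    qed
    from this[OF qs] have "tensor_sum ps = pure h b \<oplus>\<^bsub>T\<^esub> (tensor_sum (map m qs) \<oplus>\<^bsub>T\<^esub> pure h (value_sum w qs))"
      by (simp add: ps)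
    also have "\<dots> = tensor_sum (map m qs) \<oplus>\<^bsub>T\<^esub> pure h (b \<oplus>\<^bsub>B\<^esub> value_sum w qs)"
      using h b value_sum_closed[OF qs, of w] tensor_sum_closed[OF mqs] by (simp add: pure_add_right T.a_ac)
    also have "pure h (b \<oplus>\<^bsub>B\<^esub> value_sum w qs) = \<zero>\<^bsub>T\<^esub>"
      unfolding zero
      using pure_balanced[of 0 h "\<zero>\<^bsub>B\<^esub>"] pure_zero[of "\<zero>\<^bsub>B\<^esub>"] h A.smult_l_null[of h] B.smult_l_null[of "\<zero>\<^bsub>B\<^esub>"] by simp
    finally have eq: "tensor_sum ps = tensor_sum (map m qs)" using tensor_sum_closed[OF mqs] by simp
    show ?thesis
      unfolding eq by (rule Suc.hyps(1)) (use ps mqs Suc.prems(2) eq in auto)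
  qed
qed auto

lemma tensor_eqI:
  assumes "s \<in> carrier T" "t \<in> carrier T" "\<And>\<sigma>. \<sigma> \<in> carrier G \<Longrightarrow> coord_eval B \<sigma> s = coord_eval B \<sigma> t"
  shows "s = t"
proof -
  have d: "s \<ominus>\<^bsub>T\<^esub> t \<in> carrier T" using assms by simp
  obtain ps where ps: "set ps \<subseteq> carrier KG \<times> carrier B" "s \<ominus>\<^bsub>T\<^esub> t = tensor_sum ps"
    using tensor_obtain_sum[OF d] by blast
  have "coord_eval B \<sigma> (s \<ominus>\<^bsub>T\<^esub> t) = \<zero>\<^bsub>B\<^esub>" if "\<sigma> \<in> carrier G" for \<sigma>
    using eval_simps[OF that assms(1,2)] assms(3)[OF that] eval_simps(1)[OF that assms(2,2)]
    by (simp add: a_minus_def B.r_neg)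
  then have "tensor_sum ps = \<zero>\<^bsub>T\<^esub>" using ps by (intro tensor_sum_eq_zero) auto
  then show ?thesis using ps assms T.minus_eq_zero_iff by simp
qed

end


section \<open>Polynomials under ring homomorphisms\<close>

lemma hom_eval_poly:
  assumes h: "unital_hom h" and \<psi>: "unital_hom \<psi>"
  shows "h (eval_poly \<psi> x p) = eval_poly (\<lambda>c. h (\<psi> c)) (\<lambda>i. h (x i)) p"
proof -
  have h\<psi>: "unital_hom (\<lambda>c. h (\<psi> c))"
    by (simp add: unital_hom_def unital_homD[OF h] unital_homD[OF \<psi>])
  note e = eval_poly_hom[OF \<psi>] eval_poly_hom[OF h\<psi>]
  show ?thesis
    by (induction p rule: mpoly_induct)
      (simp_all add: e unital_homD[OF e(1)] unital_homD[OF e(4)] unital_homD[OF h])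
qed

lemma eval_poly_substitute:
  assumes \<phi>: "unital_hom \<phi>"
  shows "eval_poly \<phi> x (eval_poly mconst u p) = eval_poly \<phi> (\<lambda>i. eval_poly \<phi> x (u i)) p"
  using hom_eval_poly[OF eval_poly_hom(1)[OF \<phi>] mconst_hom, of x u p]
  by (simp add: eval_poly_hom(2)[OF \<phi>])

lemma map_coeffs_eq_eval_poly:
  fixes h :: "'c::comm_ring_1 \<Rightarrow> 'd::comm_ring_1" and p :: "('v::finite, 'c) mpoly"
  assumes "h 0 = 0"
  shows "map_coeffs h p = eval_poly (\<lambda>c. mconst (h c)) mvar p"
proof -
  have "map_coeffs h p = (\<Sum>m\<in>Poly_Mapping.keys p. Poly_Mapping.single m (h (Poly_Mapping.lookup p m)))"
    unfolding map_coeffs_def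
    by (intro poly_mapping_eqI)
      (auto simp: lookup_sum lookup_single when_def in_keys_iff Poly_Mapping.map.rep_eq assms)
  then show ?thesis by (simp add: eval_poly_def mpoly_monomial)
qed

lemma map_coeffs_hom:
  fixes h :: "'c::comm_ring_1 \<Rightarrow> 'd::comm_ring_1"
  assumes h: "unital_hom h"
  shows "unital_hom (map_coeffs h :: ('v::finite, 'c) mpoly \<Rightarrow> _)"
    and "unital_hom \<phi> \<Longrightarrow> eval_poly \<phi> x (map_coeffs h (p :: ('v, 'c) mpoly)) = eval_poly (\<lambda>c. \<phi> (h c)) x p"
proof -
  have mh: "unital_hom (\<lambda>c. mconst (h c) :: ('v, 'd) mpoly)"
    by (simp add: unital_hom_def unital_homD[OF h] unital_homD[OF mconst_hom])
  have eq: "map_coeffs h = eval_poly (\<lambda>c. mconst (h c)) (mvar :: 'v \<Rightarrow> _)"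
    by (intro ext map_coeffs_eq_eval_poly unital_homD[OF h])
  show "unital_hom (map_coeffs h :: ('v, 'c) mpoly \<Rightarrow> _)"
    unfolding eq by (rule eval_poly_hom(1)[OF mh])
  assume \<phi>: "unital_hom \<phi>"
  show "eval_poly \<phi> x (map_coeffs h p) = eval_poly (\<lambda>c. \<phi> (h c)) x p"
    unfolding eq hom_eval_poly[OF eval_poly_hom(1)[OF \<phi>] mh] by (simp add: eval_poly_hom[OF \<phi>])
qed

lemma algebra_poly_algebra:
  assumes "algebra base_field (type_algebra scl)"
  shows "algebra base_field (poly_algebra scl :: (_, ('v::finite, 's::comm_ring_1) mpoly) module)"
    and "map_coeffs (scl c) p = mconst (scl c 1) * (p :: ('v, 's) mpoly)"
proof -
  note \<phi> = algebra_structure_map[OF assms]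
  have m: "unital_hom (\<lambda>c. mconst (scl c 1) :: ('v, 's) mpoly)"
    by (simp add: unital_hom_def unital_homD[OF \<phi>(1)] unital_homD[OF mconst_hom])
  show eq: "map_coeffs (scl c) p = mconst (scl c 1) * (p :: ('v, 's) mpoly)" for c p
  proof -
    have "scl c = (*) (scl c 1)" using \<phi>(2) by (intro ext) metis
    then show ?thesis using mult_map_scale_conv_mult[of "scl c 1" p] by (simp add: map_coeffs_def mconst_def)
  qed
  show "algebra base_field (poly_algebra scl :: (_, ('v, 's) mpoly) module)"
    unfolding poly_algebra_def by (rule algebra_type_algebra[OF m eq])
qed

lemma type_algebra_minus: "x \<ominus>\<^bsub>type_algebra s\<^esub> y = x - y"
proof -
  have "\<ominus>\<^bsub>type_algebra s\<^esub> y = - y" by (rule type_algebra.minus_equality) simp_all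
  then show ?thesis by (simp add: a_minus_def)
qed

text \<open>
  Evaluation over the coefficient ring itself, kept as a constant of its own so that the identity on
  coefficients is not rewritten.
\<close>

definition poly_value :: "('v \<Rightarrow> 's) \<Rightarrow> ('v::finite, 's::comm_ring_1) mpoly \<Rightarrow> 's" where
  "poly_value = eval_poly id"

lemma poly_value_hom:
  "unital_hom (poly_value x)" "poly_value x (mconst c) = c" "poly_value x (mvar i) = x i"
  using eval_poly_hom[OF unital_hom_id, of x] by (simp_all add: poly_value_def del: id_apply) simp

lemma poly_value_map_coeffs:
  assumes h: "unital_hom h"
  shows "poly_value x (map_coeffs h p) = eval_poly h x p"
  unfolding poly_value_def using map_coeffs_hom(2)[OF h unital_hom_id, of x p] by simp

lemma hom_poly_value:
  assumes h: "unital_hom h"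
  shows "h (poly_value x p) = eval_poly h (\<lambda>i. h (x i)) p"
  unfolding poly_value_def using hom_eval_poly[OF h unital_hom_id, of x p] by simp

text \<open>
  Modulo the generators every polynomial is congruent to the constant \<open>p(x)\<close>.
\<close>

lemma ideal_of_point:
  fixes x :: "'n::finite \<Rightarrow> 's::comm_ring_1"
  shows "Idl\<^bsub>poly_algebra scl\<^esub> (range (\<lambda>i. mvar i - mconst (x i))) = {p. poly_value x p = 0}"
proof
  let ?J = "Idl\<^bsub>poly_algebra scl\<^esub> (range (\<lambda>i. mvar i - mconst (x i)))"
  note ev = poly_value_hom[of x]
  note evh = unital_homD[OF ev(1)]
  have "ideal {p. poly_value x p = 0} (poly_algebra scl)"
    unfolding poly_algebra_def ideal_type_algebra_iff ideal_in_def by (simp add: evh)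
  then show "?J \<subseteq> {p. poly_value x p = 0}"
    unfolding poly_algebra_def by (rule type_algebra.genideal_minimal) (auto simp: evh ev)
  have "ideal ?J (poly_algebra scl)"
    unfolding poly_algebra_def by (rule type_algebra.genideal_ideal) simp
  then have J: "ideal_in UNIV ?J" by (simp add: poly_algebra_def ideal_type_algebra_iff)
  have "p - mconst (poly_value x p) \<in> ?J" for p
  proof (induction p rule: mpoly_induct)
    case (const c)
    then show ?case unfolding ev using ideal_inD(2)[OF J] by simp
  next
    case (var i)
    have "range (\<lambda>i. mvar i - mconst (x i)) \<subseteq> ?J"
      unfolding poly_algebra_def by (rule type_algebra.genideal_self) simp
    then show ?case by (auto simp: ev)
  next
    case (add p q)
    then show ?case using ideal_inD(3)[OF J add] by (simp add: evh unital_homD[OF mconst_hom] algebra_simps)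
  next
    case (mult p q)
    have "p * q - mconst (poly_value x p) * mconst (poly_value x q) =
      p * (q - mconst (poly_value x q)) + mconst (poly_value x q) * (p - mconst (poly_value x p))"
      by (simp add: algebra_simps)
    also have "\<dots> \<in> ?J" by (intro ideal_inD(3,4)[OF J] mult UNIV_I)
    finally show ?case by (simp add: evh unital_homD[OF mconst_hom])
  qed
  note * = this
  show "{p. poly_value x p = 0} \<subseteq> ?J"
  proof
    fix p assume "p \<in> {p. poly_value x p = 0}"
    then have "poly_value x p = 0" by blast
    from *[of p, unfolded this unital_homD(4)[OF mconst_hom]] show "p \<in> ?J" by (simp only: diff_zero)
  qed
qed

section \<open>Homomorphisms between tensor products\<close>

text \<open>
  The map \<open>id \<otimes> \<psi>\<close> is determined by acting as \<open>\<psi>\<close> on values.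
\<close>

lemma coord_map_properties:
  assumes "algebra base_field B" "algebra base_field C"
    and \<psi>: "\<psi> \<in> ring_hom B C" "\<And>c b. b \<in> carrier B \<Longrightarrow> \<psi> (c \<odot>\<^bsub>B\<^esub> b) = c \<odot>\<^bsub>C\<^esub> \<psi> b"
  shows "coord_map G C \<psi> \<in> ring_hom (coord_tensor G B) (coord_tensor G C)"
    and "h \<in> carrier (coordinate_ring (carrier G)) \<Longrightarrow> b \<in> carrier B \<Longrightarrow>
      coord_map G C \<psi> (coord_pure G B h b) = coord_pure G C h (\<psi> b)"
    and "\<sigma> \<in> carrier G \<Longrightarrow> t \<in> carrier (coord_tensor G B) \<Longrightarrow>
      coord_eval C \<sigma> (coord_map G C \<psi> t) = \<psi> (coord_eval B \<sigma> t)"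
proof -
  interpret B: coord G B by (rule coord.intro) fact
  interpret C: coord G C by (rule coord.intro) fact
  interpret \<psi>: ring_hom_ring B C \<psi> by (rule ring_hom_ringI2[OF B.B.ring_axioms C.B.ring_axioms \<psi>(1)])
  interpret bal: balanced_map base_field "coordinate_ring (carrier G)" B C.T "\<lambda>h b. C.pure h (\<psi> b)"
  proof (unfold_locales, goal_cases)
    case (4 c h b)
    then show ?case using C.pure_balanced[of c h "\<psi> b"] by (simp only: \<psi>(2) \<psi>.hom_closed)
  qed (simp_all add: C.pure_add_left C.pure_add_right C.pure_mult C.pure_one)
  have eq: "coord_map G C \<psi> = tensor_lift C.T (\<lambda>h b. C.pure h (\<psi> b))"
    by (simp add: coord_map_def[abs_def] C.coord_eqs)
  show hom: "coord_map G C \<psi> \<in> ring_hom (coord_tensor G B) (coord_tensor G C)"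
    unfolding eq B.coord_eqs C.coord_eqs by (rule bal.tensor_lift_hom)
  show on_pure: "coord_map G C \<psi> (coord_pure G B h b) = coord_pure G C h (\<psi> b)"
    if "h \<in> carrier (coordinate_ring (carrier G))" "b \<in> carrier B" for h b
    unfolding eq B.coord_eqs C.coord_eqs by (rule bal.tensor_lift_pure[OF that])
  interpret m: ring_hom_ring B.T C.T "coord_map G C \<psi>"
    by (rule ring_hom_ringI2[OF B.T.ring_axioms C.T.ring_axioms hom[unfolded B.coord_eqs C.coord_eqs]])
  assume \<sigma>: "\<sigma> \<in> carrier G" and "t \<in> carrier (coord_tensor G B)"
  then have "t \<in> carrier B.T" by (simp add: B.coord_eqs)
  then show "coord_eval C \<sigma> (coord_map G C \<psi> t) = \<psi> (coord_eval B \<sigma> t)"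
  proof (induction t rule: B.tensor_induct)
    case zero
    then show ?case
      using B.eval_constants(1)[OF \<sigma>] C.eval_constants(1)[OF \<sigma>]
      by simp
  next
    case (pure h b)
    then show ?case
      using on_pure[unfolded B.coord_eqs C.coord_eqs, of h b] \<psi>(2)[of b "h \<sigma>"]
      by (simp add: B.eval_pure[OF \<sigma>] C.eval_pure[OF \<sigma>])
  next
    case (diff s t)
    have "coord_map G C \<psi> (s \<ominus>\<^bsub>B.T\<^esub> t) = coord_map G C \<psi> s \<ominus>\<^bsub>C.T\<^esub> coord_map G C \<psi> t"
      using diff(1,2) by (simp add: a_minus_def)
    moreover have "\<psi> (coord_eval B \<sigma> s \<ominus>\<^bsub>B\<^esub> coord_eval B \<sigma> t) =
        \<psi> (coord_eval B \<sigma> s) \<ominus>\<^bsub>C\<^esub> \<psi> (coord_eval B \<sigma> t)"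
      using B.eval_simps(1)[OF \<sigma> diff(1,1)] B.eval_simps(1)[OF \<sigma> diff(2,2)] by (simp add: a_minus_def)
    ultimately show ?case
      using diff by (simp add: B.eval_simps(4)[OF \<sigma>] C.eval_simps(4)[OF \<sigma>])
  qed
qed

context coord
begin

text \<open>
  Since tensors are determined by their values, a pointwise homomorphism lifts to one into the tensor
  product as soon as each of its families of values belongs to some tensor.
\<close>

lemma hom_from_values:
  assumes A: "cring A" and v: "\<And>\<sigma>. \<sigma> \<in> carrier G \<Longrightarrow> v \<sigma> \<in> ring_hom A B"
    and ex: "\<And>x. x \<in> carrier A \<Longrightarrow> \<exists>t\<in>carrier T. \<forall>\<sigma>\<in>carrier G. coord_eval B \<sigma> t = v \<sigma> x"
  shows "\<exists>\<rho>\<in>ring_hom A T. \<forall>x\<in>carrier A. \<forall>\<sigma>\<in>carrier G. coord_eval B \<sigma> (\<rho> x) = v \<sigma> x"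
proof -
  interpret A: cring A by fact
  from ex obtain \<rho> where \<rho>: "\<And>x. x \<in> carrier A \<Longrightarrow> \<rho> x \<in> carrier T"
    "\<And>x \<sigma>. x \<in> carrier A \<Longrightarrow> \<sigma> \<in> carrier G \<Longrightarrow> coord_eval B \<sigma> (\<rho> x) = v \<sigma> x"
    by metis
  have "\<rho> \<in> ring_hom A T"
  proof (rule ring_hom_memI)
    fix x y assume xy: "x \<in> carrier A" "y \<in> carrier A"
    show "\<rho> (x \<otimes>\<^bsub>A\<^esub> y) = \<rho> x \<otimes>\<^bsub>T\<^esub> \<rho> y"
      by (rule tensor_eqI) (use xy \<rho> v in \<open>auto simp: eval_simps ring_hom_mult\<close>)
    show "\<rho> (x \<oplus>\<^bsub>A\<^esub> y) = \<rho> x \<oplus>\<^bsub>T\<^esub> \<rho> y"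
      by (rule tensor_eqI) (use xy \<rho> v in \<open>auto simp: eval_simps ring_hom_add\<close>)
  next
    show "\<rho> \<one>\<^bsub>A\<^esub> = \<one>\<^bsub>T\<^esub>"
    proof (rule tensor_eqI)
      fix \<sigma> assume \<sigma>: "\<sigma> \<in> carrier G"
      show "coord_eval B \<sigma> (\<rho> \<one>\<^bsub>A\<^esub>) = coord_eval B \<sigma> \<one>\<^bsub>T\<^esub>"
        using \<rho>(2)[OF A.one_closed \<sigma>] ring_hom_one[OF v[OF \<sigma>]] eval_constants(2)[OF \<sigma>]
        by simp
    qed (use \<rho>(1)[OF A.one_closed] in auto)
  qed (rule \<rho>)
  then show ?thesis using \<rho>(2) by blast
qed

lemma polynomial_values_exist:
  fixes v :: "('m \<Rightarrow> 'k) \<Rightarrow> ('v::finite, 'c::comm_ring_1) mpoly \<Rightarrow> 'b"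
  assumes v: "\<And>\<sigma> p q. \<sigma> \<in> carrier G \<Longrightarrow> v \<sigma> (p + q) = v \<sigma> p \<oplus>\<^bsub>B\<^esub> v \<sigma> q"
      "\<And>\<sigma> p q. \<sigma> \<in> carrier G \<Longrightarrow> v \<sigma> (p * q) = v \<sigma> p \<otimes>\<^bsub>B\<^esub> v \<sigma> q"
    and const: "\<And>c. \<exists>t\<in>carrier T. \<forall>\<sigma>\<in>carrier G. coord_eval B \<sigma> t = v \<sigma> (mconst c)"
    and var: "\<And>i. \<exists>t\<in>carrier T. \<forall>\<sigma>\<in>carrier G. coord_eval B \<sigma> t = v \<sigma> (mvar i)"
  shows "\<exists>t\<in>carrier T. \<forall>\<sigma>\<in>carrier G. coord_eval B \<sigma> t = v \<sigma> p"
proof (induction p rule: mpoly_induct)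
  case (add p q)
  then obtain s t where "s \<in> carrier T" "t \<in> carrier T"
    "\<forall>\<sigma>\<in>carrier G. coord_eval B \<sigma> s = v \<sigma> p" "\<forall>\<sigma>\<in>carrier G. coord_eval B \<sigma> t = v \<sigma> q" by blast
  then show ?case by (intro bexI[of _ "s \<oplus>\<^bsub>T\<^esub> t"]) (simp_all add: eval_simps v)
next
  case (mult p q)
  then obtain s t where "s \<in> carrier T" "t \<in> carrier T"
    "\<forall>\<sigma>\<in>carrier G. coord_eval B \<sigma> s = v \<sigma> p" "\<forall>\<sigma>\<in>carrier G. coord_eval B \<sigma> t = v \<sigma> q" by blast
  then show ?case by (intro bexI[of _ "s \<otimes>\<^bsub>T\<^esub> t"]) (simp_all add: eval_simps v)
qed (rule const, rule var)

lemma eval_poly_eval: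
  fixes x :: "'v::finite \<Rightarrow> _"
  assumes "\<sigma> \<in> carrier G" "\<And>i. x i \<in> carrier T"
  shows "coord_eval B \<sigma> (poly_eval T x f) = poly_eval B (\<lambda>i. coord_eval B \<sigma> (x i)) f"
proof -
  interpret e: ring_hom_cring T B "coord_eval B \<sigma>"
    by (rule ring_hom_cringI[OF ring_hom_ringI2[OF T.ring_axioms B.ring_axioms eval_hom[OF assms(1)]] T.is_cring B.is_cring])
  have prod: "(\<Otimes>\<^bsub>T\<^esub>i\<in>UNIV. x i [^]\<^bsub>T\<^esub> Poly_Mapping.lookup m i) \<in> carrier T"
    for m :: "'v \<Rightarrow>\<^sub>0 nat"
    by (intro T.finprod_closed funcsetI T.nat_pow_closed assms(2))
  have sm: "coord_eval B \<sigma> (c \<odot>\<^bsub>T\<^esub> t) = c \<odot>\<^bsub>B\<^esub> coord_eval B \<sigma> t" if "t \<in> carrier T" for c t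
    using eval_simps(5)[OF assms(1) that that] .
  have pow: "coord_eval B \<sigma> (x i [^]\<^bsub>T\<^esub> n) = coord_eval B \<sigma> (x i) [^]\<^bsub>B\<^esub> (n::nat)" for i n
    by (induction n) (use assms(2) in auto)
  show ?thesis
    unfolding poly_eval_def
    by (subst e.hom_finsum)
      (auto simp: tensor_smult_closed prod sm e.hom_finprod assms(2) pow o_def
        intro!: B.finsum_cong' B.finprod_cong' B.smult_closed T.nat_pow_closed B.nat_pow_closed)
qed

lemma poly_eval_tensor_closed:
  assumes "\<And>i. x i \<in> carrier T"
  shows "poly_eval T x f \<in> carrier T"
  unfolding poly_eval_def using assms
  by (auto intro!: T.finsum_closed T.finprod_closed T.nat_pow_closed tensor_smult_closed)

end


section \<open>Powers of ideals in a subring\<close>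

text \<open>
  The power \<open>N\<^sup>j\<close> consists of sums of products of \<open>j\<close> elements of \<open>N\<close> with an element of \<open>C\<close>.  Instead of
  describing it as a set, one proves that its elements are killed by products of \<open>k - j\<close> further
  elements of \<open>N\<close>; for \<open>j = k\<close> the latter product is \<open>1\<close>.
\<close>

lemma nilpotent_ideal_power:
  assumes C: "subring_set C" and N: "ideal_in C N"
    and zero: "\<And>xs. length xs = k \<Longrightarrow> set xs \<subseteq> N \<Longrightarrow> prod_list xs = 0"
  shows "nilpotent_ideal ((type_algebra s)\<lparr>carrier := C\<rparr>) N"
proof -
  let ?R = "(type_algebra s)\<lparr>carrier := C\<rparr>"
  let ?pow = "\<lambda>j::nat. N [^]\<^bsub>ideals_set ?R\<^esub> j"
  have simps: "?pow 0 = C" "?pow (Suc j) = ideal_prod ?R (?pow j) N" for j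
    by (simp_all add: ideals_set_def)
  have vanish: "z * prod_list ys = 0"
    if "z \<in> ?pow j" "set ys \<subseteq> N" "j + length ys = k" for j z ys
    using that
  proof (induction j arbitrary: z ys)
    case 0
    then show ?case using zero[of ys] by simp
  next
    case (Suc j)
    from Suc.prems(1) have "z \<in> ideal_prod ?R (?pow j) N" by (simp only: simps)
    then show ?case using Suc.prems(2,3)
    proof (induction z rule: ideal_prod.induct)
      case (prod u v)
      have "u * prod_list (v # ys) = 0" by (rule Suc.IH) (use prod in auto)
      then show ?case by (simp add: mult.assoc)
    next
      case (sum u v)
      then show ?case by (simp add: distrib_right)
    qed
  qed
  have zero_in: "0 \<in> ?pow j" for j
  proof (induction j)
    case 0
    then show ?case using subring_set_closed(1)[OF C] by (simp only: simps)
  next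
    case (Suc j)
    have "0 \<otimes>\<^bsub>?R\<^esub> 0 \<in> ideal_prod ?R (?pow j) N"
      by (rule ideal_prod.prod[OF Suc ideal_inD(2)[OF N]])
    then show ?case unfolding simps by simp
  qed
  have "?pow k = {0}"
  proof -
    have "z = 0" if "z \<in> ?pow k" for z using vanish[OF that, of "[]"] by simp
    then show ?thesis using zero_in[of k] by blast
  qed
  then show ?thesis unfolding nilpotent_ideal_def by (intro exI[of _ k]) simp
qed

section \<open>Substituting the orbit map into polynomials\<close>

locale derksen_setup =
  fixes G :: "('m::finite \<Rightarrow> 'k::alg_closed_field) monoid"
    and scl :: "'k \<Rightarrow> 's \<Rightarrow> 's::comm_ring_1"
    and act :: "('m \<Rightarrow> 'k) \<Rightarrow> 's \<Rightarrow> 's"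
    and a :: "'n::finite \<Rightarrow> 's"
    and g :: "'n \<Rightarrow> ((('m \<Rightarrow> 'k) \<Rightarrow> 'k) \<times> 's \<Rightarrow>\<^sub>0 int) set"
  assumes linear_group: "linear_algebraic_group G"
    and S_algebra: "algebra base_field (type_algebra scl)"
    and acts: "acts_by_automorphisms G scl act"
    and g_tensor: "\<And>i. g i \<in> carrier (coord_tensor G (gen_subalgebra (type_algebra scl) a))"
    and g_values: "\<And>\<sigma> i. \<sigma> \<in> carrier G \<Longrightarrow>
           act (inv\<^bsub>G\<^esub> \<sigma>) (a i) = coord_eval (gen_subalgebra (type_algebra scl) a) \<sigma> (g i)"
begin

definition emb :: "'k \<Rightarrow> 's" where "emb c = scl c 1"

definition orbit_point :: "('m \<Rightarrow> 'k) \<Rightarrow> 'n \<Rightarrow> 's" where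
  "orbit_point \<sigma> i = act (inv\<^bsub>G\<^esub> \<sigma>) (a i)"

text \<open>
  The subring \<open>R = K[a\<^sub>1, \<dots>, a\<^sub>n]\<close> of \<open>S\<close>.
\<close>

definition C :: "'s set" where "C = range (eval_poly emb a)"

lemma emb_hom: "unital_hom emb"
  using algebra_structure_map(1)[OF S_algebra] by (simp add: emb_def[abs_def])

lemma scl_eq: "scl c x = emb c * x"
  unfolding emb_def by (rule algebra_structure_map(2)[OF S_algebra])

lemmas emb_simps = unital_homD[OF emb_hom]
lemmas emb_eval = eval_poly_hom[OF emb_hom]
lemmas emb_eval_simps = unital_homD[OF emb_eval(1)]

lemma poly_eval_S: "poly_eval (type_algebra scl) x f = eval_poly emb x f"
  using poly_eval_type_algebra[OF S_algebra] by (simp add: emb_def[abs_def])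

lemma C_subring: "subring_set C"
  unfolding C_def by (rule subring_image[OF subring_set_UNIV]) (simp_all add: emb_eval_simps)

lemma emb_C: "emb c \<in> C" and a_C: "a i \<in> C"
  unfolding C_def by (metis emb_eval(2) rangeI, metis emb_eval(3) rangeI)

lemma R_eq: "gen_subalgebra (type_algebra scl) a = (type_algebra scl)\<lparr>carrier := C\<rparr>"
  by (simp add: gen_subalgebra_def C_def poly_eval_S[abs_def] image_def)

text \<open>
  The algebras \<open>R\<close>, \<open>S\<close> and \<open>S[y\<^sub>1, \<dots>, y\<^sub>n]\<close> as records; \<open>R.T\<close>, \<open>S.T\<close> and \<open>P.T\<close> below are their tensor
  products with \<open>K[G]\<close>.
\<close>

abbreviation "RR \<equiv> (type_algebra scl)\<lparr>carrier := C\<rparr>"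
abbreviation "SS \<equiv> type_algebra scl"
abbreviation "PP \<equiv> (poly_algebra scl :: ('k, ('n, 's) mpoly) module)"

lemma R_algebra: "algebra base_field RR"
  by (rule algebra_subset[OF emb_hom scl_eq C_subring]) (use emb_C in auto)

lemma P_algebra: "algebra base_field PP"
  by (rule algebra_poly_algebra(1)[OF S_algebra])

end

sublocale derksen_setup \<subseteq> S: coord G "type_algebra scl" by (rule coord.intro[OF S_algebra])
sublocale derksen_setup \<subseteq> P: coord G "poly_algebra scl :: ('k, ('n, 's) mpoly) module" by (rule coord.intro[OF P_algebra])
sublocale derksen_setup \<subseteq> R: coord G "(type_algebra scl)\<lparr>carrier := C\<rparr>" by (rule coord.intro[OF R_algebra])

context derksen_setup
begin

sublocale G: group G using linear_group by (simp add: linear_algebraic_group_def)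

sublocale action: group_action G UNIV act using acts by (simp add: acts_by_automorphisms_def)

lemma act_hom: "\<sigma> \<in> carrier G \<Longrightarrow> unital_hom (act \<sigma>)"
  using acts by (auto simp: acts_by_automorphisms_def ring_hom_def unital_hom_def)

lemma act_emb: "\<sigma> \<in> carrier G \<Longrightarrow> act \<sigma> (emb c) = emb c"
  using acts unital_homD(1)[OF act_hom] by (simp add: acts_by_automorphisms_def emb_def)

lemma act_mult: "\<sigma> \<in> carrier G \<Longrightarrow> \<tau> \<in> carrier G \<Longrightarrow> act (\<sigma> \<otimes>\<^bsub>G\<^esub> \<tau>) x = act \<sigma> (act \<tau> x)"
  by (rule action.composition_rule) auto

lemma act_one: "act \<one>\<^bsub>G\<^esub> x = x"
  using action.id_eq_one by (metis UNIV_I restrict_apply')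

lemma act_inv:
  assumes "\<sigma> \<in> carrier G"
  shows "act \<sigma> (act (inv\<^bsub>G\<^esub> \<sigma>) x) = x" "act (inv\<^bsub>G\<^esub> \<sigma>) (act \<sigma> x) = x"
  using assms act_mult[of \<sigma> "inv\<^bsub>G\<^esub> \<sigma>" x] act_mult[of "inv\<^bsub>G\<^esub> \<sigma>" \<sigma> x] by (simp_all add: act_one)

lemma act_eval: "\<sigma> \<in> carrier G \<Longrightarrow> act \<sigma> (eval_poly emb x f) = eval_poly emb (\<lambda>i. act \<sigma> (x i)) f"
  by (simp add: hom_eval_poly[OF act_hom emb_hom] act_emb)

text \<open>
  This is \<open>\<tau> (\<sigma>\<tau>)\<^sup>-\<^sup>1 = \<sigma>\<^sup>-\<^sup>1\<close>.  It makes right translation by \<open>\<tau>\<close>, combined with the action of \<open>\<tau>\<close> on values,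
  fix the \<open>g\<^sub>i\<close>.
\<close>

lemma act_orbit_point:
  assumes "\<sigma> \<in> carrier G" "\<tau> \<in> carrier G"
  shows "act \<tau> (orbit_point (\<sigma> \<otimes>\<^bsub>G\<^esub> \<tau>) i) = orbit_point \<sigma> i"
  using assms by (simp add: orbit_point_def G.inv_mult_group act_mult act_inv)

lemma orbit_point_C: "\<sigma> \<in> carrier G \<Longrightarrow> orbit_point \<sigma> i \<in> C"
  using R.eval_simps(1)[of \<sigma> "g i" "g i"] g_tensor[of i] g_values[of \<sigma> i]
  by (simp add: R_eq R.coord_eqs orbit_point_def)

text \<open>
  The hypothesis on the \<open>g\<^sub>i\<close> makes \<open>R\<close> stable under \<open>G\<close>, since \<open>\<sigma> a\<^sub>i\<close> is a value of \<open>g\<^sub>i\<close>.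
\<close>

lemma act_C:
  assumes "\<sigma> \<in> carrier G" "x \<in> C"
  shows "act \<sigma> x \<in> C"
proof -
  have "orbit_point (inv\<^bsub>G\<^esub> \<sigma>) i \<in> C" for i using orbit_point_C assms by simp
  then have ai: "act \<sigma> (a i) \<in> C" for i using assms by (simp add: orbit_point_def)
  obtain f where f: "x = eval_poly emb a f" using assms(2) by (auto simp: C_def)
  have "eval_poly emb (\<lambda>i. act \<sigma> (a i)) f \<in> C"
    unfolding eval_poly_def
    by (intro subring_set_sum[OF C_subring] subring_set_closed(6,7)[OF C_subring] emb_C
        subring_set_prod[OF C_subring] ai)
  then show ?thesis using act_eval[OF assms(1), of a f] f by simp
qed

abbreviation "ev_S \<equiv> coord_eval SS"
abbreviation "ev_P \<equiv> coord_eval PP"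
abbreviation "ev_R \<equiv> coord_eval RR"

lemma S_eval:
  assumes "\<sigma> \<in> carrier G" "s \<in> carrier S.T" "t \<in> carrier S.T"
  shows "ev_S \<sigma> (s \<oplus>\<^bsub>S.T\<^esub> t) = ev_S \<sigma> s + ev_S \<sigma> t"
    "ev_S \<sigma> (s \<otimes>\<^bsub>S.T\<^esub> t) = ev_S \<sigma> s * ev_S \<sigma> t"
    "ev_S \<sigma> (s \<ominus>\<^bsub>S.T\<^esub> t) = ev_S \<sigma> s - ev_S \<sigma> t"
  using S.eval_simps(2-4)[OF assms] by (simp_all add: type_algebra_minus)

lemma S_eval_constants:
  assumes "\<sigma> \<in> carrier G"
  shows "ev_S \<sigma> \<zero>\<^bsub>S.T\<^esub> = 0" "ev_S \<sigma> \<one>\<^bsub>S.T\<^esub> = 1"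
  using S.eval_constants[OF assms] by simp_all

abbreviation "incl_S \<equiv> coord_incl G SS"
abbreviation "incl_P \<equiv> coord_incl G PP"

lemma incl_closed: "incl_S x \<in> carrier S.T" "incl_P p \<in> carrier P.T"
  using ring_hom_closed[OF S.incl_hom] ring_hom_closed[OF P.incl_hom] by (simp_all add: poly_algebra_def)

lemma S_eval_incl: "\<sigma> \<in> carrier G \<Longrightarrow> ev_S \<sigma> (incl_S x) = x"
  by (rule S.eval_incl) simp_all

lemma P_eval_incl: "\<sigma> \<in> carrier G \<Longrightarrow> ev_P \<sigma> (incl_P p) = p"
  by (rule P.eval_incl) (simp_all add: poly_algebra_def)

text \<open>
  The elements \<open>g\<^sub>i\<close> seen in \<open>K[G] \<otimes> S\<close>.
\<close>

definition gS where "gS i = coord_map G SS id (g i)"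

text \<open>
  The inclusion of \<open>K[G] \<otimes> S\<close> into \<open>K[G] \<otimes> S[y\<^sub>1, \<dots>, y\<^sub>n]\<close>.
\<close>

definition \<kappa> where "\<kappa> = coord_map G PP mconst"

lemma id_properties:
  "coord_map G SS id \<in> ring_hom R.T S.T"
  "\<sigma> \<in> carrier G \<Longrightarrow> t \<in> carrier R.T \<Longrightarrow> ev_S \<sigma> (coord_map G SS id t) = ev_R \<sigma> t"
proof -
  have "id \<in> ring_hom RR SS" by (rule ring_hom_memI) simp_all
  note * = coord_map_properties[OF R_algebra S_algebra this, where G = G]
  show "coord_map G SS id \<in> ring_hom R.T S.T" using *(1) by (simp add: R.coord_eqs S.coord_eqs)
  show "\<sigma> \<in> carrier G \<Longrightarrow> t \<in> carrier R.T \<Longrightarrow> ev_S \<sigma> (coord_map G SS id t) = ev_R \<sigma> t"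
    using *(3)[of \<sigma> t] by (simp add: R.coord_eqs)
qed

lemma mconst_P_hom: "mconst \<in> ring_hom RR PP" "mconst \<in> ring_hom SS PP"
  "module.smult PP c (mconst x) = mconst (scl c x)"
  by (rule ring_hom_memI; simp add: poly_algebra_def unital_homD[OF mconst_hom])+
    (simp add: poly_algebra_def algebra_poly_algebra(2)[OF S_algebra] scl_eq emb_simps
      unital_homD[OF mconst_hom])

lemma \<kappa>_properties:
  "\<kappa> \<in> ring_hom S.T P.T"
  "h \<in> carrier S.KG \<Longrightarrow> \<kappa> (S.pure h x) = P.pure h (mconst x)"
  "\<sigma> \<in> carrier G \<Longrightarrow> t \<in> carrier S.T \<Longrightarrow> ev_P \<sigma> (\<kappa> t) = mconst (ev_S \<sigma> t)"
proof -
  note * = coord_map_properties[OF S_algebra P_algebra mconst_P_hom(2), where G = G, unfolded S.coord_eqs P.coord_eqs]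
  show "\<kappa> \<in> ring_hom S.T P.T" unfolding \<kappa>_def by (rule *(1)) (simp add: mconst_P_hom(3))
  show "h \<in> carrier S.KG \<Longrightarrow> \<kappa> (S.pure h x) = P.pure h (mconst x)"
    unfolding \<kappa>_def by (rule *(2)) (simp_all add: mconst_P_hom(3))
  show "\<sigma> \<in> carrier G \<Longrightarrow> t \<in> carrier S.T \<Longrightarrow> ev_P \<sigma> (\<kappa> t) = mconst (ev_S \<sigma> t)"
    unfolding \<kappa>_def by (rule *(3)) (simp_all add: mconst_P_hom(3))
qed

lemma g_closed: "g i \<in> carrier R.T"
  using g_tensor[of i] by (simp add: R_eq R.coord_eqs)

lemma gS_closed: "gS i \<in> carrier S.T"
  unfolding gS_def by (rule ring_hom_closed[OF id_properties(1) g_closed])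

lemma gS_eval: "\<sigma> \<in> carrier G \<Longrightarrow> ev_S \<sigma> (gS i) = orbit_point \<sigma> i"
  using id_properties(2)[OF _ g_closed] g_values[of \<sigma> i] by (simp add: gS_def orbit_point_def R_eq)

text \<open>
  Passing from \<open>K[G] \<otimes> R\<close> to \<open>K[G] \<otimes> S[y\<^sub>1, \<dots>, y\<^sub>n]\<close> directly or through \<open>K[G] \<otimes> S\<close> gives cosets of
  different formal sums, so the equality is checked on values.
\<close>

lemma g_in_P: "coord_map G PP mconst (g i) = \<kappa> (gS i)"
proof (rule P.tensor_eqI)
  note * = coord_map_properties[OF R_algebra P_algebra mconst_P_hom(1), where G = G, unfolded R.coord_eqs P.coord_eqs]
  show "coord_map G PP mconst (g i) \<in> carrier P.T"
    by (rule ring_hom_closed[OF *(1) g_closed]) (simp add: mconst_P_hom(3))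
  show "\<kappa> (gS i) \<in> carrier P.T" by (rule ring_hom_closed[OF \<kappa>_properties(1) gS_closed])
  fix \<sigma> assume \<sigma>: "\<sigma> \<in> carrier G"
  have "ev_P \<sigma> (coord_map G PP mconst (g i)) = mconst (ev_R \<sigma> (g i))"
    by (rule *(3)[OF _ \<sigma> g_closed]) (simp add: mconst_P_hom(3))
  then show "ev_P \<sigma> (coord_map G PP mconst (g i)) = ev_P \<sigma> (\<kappa> (gS i))"
    using \<kappa>_properties(3)[OF \<sigma> gS_closed] gS_eval[OF \<sigma>] g_values[OF \<sigma>]
    by (simp add: orbit_point_def R_eq)
qed

lemma substitution_exists: "\<exists>t\<in>carrier S.T. \<forall>\<sigma>\<in>carrier G. ev_S \<sigma> t = poly_value (orbit_point \<sigma>) p"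
proof (rule S.polynomial_values_exist)
  show "\<exists>t\<in>carrier S.T. \<forall>\<sigma>\<in>carrier G. ev_S \<sigma> t = poly_value (orbit_point \<sigma>) (mconst c)" for c
    by (intro bexI[of _ "incl_S c"]) (simp_all add: S_eval_incl incl_closed poly_value_hom)
  show "\<exists>t\<in>carrier S.T. \<forall>\<sigma>\<in>carrier G. ev_S \<sigma> t = poly_value (orbit_point \<sigma>) (mvar i)" for i
    by (intro bexI[of _ "gS i"]) (simp_all add: gS_eval gS_closed poly_value_hom)
qed (simp_all add: unital_homD[OF poly_value_hom(1)])

lemma P_tensor_value_exists:
  assumes "z \<in> carrier P.T"
  shows "\<exists>t\<in>carrier S.T. \<forall>\<sigma>\<in>carrier G. ev_S \<sigma> t = poly_value (orbit_point \<sigma>) (ev_P \<sigma> z)"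
  using assms
proof (induction z rule: P.tensor_induct)
  case zero
  have "ev_P \<sigma> \<zero>\<^bsub>P.T\<^esub> = 0" if "\<sigma> \<in> carrier G" for \<sigma>
    using P.eval_constants(1)[OF that] by (simp add: poly_algebra_def)
  then show ?case
    by (intro bexI[of _ "\<zero>\<^bsub>S.T\<^esub>"]) (simp_all add: S_eval_constants unital_homD[OF poly_value_hom(1)])
next
  case (pure h p)
  obtain t where t: "t \<in> carrier S.T" "\<forall>\<sigma>\<in>carrier G. ev_S \<sigma> t = poly_value (orbit_point \<sigma>) p"
    using substitution_exists by blast
  have h1: "S.pure h 1 \<in> carrier S.T" using pure(1) by (intro S.pure_closed) simp_all
  have "ev_S \<sigma> (S.pure h 1 \<otimes>\<^bsub>S.T\<^esub> t) = poly_value (orbit_point \<sigma>) (ev_P \<sigma> (P.pure h p))"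
    if \<sigma>: "\<sigma> \<in> carrier G" for \<sigma>
  proof -
    have "ev_S \<sigma> (S.pure h 1) = emb (h \<sigma>)"
      using S.eval_pure[OF \<sigma> pure(1), of 1] by (simp add: emb_def)
    moreover have "ev_P \<sigma> (P.pure h p) = mconst (emb (h \<sigma>)) * p"
      using P.eval_pure[OF \<sigma> pure] algebra_poly_algebra(2)[OF S_algebra, of "h \<sigma>" p]
      by (simp add: poly_algebra_def emb_def)
    ultimately show ?thesis
      using t(2) \<sigma> by (simp add: S_eval(2)[OF \<sigma> h1 t(1)] unital_homD[OF poly_value_hom(1)] poly_value_hom(2))
  qed
  then show ?case using h1 t(1) by (intro bexI[of _ "S.pure h 1 \<otimes>\<^bsub>S.T\<^esub> t"]) simp_all
next
  case (diff y z)
  then obtain s t where "s \<in> carrier S.T" "t \<in> carrier S.T"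
    "\<forall>\<sigma>\<in>carrier G. ev_S \<sigma> s = poly_value (orbit_point \<sigma>) (ev_P \<sigma> y)"
    "\<forall>\<sigma>\<in>carrier G. ev_S \<sigma> t = poly_value (orbit_point \<sigma>) (ev_P \<sigma> z)" by blast
  then show ?case
    using P.eval_simps(4)[OF _ diff(1,2)]
    by (intro bexI[of _ "s \<ominus>\<^bsub>S.T\<^esub> t"])
      (simp_all add: S_eval unital_homD[OF poly_value_hom(1)] poly_algebra_def type_algebra_minus)
qed

lemma retraction_exists:
  "\<exists>\<rho>\<in>ring_hom P.T S.T. \<forall>z\<in>carrier P.T. \<forall>\<sigma>\<in>carrier G.
    ev_S \<sigma> (\<rho> z) = poly_value (orbit_point \<sigma>) (ev_P \<sigma> z)"
proof (rule S.hom_from_values[OF P.tensor_cring])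
  fix \<sigma> assume \<sigma>: "\<sigma> \<in> carrier G"
  show "(\<lambda>z. poly_value (orbit_point \<sigma>) (ev_P \<sigma> z)) \<in> ring_hom P.T SS"
    by (rule ring_hom_memI)
      (use P.eval_simps(2,3)[OF \<sigma>] P.eval_constants(2)[OF \<sigma>]
        in \<open>simp_all add: poly_algebra_def unital_homD[OF poly_value_hom(1)]\<close>)
qed (rule P_tensor_value_exists)

text \<open>
  The homomorphism that substitutes \<open>g\<^sub>i\<close> for \<open>y\<^sub>i\<close>, characterised by its values.
\<close>

definition \<rho> where "\<rho> = (SOME \<rho>. \<rho> \<in> ring_hom P.T S.T \<and> (\<forall>z\<in>carrier P.T. \<forall>\<sigma>\<in>carrier G.
    ev_S \<sigma> (\<rho> z) = poly_value (orbit_point \<sigma>) (ev_P \<sigma> z)))"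

lemma \<rho>_hom: "\<rho> \<in> ring_hom P.T S.T"
  and \<rho>_eval: "z \<in> carrier P.T \<Longrightarrow> \<sigma> \<in> carrier G \<Longrightarrow>
    ev_S \<sigma> (\<rho> z) = poly_value (orbit_point \<sigma>) (ev_P \<sigma> z)"
proof -
  have "\<rho> \<in> ring_hom P.T S.T \<and> (\<forall>z\<in>carrier P.T. \<forall>\<sigma>\<in>carrier G.
    ev_S \<sigma> (\<rho> z) = poly_value (orbit_point \<sigma>) (ev_P \<sigma> z))"
    unfolding \<rho>_def by (rule someI_ex[OF retraction_exists[unfolded Bex_def]])
  then show "\<rho> \<in> ring_hom P.T S.T" "z \<in> carrier P.T \<Longrightarrow> \<sigma> \<in> carrier G \<Longrightarrow>
    ev_S \<sigma> (\<rho> z) = poly_value (orbit_point \<sigma>) (ev_P \<sigma> z)" by auto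
qed

lemma \<rho>_ring_hom: "ring_hom_ring P.T S.T \<rho>"
  by (rule ring_hom_ringI2[OF P.T.ring_axioms S.T.ring_axioms \<rho>_hom])

lemma \<kappa>_ring_hom: "ring_hom_ring S.T P.T \<kappa>"
  by (rule ring_hom_ringI2[OF S.T.ring_axioms P.T.ring_axioms \<kappa>_properties(1)])

lemma \<rho>_closed: "z \<in> carrier P.T \<Longrightarrow> \<rho> z \<in> carrier S.T" and \<kappa>_closed: "t \<in> carrier S.T \<Longrightarrow> \<kappa> t \<in> carrier P.T"
  using ring_hom_closed[OF \<rho>_hom] ring_hom_closed[OF \<kappa>_properties(1)] by auto

lemma \<rho>_\<kappa>: "t \<in> carrier S.T \<Longrightarrow> \<rho> (\<kappa> t) = t"
  by (rule S.tensor_eqI) (simp_all add: \<rho>_closed \<kappa>_closed \<rho>_eval \<kappa>_properties(3) poly_value_hom(2))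

lemma \<rho>_incl_eval: "\<sigma> \<in> carrier G \<Longrightarrow> ev_S \<sigma> (\<rho> (incl_P p)) = poly_value (orbit_point \<sigma>) p"
  by (simp add: \<rho>_eval incl_closed P_eval_incl)

end


lemma map_coeffs_compose:
  assumes "h 0 = 0"
  shows "map_coeffs h (map_coeffs k p) = map_coeffs (\<lambda>c. h (k c)) p"
  unfolding map_coeffs_def
  by (intro poly_mapping_eqI) (auto simp: Poly_Mapping.map.rep_eq when_def assms)

lemma ring_hom_ring_diff:
  assumes "ring_hom_ring A S h" "x \<in> carrier A" "y \<in> carrier A"
  shows "h (x \<ominus>\<^bsub>A\<^esub> y) = h x \<ominus>\<^bsub>S\<^esub> h y"
proof -
  interpret ring_hom_ring A S h by fact
  show ?thesis using assms(2,3) by (simp add: a_minus_def)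
qed

section \<open>Congruences modulo an ideal\<close>

text \<open>
  The elements congruent modulo \<open>D\<close> to an element of the image of \<open>\<kappa>\<close> form a subring.
\<close>

lemma coset_images:
  assumes "ring A" "ring S" and \<kappa>: "\<kappa> \<in> ring_hom S A" and D: "ideal D A"
    and xy: "x \<in> carrier A" "y \<in> carrier A" and st: "s \<in> carrier S" "t \<in> carrier S"
    and eq: "D +>\<^bsub>A\<^esub> x = D +>\<^bsub>A\<^esub> \<kappa> s" "D +>\<^bsub>A\<^esub> y = D +>\<^bsub>A\<^esub> \<kappa> t"
  shows "D +>\<^bsub>A\<^esub> (x \<oplus>\<^bsub>A\<^esub> y) = D +>\<^bsub>A\<^esub> \<kappa> (s \<oplus>\<^bsub>S\<^esub> t)"
    and "D +>\<^bsub>A\<^esub> (x \<otimes>\<^bsub>A\<^esub> y) = D +>\<^bsub>A\<^esub> \<kappa> (s \<otimes>\<^bsub>S\<^esub> t)"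
    and "D +>\<^bsub>A\<^esub> (x \<ominus>\<^bsub>A\<^esub> y) = D +>\<^bsub>A\<^esub> \<kappa> (s \<ominus>\<^bsub>S\<^esub> t)"
proof -
  interpret \<kappa>: ring_hom_ring S A \<kappa> by (rule ring_hom_ringI2) fact+
  interpret \<pi>: ring_hom_ring A "A Quot D" "(+>\<^bsub>A\<^esub>) D" by (rule ideal.rcos_ring_hom_ring[OF D])
  show "D +>\<^bsub>A\<^esub> (x \<oplus>\<^bsub>A\<^esub> y) = D +>\<^bsub>A\<^esub> \<kappa> (s \<oplus>\<^bsub>S\<^esub> t)"
    "D +>\<^bsub>A\<^esub> (x \<otimes>\<^bsub>A\<^esub> y) = D +>\<^bsub>A\<^esub> \<kappa> (s \<otimes>\<^bsub>S\<^esub> t)"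
    "D +>\<^bsub>A\<^esub> (x \<ominus>\<^bsub>A\<^esub> y) = D +>\<^bsub>A\<^esub> \<kappa> (s \<ominus>\<^bsub>S\<^esub> t)"
    using xy st eq by (simp_all add: a_minus_def)
qed

lemma ideal_sum_superset:
  assumes "ideal D A" "ideal F A"
  shows "D \<subseteq> D <+>\<^bsub>A\<^esub> F" "F \<subseteq> D <+>\<^bsub>A\<^esub> F"
proof -
  interpret D: ideal D A by fact
  interpret F: ideal F A by fact
  show "D \<subseteq> D <+>\<^bsub>A\<^esub> F"
  proof
    fix d assume d: "d \<in> D"
    have "d \<oplus>\<^bsub>A\<^esub> \<zero>\<^bsub>A\<^esub> \<in> D <+>\<^bsub>A\<^esub> F" unfolding set_add_def'
      by (rule UN_I[OF d], rule UN_I[OF F.zero_closed], rule singletonI)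
    then show "d \<in> D <+>\<^bsub>A\<^esub> F" using D.a_Hcarr[OF d] by simp
  qed
  show "F \<subseteq> D <+>\<^bsub>A\<^esub> F"
  proof
    fix d assume d: "d \<in> F"
    have "\<zero>\<^bsub>A\<^esub> \<oplus>\<^bsub>A\<^esub> d \<in> D <+>\<^bsub>A\<^esub> F" unfolding set_add_def'
      by (rule UN_I[OF additive_subgroup.zero_closed[OF ideal.axioms(1)[OF assms(1)]]], rule UN_I[OF d], rule singletonI)
    then show "d \<in> D <+>\<^bsub>A\<^esub> F" using F.a_Hcarr[OF d] by simp
  qed
qed

lemma ideal_congruent_mem:
  assumes "ideal E A" "y \<in> carrier A" "k \<in> carrier A" "y \<ominus>\<^bsub>A\<^esub> k \<in> E"
  shows "k \<in> E \<longleftrightarrow> y \<in> E"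
proof -
  interpret E: ideal E A by fact
  have "E +>\<^bsub>A\<^esub> y = E +>\<^bsub>A\<^esub> k"
    using E.quotient_eq_iff_same_a_r_cos[OF assms(1-3)] assms(4) by blast
  moreover have "z \<in> E \<longleftrightarrow> E +>\<^bsub>A\<^esub> z = E" if "z \<in> carrier A" for z
    using that E.a_rcos_const E.a_rcos_self by blast
  ultimately show ?thesis using assms(2,3) by simp
qed

section \<open>The Derksen ideal is an elimination ideal\<close>

context derksen_setup
begin

abbreviation "Dhat \<equiv> derksen_hat G scl g"

lemma Dhat_eq: "Dhat = Idl\<^bsub>P.T\<^esub> (range (\<lambda>i. incl_P (mvar i) \<ominus>\<^bsub>P.T\<^esub> \<kappa> (gS i)))"
  by (simp add: derksen_hat_def Let_def P.coord_eqs(1) g_in_P)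

lemma Dhat_generators: "range (\<lambda>i. incl_P (mvar i) \<ominus>\<^bsub>P.T\<^esub> \<kappa> (gS i)) \<subseteq> carrier P.T"
  using incl_closed(2) \<kappa>_closed[OF gS_closed] by auto

lemma Dhat_ideal: "ideal Dhat P.T"
  unfolding Dhat_eq by (rule P.T.genideal_ideal[OF Dhat_generators])

lemma \<rho>_diff: "x \<in> carrier P.T \<Longrightarrow> y \<in> carrier P.T \<Longrightarrow> \<rho> (x \<ominus>\<^bsub>P.T\<^esub> y) = \<rho> x \<ominus>\<^bsub>S.T\<^esub> \<rho> y"
  by (rule ring_hom_ring_diff[OF \<rho>_ring_hom])

lemma \<rho>_incl_mvar: "\<rho> (incl_P (mvar i)) = gS i"
  by (rule S.tensor_eqI)
    (simp_all add: \<rho>_closed incl_closed gS_closed \<rho>_incl_eval gS_eval poly_value_hom(3))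

lemma \<rho>_Dhat: "z \<in> Dhat \<Longrightarrow> \<rho> z = \<zero>\<^bsub>S.T\<^esub>"
proof -
  have "Dhat \<subseteq> {z \<in> carrier P.T. \<rho> z \<in> {\<zero>\<^bsub>S.T\<^esub>}}"
    unfolding Dhat_eq
  proof (rule P.T.genideal_minimal[OF ring_hom_ring.ideal_vimage[OF \<rho>_ring_hom S.T.zeroideal]])
    show "range (\<lambda>i. incl_P (mvar i) \<ominus>\<^bsub>P.T\<^esub> \<kappa> (gS i)) \<subseteq> {z \<in> carrier P.T. \<rho> z \<in> {\<zero>\<^bsub>S.T\<^esub>}}"
    proof (intro subsetI, elim rangeE)
      fix z i assume z: "z = incl_P (mvar i) \<ominus>\<^bsub>P.T\<^esub> \<kappa> (gS i)"
      have "\<rho> z = gS i \<ominus>\<^bsub>S.T\<^esub> gS i"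
        unfolding z \<rho>_diff[OF incl_closed(2) \<kappa>_closed[OF gS_closed]] \<rho>_incl_mvar \<rho>_\<kappa>[OF gS_closed] ..
      moreover have "z \<in> carrier P.T" using Dhat_generators z by blast
      ultimately show "z \<in> {z \<in> carrier P.T. \<rho> z \<in> {\<zero>\<^bsub>S.T\<^esub>}}"
        using S.T.minus_eq_zero_iff[OF gS_closed gS_closed, of i i] by simp
    qed
  qed
  then show "z \<in> Dhat \<Longrightarrow> ?thesis" by auto
qed

text \<open>
  Modulo the elements \<open>y\<^sub>i - g\<^sub>i\<close> each variable is congruent to an element coming from \<open>K[G] \<otimes> S\<close>, and
  \<open>K[G] \<otimes> S[y\<^sub>1, \<dots>, y\<^sub>n]\<close> is generated by the variables over \<open>K[G] \<otimes> S\<close>.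
\<close>

lemma constants_modulo_Dhat:
  assumes "z \<in> carrier P.T"
  shows "\<exists>t\<in>carrier S.T. Dhat +>\<^bsub>P.T\<^esub> z = Dhat +>\<^bsub>P.T\<^esub> \<kappa> t"
proof -
  let ?\<pi> = "\<lambda>z. Dhat +>\<^bsub>P.T\<^esub> z"
  note images = coset_images[OF P.T.ring_axioms S.T.ring_axioms \<kappa>_properties(1) Dhat_ideal]
  have incl: "\<exists>t\<in>carrier S.T. ?\<pi> (incl_P p) = ?\<pi> (\<kappa> t)" for p
  proof (induction p rule: mpoly_induct)
    case (const c)
    have "incl_P (mconst c) = \<kappa> (incl_S c)"
      by (simp only: P.coord_eqs(3) S.coord_eqs(3) \<kappa>_properties(2)[OF S.A.one_closed])
    then show ?case using incl_closed(1)[of c] by auto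
  next
    case (var i)
    have "incl_P (mvar i) \<ominus>\<^bsub>P.T\<^esub> \<kappa> (gS i) \<in> Dhat"
      using P.T.genideal_self[OF Dhat_generators] unfolding Dhat_eq by blast
    then have "?\<pi> (incl_P (mvar i)) = ?\<pi> (\<kappa> (gS i))"
      using P.T.quotient_eq_iff_same_a_r_cos[OF Dhat_ideal incl_closed(2) \<kappa>_closed[OF gS_closed]] by blast
    then show ?case using gS_closed by blast
  next
    case (add p q)
    have "incl_P (p + q) = incl_P p \<oplus>\<^bsub>P.T\<^esub> incl_P q"
      using ring_hom_add[OF P.incl_hom, of p q] by (simp add: poly_algebra_def)
    moreover obtain s t where "s \<in> carrier S.T" "t \<in> carrier S.T" "?\<pi> (incl_P p) = ?\<pi> (\<kappa> s)"
      "?\<pi> (incl_P q) = ?\<pi> (\<kappa> t)" using add by blast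
    ultimately show ?case using images(1)[OF incl_closed(2) incl_closed(2)] S.T.a_closed by metis
  next
    case (mult p q)
    have "incl_P (p * q) = incl_P p \<otimes>\<^bsub>P.T\<^esub> incl_P q"
      using ring_hom_mult[OF P.incl_hom, of p q] by (simp add: poly_algebra_def)
    moreover obtain s t where "s \<in> carrier S.T" "t \<in> carrier S.T" "?\<pi> (incl_P p) = ?\<pi> (\<kappa> s)"
      "?\<pi> (incl_P q) = ?\<pi> (\<kappa> t)" using mult by blast
    ultimately show ?case using images(2)[OF incl_closed(2) incl_closed(2)] S.T.m_closed by metis
  qed
  show ?thesis using assms
  proof (induction z rule: P.tensor_induct)
    case zero
    have "?\<pi> \<zero>\<^bsub>P.T\<^esub> = ?\<pi> (\<kappa> \<zero>\<^bsub>S.T\<^esub>)"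
      by (simp only: ring_hom_zero[OF \<kappa>_properties(1) S.T.ring_axioms P.T.ring_axioms])
    then show ?case using S.T.zero_closed by blast
  next
    case (pure h p)
    have "P.pure h (mconst 1) = \<kappa> (S.pure h 1)" using \<kappa>_properties(2)[OF pure(1)] by simp
    moreover have h1: "S.pure h 1 \<in> carrier S.T" using pure(1) by (intro S.pure_closed) simp_all
    moreover have "P.pure h p = P.pure h (mconst 1) \<otimes>\<^bsub>P.T\<^esub> incl_P p"
    proof -
      have "mconst 1 \<in> carrier PP" "mconst 1 \<otimes>\<^bsub>PP\<^esub> p = p"
        by (simp_all add: poly_algebra_def unital_homD(1)[OF mconst_hom])
      then show ?thesis
        unfolding P.coord_eqs(3) using P.pure_mult[OF pure(1) _ S.A.one_closed pure(2), of "mconst 1"] pure(1)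
        by simp
    qed
    moreover obtain t where "t \<in> carrier S.T" "?\<pi> (incl_P p) = ?\<pi> (\<kappa> t)" using incl by blast
    ultimately show ?case
      using images(2)[OF \<kappa>_closed[OF h1] incl_closed(2) h1] S.T.m_closed[OF h1] by metis
  next
    case (diff x y)
    then obtain s t where st: "s \<in> carrier S.T" "t \<in> carrier S.T" "?\<pi> x = ?\<pi> (\<kappa> s)" "?\<pi> y = ?\<pi> (\<kappa> t)" by blast
    then have "?\<pi> (x \<ominus>\<^bsub>P.T\<^esub> y) = ?\<pi> (\<kappa> (s \<ominus>\<^bsub>S.T\<^esub> t))" using diff(1,2) by (intro images)
    then show ?case using st S.T.minus_closed by blast
  qed
qed

lemma minus_retract_in_Dhat:
  assumes "z \<in> carrier P.T"
  shows "z \<ominus>\<^bsub>P.T\<^esub> \<kappa> (\<rho> z) \<in> Dhat"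
proof -
  obtain t where t: "t \<in> carrier S.T" "Dhat +>\<^bsub>P.T\<^esub> z = Dhat +>\<^bsub>P.T\<^esub> \<kappa> t"
    using constants_modulo_Dhat[OF assms] by blast
  then have in_D: "z \<ominus>\<^bsub>P.T\<^esub> \<kappa> t \<in> Dhat"
    using P.T.quotient_eq_iff_same_a_r_cos[OF Dhat_ideal assms \<kappa>_closed[OF t(1)]] by blast
  then have "\<rho> z \<ominus>\<^bsub>S.T\<^esub> t = \<zero>\<^bsub>S.T\<^esub>"
    using \<rho>_Dhat[OF in_D] by (simp add: \<rho>_diff assms \<kappa>_closed t(1) \<rho>_\<kappa>)
  then have "\<rho> z = t" using S.T.minus_eq_zero_iff[OF \<rho>_closed[OF assms] t(1)] by blast
  then show ?thesis using in_D by simp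
qed

lemma Dhat_iff: "z \<in> carrier P.T \<Longrightarrow> z \<in> Dhat \<longleftrightarrow> \<rho> z = \<zero>\<^bsub>S.T\<^esub>"
proof
  assume z: "z \<in> carrier P.T" "\<rho> z = \<zero>\<^bsub>S.T\<^esub>"
  have "\<kappa> (\<rho> z) = \<zero>\<^bsub>P.T\<^esub>"
    unfolding z(2) by (rule ring_hom_zero[OF \<kappa>_properties(1) S.T.ring_axioms P.T.ring_axioms])
  then show "z \<in> Dhat" using minus_retract_in_Dhat[OF z(1)] z(1) by (simp add: a_minus_def)
qed (rule \<rho>_Dhat)

lemma incl_in_Dhat_iff: "incl_P p \<in> Dhat \<longleftrightarrow> (\<forall>\<sigma>\<in>carrier G. poly_value (orbit_point \<sigma>) p = 0)"
proof -
  have "\<rho> (incl_P p) = \<zero>\<^bsub>S.T\<^esub> \<longleftrightarrow>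
      (\<forall>\<sigma>\<in>carrier G. ev_S \<sigma> (\<rho> (incl_P p)) = ev_S \<sigma> \<zero>\<^bsub>S.T\<^esub>)"
    using S.tensor_eqI[OF \<rho>_closed[OF incl_closed(2)] S.T.zero_closed] by auto
  then show ?thesis by (simp add: Dhat_iff incl_closed \<rho>_incl_eval S_eval_constants)
qed

lemma derksen_ideal_iff: "p \<in> derksen_ideal G scl act a \<longleftrightarrow> (\<forall>\<sigma>\<in>carrier G. poly_value (orbit_point \<sigma>) p = 0)"
proof -
  have "p \<in> derksen_ideal G scl act a \<longleftrightarrow> (\<forall>\<sigma>\<in>carrier G. poly_value (\<lambda>i. act \<sigma> (a i)) p = 0)"
    by (simp add: derksen_ideal_def ideal_of_point)
  also have "\<dots> \<longleftrightarrow> (\<forall>\<sigma>\<in>carrier G. poly_value (orbit_point \<sigma>) p = 0)"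
    unfolding orbit_point_def by (metis G.inv_closed G.inv_inv)
  finally show ?thesis .
qed

lemma derksen_elimination: "derksen_ideal G scl act a = elimination_ideal G scl Dhat"
  by (auto simp: elimination_ideal_def derksen_ideal_iff incl_in_Dhat_iff)

section \<open>The elimination ideal is an extended Derksen ideal\<close>

context
  fixes fs :: "('n, 'k) mpoly list"
begin

abbreviation "J \<equiv> substituted_ideal G scl g fs"
abbreviation "Ehat \<equiv> extended_hat G scl g fs"
abbreviation "E \<equiv> elimination_ideal G scl Ehat"

lemma poly_embed_eq: "poly_embed scl = map_coeffs emb"
  by (intro ext) (simp add: poly_embed_def emb_def[abs_def])

text \<open>
  The generators \<open>f(g\<^sub>1, \<dots>, g\<^sub>n)\<close> of the substituted ideal are the images of the \<open>f\<close> under \<open>\<rho>\<close>.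
\<close>

lemma J_eq: "J = Idl\<^bsub>S.T\<^esub> ((\<lambda>f. \<rho> (incl_P (poly_embed scl f))) ` set fs)"
proof -
  have "poly_eval S.T gS f = \<rho> (incl_P (poly_embed scl f))" for f
  proof (rule S.tensor_eqI)
    fix \<sigma> assume \<sigma>: "\<sigma> \<in> carrier G"
    have "ev_S \<sigma> (poly_eval S.T gS f) = eval_poly emb (orbit_point \<sigma>) f"
      unfolding S.eval_poly_eval[OF \<sigma> gS_closed] poly_eval_S gS_eval[OF \<sigma>] ..
    then show "ev_S \<sigma> (poly_eval S.T gS f) = ev_S \<sigma> (\<rho> (incl_P (poly_embed scl f)))"
      by (simp add: \<rho>_incl_eval[OF \<sigma>] poly_embed_eq poly_value_map_coeffs[OF emb_hom])
  qed (auto intro: S.poly_eval_tensor_closed gS_closed \<rho>_closed incl_closed)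
  then show ?thesis
    by (simp add: substituted_ideal_def Let_def S.coord_eqs(1) flip: gS_def)
qed

lemma J_generators: "(\<lambda>f. \<rho> (incl_P (poly_embed scl f))) ` set fs \<subseteq> carrier S.T"
  using \<rho>_closed[OF incl_closed(2)] by auto

lemma J_ideal: "ideal J S.T"
  unfolding J_eq by (rule S.T.genideal_ideal[OF J_generators])

lemma J_generator: "f \<in> set fs \<Longrightarrow> \<rho> (incl_P (poly_embed scl f)) \<in> J"
  using S.T.genideal_self[OF J_generators] unfolding J_eq by blast

lemma Ehat_eq: "Ehat = Dhat <+>\<^bsub>P.T\<^esub> Idl\<^bsub>P.T\<^esub> ((\<lambda>f. incl_P (poly_embed scl f)) ` set fs)"
  by (simp add: extended_hat_def Let_def P.coord_eqs(1))

lemma F_generators: "(\<lambda>f. incl_P (poly_embed scl f)) ` set fs \<subseteq> carrier P.T"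
  using incl_closed(2) by auto

lemma F_ideal: "ideal (Idl\<^bsub>P.T\<^esub> ((\<lambda>f. incl_P (poly_embed scl f)) ` set fs)) P.T"
  by (rule P.T.genideal_ideal[OF F_generators])

lemma Ehat_ideal: "ideal Ehat P.T"
  unfolding Ehat_eq by (rule P.T.add_ideals[OF Dhat_ideal F_ideal])

lemma Ehat_superset:
  "Dhat \<subseteq> Ehat" "f \<in> set fs \<Longrightarrow> incl_P (poly_embed scl f) \<in> Ehat"
  unfolding Ehat_eq
  using ideal_sum_superset[OF Dhat_ideal F_ideal] P.T.genideal_self[OF F_generators] by blast+

text \<open>
  Since \<open>\<rho>\<close> is onto with a kernel inside the ideal on the left, that ideal is the full preimage of its
  image; and \<open>\<rho>\<close> sends its generators to zero or to generators of \<open>J\<close>.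
\<close>

lemma Ehat_iff:
  assumes z: "z \<in> carrier P.T"
  shows "z \<in> Ehat \<longleftrightarrow> \<rho> z \<in> J"
proof
  assume "z \<in> Ehat"
  then obtain d y where dy: "d \<in> Dhat" "y \<in> Idl\<^bsub>P.T\<^esub> ((\<lambda>f. incl_P (poly_embed scl f)) ` set fs)"
    "z = d \<oplus>\<^bsub>P.T\<^esub> y"
    unfolding Ehat_eq set_add_def' by blast
  have "Idl\<^bsub>P.T\<^esub> ((\<lambda>f. incl_P (poly_embed scl f)) ` set fs) \<subseteq> {z \<in> carrier P.T. \<rho> z \<in> J}"
    by (rule P.T.genideal_minimal[OF ring_hom_ring.ideal_vimage[OF \<rho>_ring_hom J_ideal]]) (use J_generator incl_closed(2) in auto)
  then have y: "y \<in> carrier P.T" "\<rho> y \<in> J" using dy(2) by auto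
  have "d \<in> carrier P.T" using dy(1) ideal.Icarr[OF Dhat_ideal] by blast
  then have "\<rho> z = \<rho> y"
    using ring_hom_add[OF \<rho>_hom _ y(1)] dy(3) \<rho>_Dhat[OF dy(1)] \<rho>_closed[OF y(1)] by simp
  then show "\<rho> z \<in> J" using y by simp
next
  have transfer: "\<kappa> (\<rho> y) \<in> Ehat \<longleftrightarrow> y \<in> Ehat" if y: "y \<in> carrier P.T" for y
    using minus_retract_in_Dhat[OF y] Ehat_superset(1)
    by (intro ideal_congruent_mem[OF Ehat_ideal y \<kappa>_closed[OF \<rho>_closed[OF y]]]) blast
  assume "\<rho> z \<in> J"
  moreover have "J \<subseteq> {t \<in> carrier S.T. \<kappa> t \<in> Ehat}"
    unfolding J_eq
    by (rule S.T.genideal_minimal[OF ring_hom_ring.ideal_vimage[OF \<kappa>_ring_hom Ehat_ideal]])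
      (use Ehat_superset(2) transfer incl_closed(2) \<rho>_closed[OF incl_closed(2)] in auto)
  ultimately show "z \<in> Ehat" using transfer[OF z] by blast
qed

lemma E_iff: "p \<in> E \<longleftrightarrow> \<rho> (incl_P p) \<in> J"
  by (simp add: elimination_ideal_def Ehat_iff incl_closed)

lemma E_ideal: "ideal E PP"
proof -
  have "ideal {p \<in> carrier PP. incl_P p \<in> Ehat} PP"
    by (rule ring_hom_ring.ideal_vimage[OF ring_hom_ringI2[OF P.B.ring_axioms P.T.ring_axioms P.incl_hom] Ehat_ideal])
  then show ?thesis by (simp add: elimination_ideal_def poly_algebra_def)
qed

lemma derksen_subset_E: "derksen_ideal G scl act a \<subseteq> E"
  using Ehat_superset(1) by (auto simp: derksen_elimination elimination_ideal_def)

lemma incl_one: "incl_P 1 = \<one>\<^bsub>P.T\<^esub>" "incl_S 1 = \<one>\<^bsub>S.T\<^esub>"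
  using ring_hom_one[OF P.incl_hom] ring_hom_one[OF S.incl_hom] by (simp_all add: poly_algebra_def)

text \<open>
  Multiplication of \<open>G\<close> is given by polynomials, which can be inserted into one representing \<open>h\<close>.
\<close>

lemma translate_regular:
  assumes h: "h \<in> carrier S.KG" and \<tau>: "\<tau> \<in> carrier G"
  shows "(\<lambda>\<sigma>\<in>carrier G. h (\<sigma> \<otimes>\<^bsub>G\<^esub> \<tau>)) \<in> carrier S.KG"
proof (rule coordinate_ring_closed)
  obtain f where f: "\<forall>x\<in>carrier G. h x = eval_poly id x f"
    using h by (auto simp: coordinate_ring_simps regular_on_iff)
  have "\<forall>j. \<exists>m. \<forall>z\<in>{z :: 'm + 'm \<Rightarrow> 'k. z \<circ> Inl \<in> carrier G \<and> z \<circ> Inr \<in> carrier G}.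
      ((z \<circ> Inl) \<otimes>\<^bsub>G\<^esub> (z \<circ> Inr)) j = eval_poly id z m"
    using linear_group unfolding linear_algebraic_group_def regular_on_iff by blast
  then obtain m where m: "\<And>j z. z \<circ> Inl \<in> carrier G \<Longrightarrow> z \<circ> Inr \<in> carrier G \<Longrightarrow>
      ((z \<circ> Inl) \<otimes>\<^bsub>G\<^esub> (z \<circ> Inr)) j = eval_poly id (z :: 'm + 'm \<Rightarrow> 'k) (m j)"
    by (auto simp: choice_iff)
  \<comment> \<open>Compose with the polynomials of the product and specialise the second factor to \<open>\<tau>\<close>.\<close>
  define q where "q = eval_poly mconst (case_sum mvar (\<lambda>j. mconst (\<tau> j))) (eval_poly mconst m f)"
  have "h (\<sigma> \<otimes>\<^bsub>G\<^esub> \<tau>) = eval_poly id \<sigma> q" if \<sigma>: "\<sigma> \<in> carrier G" for \<sigma>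
  proof -
    have "(\<lambda>i. eval_poly id \<sigma> (case_sum mvar (\<lambda>j. mconst (\<tau> j)) i)) = case_sum \<sigma> \<tau>"
      using poly_value_hom[of \<sigma>] by (intro ext) (simp add: poly_value_def split: sum.split)
    then have "eval_poly id \<sigma> q = eval_poly id (\<lambda>j. eval_poly id (case_sum \<sigma> \<tau>) (m j)) f"
      unfolding q_def by (simp only: eval_poly_substitute[OF unital_hom_id])
    also have "(\<lambda>j. eval_poly id (case_sum \<sigma> \<tau>) (m j)) = \<sigma> \<otimes>\<^bsub>G\<^esub> \<tau>"
      using m[of "case_sum \<sigma> \<tau>"] \<sigma> \<tau> by (intro ext) (simp add: case_sum_o_inj)
    finally have "eval_poly id \<sigma> q = eval_poly id (\<sigma> \<otimes>\<^bsub>G\<^esub> \<tau>) f" .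
    then show ?thesis using bspec[OF f G.m_closed[OF \<sigma> \<tau>]] by (rule trans[OF _ sym, rotated])
  qed
  then show "regular_on (carrier G) (\<lambda>\<sigma>. h (\<sigma> \<otimes>\<^bsub>G\<^esub> \<tau>))" unfolding regular_on_iff by blast
qed

text \<open>
  The automorphism by which \<open>\<tau>\<close> acts on \<open>K[G] \<otimes> S\<close>: right translation on \<open>K[G]\<close> and the given action
  on \<open>S\<close>.
\<close>

lemma translate_exists:
  assumes \<tau>: "\<tau> \<in> carrier G"
  shows "\<exists>\<Phi>\<in>ring_hom S.T S.T. \<forall>t\<in>carrier S.T. \<forall>\<sigma>\<in>carrier G.
    ev_S \<sigma> (\<Phi> t) = act \<tau> (ev_S (\<sigma> \<otimes>\<^bsub>G\<^esub> \<tau>) t)"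
proof (rule S.hom_from_values[OF S.tensor_cring])
  fix \<sigma> assume "\<sigma> \<in> carrier G"
  then have \<sigma>\<tau>: "\<sigma> \<otimes>\<^bsub>G\<^esub> \<tau> \<in> carrier G" using \<tau> by simp
  show "(\<lambda>t. act \<tau> (ev_S (\<sigma> \<otimes>\<^bsub>G\<^esub> \<tau>) t)) \<in> ring_hom S.T SS"
    by (rule ring_hom_memI)
      (simp_all add: S_eval[OF \<sigma>\<tau>] S_eval_constants[OF \<sigma>\<tau>] unital_homD[OF act_hom[OF \<tau>]])
next
  fix t assume "t \<in> carrier S.T"
  then show "\<exists>t'\<in>carrier S.T. \<forall>\<sigma>\<in>carrier G. ev_S \<sigma> t' = act \<tau> (ev_S (\<sigma> \<otimes>\<^bsub>G\<^esub> \<tau>) t)"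
  proof (induction t rule: S.tensor_induct)
    case zero
    then show ?case using \<tau>
      by (intro bexI[of _ "\<zero>\<^bsub>S.T\<^esub>"]) (simp_all add: S_eval_constants unital_homD[OF act_hom])
  next
    case (pure h b)
    let ?h = "\<lambda>\<sigma>\<in>carrier G. h (\<sigma> \<otimes>\<^bsub>G\<^esub> \<tau>)"
    note h' = translate_regular[OF pure(1) \<tau>]
    have "ev_S \<sigma> (S.pure ?h (act \<tau> b)) = act \<tau> (ev_S (\<sigma> \<otimes>\<^bsub>G\<^esub> \<tau>) (S.pure h b))"
      if \<sigma>: "\<sigma> \<in> carrier G" for \<sigma>
    proof -
      have "\<sigma> \<otimes>\<^bsub>G\<^esub> \<tau> \<in> carrier G" using \<sigma> \<tau> by simp
      from S.eval_pure[OF this pure] S.eval_pure[OF \<sigma> h', of "act \<tau> b"]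
      show ?thesis using \<sigma> \<tau> by (simp add: scl_eq unital_homD(3)[OF act_hom] act_emb)
    qed
    then show ?case using h' by (intro bexI[of _ "S.pure ?h (act \<tau> b)"]) simp_all
  next
    case (diff s t)
    then obtain s' t' where "s' \<in> carrier S.T" "t' \<in> carrier S.T"
      "\<forall>\<sigma>\<in>carrier G. ev_S \<sigma> s' = act \<tau> (ev_S (\<sigma> \<otimes>\<^bsub>G\<^esub> \<tau>) s)"
      "\<forall>\<sigma>\<in>carrier G. ev_S \<sigma> t' = act \<tau> (ev_S (\<sigma> \<otimes>\<^bsub>G\<^esub> \<tau>) t)" by blast
    then show ?case using \<tau> diff(1,2)
      by (intro bexI[of _ "s' \<ominus>\<^bsub>S.T\<^esub> t'"]) (simp_all add: S_eval unital_homD[OF act_hom])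
  qed
qed

text \<open>
  Under the action of \<open>\<tau>\<close> on \<open>K[G] \<otimes> S\<close> the map \<open>\<rho>\<close> is equivariant.  The generators of \<open>J\<close> come from
  polynomials over \<open>K\<close>, so they are fixed and \<open>J\<close> is stable.
\<close>

lemma E_stable:
  assumes \<tau>: "\<tau> \<in> carrier G" and p: "p \<in> E"
  shows "map_coeffs (act \<tau>) p \<in> E"
proof -
  obtain \<Phi> where \<Phi>: "\<Phi> \<in> ring_hom S.T S.T"
    "\<And>t \<sigma>. t \<in> carrier S.T \<Longrightarrow> \<sigma> \<in> carrier G \<Longrightarrow>
      ev_S \<sigma> (\<Phi> t) = act \<tau> (ev_S (\<sigma> \<otimes>\<^bsub>G\<^esub> \<tau>) t)"
    using translate_exists[OF \<tau>] by blast
  note \<Phi>_ring_hom = ring_hom_ringI2[OF S.T.ring_axioms S.T.ring_axioms \<Phi>(1)]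
  have translate: "\<Phi> (\<rho> (incl_P q)) = \<rho> (incl_P (map_coeffs (act \<tau>) q))" for q
  proof (rule S.tensor_eqI)
    fix \<sigma> assume \<sigma>: "\<sigma> \<in> carrier G"
    then have \<sigma>\<tau>: "\<sigma> \<otimes>\<^bsub>G\<^esub> \<tau> \<in> carrier G" using \<tau> by simp
    show "ev_S \<sigma> (\<Phi> (\<rho> (incl_P q)))
        = ev_S \<sigma> (\<rho> (incl_P (map_coeffs (act \<tau>) q)))"
      unfolding \<Phi>(2)[OF \<rho>_closed[OF incl_closed(2)] \<sigma>] \<rho>_incl_eval[OF \<sigma>\<tau>] \<rho>_incl_eval[OF \<sigma>]
        hom_poly_value[OF act_hom[OF \<tau>]] poly_value_map_coeffs[OF act_hom[OF \<tau>]]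
        act_orbit_point[OF \<sigma> \<tau>] ..
  qed (auto intro: \<rho>_closed incl_closed ring_hom_closed[OF \<Phi>(1)])
  have "map_coeffs (act \<tau>) (poly_embed scl f) = (poly_embed scl f :: ('n, 's) mpoly)" for f
    unfolding poly_embed_eq
    by (subst map_coeffs_compose) (simp_all add: act_emb[OF \<tau>] unital_homD(4)[OF act_hom[OF \<tau>]])
  then have "J \<subseteq> {t \<in> carrier S.T. \<Phi> t \<in> J}"
    unfolding J_eq
    by (intro S.T.genideal_minimal ring_hom_ring.ideal_vimage[OF \<Phi>_ring_hom] S.T.genideal_ideal J_generators)
      (use J_generators S.T.genideal_self[OF J_generators] in \<open>auto simp: translate\<close>)
  then show ?thesis using p translate[of p] by (auto simp: E_iff)
qed

end

end


section \<open>Tameness\<close>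

context derksen_setup
begin

lemma eval_renamed:
  "eval_poly emb x (eval_poly mconst (\<lambda>i. mvar (u i)) f) = eval_poly emb (\<lambda>i. x (u i)) f"
  by (simp add: eval_poly_substitute[OF emb_hom] emb_eval)

lemma value_lift: "poly_value x (eval_poly mconst (\<lambda>i. mvar (u i)) f) = poly_value (\<lambda>i. x (u i)) f"
  using poly_value_hom[of x] by (simp add: poly_value_def eval_poly_substitute[OF unital_hom_id])

text \<open>
  The polynomial ring in the coordinates of the affine space containing \<open>G\<close> and in the \<open>y\<^sub>i\<close>
  maps onto \<open>K[G] \<otimes> R\<close>; this is the value at \<open>\<sigma>\<close> of the image of a polynomial.
\<close>

definition coordinate_value :: "('m \<Rightarrow> 'k) \<Rightarrow> ('m + 'n, 'k) mpoly \<Rightarrow> 's" where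
  "coordinate_value \<sigma> = eval_poly emb (case_sum (\<lambda>j. emb (\<sigma> j)) a)"

lemma coordinate_value_hom: "unital_hom (coordinate_value \<sigma>)"
  unfolding coordinate_value_def by (rule emb_eval(1))

lemma coordinate_value_var:
  "coordinate_value \<sigma> (mvar (Inl j)) = emb (\<sigma> j)" "coordinate_value \<sigma> (mvar (Inr i)) = a i"
  "coordinate_value \<sigma> (mconst c) = emb c"
  by (simp_all add: coordinate_value_def emb_eval)

lemma coordinate_value_lift:
  "coordinate_value \<sigma> (eval_poly mconst (\<lambda>j. mvar (Inl j)) f) = emb (poly_value \<sigma> f)"
  "coordinate_value \<sigma> (eval_poly mconst (\<lambda>i. mvar (Inr i)) f') = eval_poly emb a f'"
  by (simp_all add: coordinate_value_def eval_renamed hom_poly_value[OF emb_hom])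

lemma coordinate_tensor_exists:
  "\<exists>t\<in>carrier S.T. \<forall>\<sigma>\<in>carrier G. ev_S \<sigma> t = coordinate_value \<sigma> q"
proof (rule S.polynomial_values_exist)
  show "\<exists>t\<in>carrier S.T. \<forall>\<sigma>\<in>carrier G. ev_S \<sigma> t = coordinate_value \<sigma> (mconst c)" for c
    by (intro bexI[of _ "incl_S (emb c)"]) (simp_all add: S_eval_incl incl_closed coordinate_value_var)
  show "\<exists>t\<in>carrier S.T. \<forall>\<sigma>\<in>carrier G. ev_S \<sigma> t = coordinate_value \<sigma> (mvar v)" for v
  proof (cases v)
    case (Inl j)
    have "regular_on (carrier G) (\<lambda>\<sigma>. \<sigma> j)"
      unfolding regular_on_iff
    proof (intro exI ballI)
      fix \<sigma> show "\<sigma> j = eval_poly id \<sigma> (mvar j)" using poly_value_hom(3)[of \<sigma> j] by (simp only: poly_value_def)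
    qed
    then have h: "(\<lambda>\<sigma>\<in>carrier G. \<sigma> j) \<in> carrier S.KG" by (rule coordinate_ring_closed)
    have "ev_S \<sigma> (S.pure (\<lambda>\<sigma>\<in>carrier G. \<sigma> j) 1) = coordinate_value \<sigma> (mvar v)"
      if \<sigma>: "\<sigma> \<in> carrier G" for \<sigma>
      using S.eval_pure[OF \<sigma> h, of 1] \<sigma> scl_eq[of "\<sigma> j" 1] by (simp add: Inl coordinate_value_var)
    moreover have "S.pure (\<lambda>\<sigma>\<in>carrier G. \<sigma> j) 1 \<in> carrier S.T" using h by (intro S.pure_closed) simp_all
    ultimately show ?thesis by blast
  next
    case (Inr i)
    then show ?thesis
      by (intro bexI[of _ "incl_S (a i)"]) (simp_all add: S_eval_incl incl_closed coordinate_value_var)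
  qed
qed (simp_all add: unital_homD[OF coordinate_value_hom])

lemma coordinate_tensor_hom:
  "\<exists>\<theta>\<in>ring_hom (poly_algebra ((*) :: 'k \<Rightarrow> 'k \<Rightarrow> 'k)) S.T.
    \<forall>q. \<forall>\<sigma>\<in>carrier G. ev_S \<sigma> (\<theta> q) = coordinate_value \<sigma> q"
proof -
  have "\<exists>\<theta>\<in>ring_hom (poly_algebra ((*) :: 'k \<Rightarrow> 'k \<Rightarrow> 'k)) S.T.
    \<forall>q\<in>carrier (poly_algebra ((*) :: 'k \<Rightarrow> 'k \<Rightarrow> 'k)). \<forall>\<sigma>\<in>carrier G. ev_S \<sigma> (\<theta> q) = coordinate_value \<sigma> q"
  proof (rule S.hom_from_values)
    show "cring (poly_algebra ((*) :: 'k \<Rightarrow> 'k \<Rightarrow> 'k) :: (_, ('m + 'n, 'k) mpoly) module)"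
      unfolding poly_algebra_def by (rule cring_type_algebra)
    fix \<sigma> show "coordinate_value \<sigma> \<in> ring_hom (poly_algebra ((*) :: 'k \<Rightarrow> 'k \<Rightarrow> 'k)) SS"
      by (rule ring_hom_memI) (simp_all add: poly_algebra_def unital_homD[OF coordinate_value_hom])
  qed (rule coordinate_tensor_exists)
  then show ?thesis by (simp add: poly_algebra_def)
qed

lemma R_tensor_coordinates:
  assumes "t \<in> carrier R.T"
  shows "\<exists>q. \<forall>\<sigma>\<in>carrier G. ev_R \<sigma> t = coordinate_value \<sigma> q"
  using assms
proof (induction t rule: R.tensor_induct)
  case zero
  have "ev_R \<sigma> \<zero>\<^bsub>R.T\<^esub> = 0" if "\<sigma> \<in> carrier G" for \<sigma>
    using R.eval_constants(1)[OF that] by simp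
  then show ?case by (intro exI[of _ 0]) (simp add: unital_homD[OF coordinate_value_hom])
next
  case (pure h b)
  obtain f where f: "\<forall>\<sigma>\<in>carrier G. h \<sigma> = poly_value \<sigma> f"
    using pure(1) by (auto simp: coordinate_ring_simps regular_on_iff poly_value_def)
  obtain f' where f': "b = eval_poly emb a f'" using pure(2) by (auto simp: C_def)
  show ?case
  proof (intro exI ballI)
    fix \<sigma> assume \<sigma>: "\<sigma> \<in> carrier G"
    show "ev_R \<sigma> (R.pure h b) = coordinate_value \<sigma>
      (eval_poly mconst (\<lambda>j. mvar (Inl j)) f * eval_poly mconst (\<lambda>i. mvar (Inr i)) f')"
      using R.eval_pure[OF \<sigma> pure] f f' \<sigma> scl_eq[of "h \<sigma>" b]
      by (simp add: unital_homD(3)[OF coordinate_value_hom] coordinate_value_lift)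
  qed
next
  case (diff s t)
  then obtain p q where pq: "\<forall>\<sigma>\<in>carrier G. ev_R \<sigma> s = coordinate_value \<sigma> p"
    "\<forall>\<sigma>\<in>carrier G. ev_R \<sigma> t = coordinate_value \<sigma> q" by blast
  have minus: "x \<ominus>\<^bsub>RR\<^esub> y = x - y" if "y \<in> C" for x y
  proof -
    have "\<ominus>\<^bsub>RR\<^esub> y = - y"
      by (rule R.B.minus_equality) (use that subring_set_closed[OF C_subring] in auto)
    then show ?thesis by (simp add: a_minus_def)
  qed
  have "ev_R \<sigma> (s \<ominus>\<^bsub>R.T\<^esub> t) = coordinate_value \<sigma> (p - q)" if \<sigma>: "\<sigma> \<in> carrier G" for \<sigma>
    using R.eval_simps(4)[OF \<sigma> diff(1,2)] R.eval_simps(1)[OF \<sigma> diff(2,2)] pq \<sigma>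
    by (simp add: minus unital_homD[OF coordinate_value_hom])
  then show ?case by blast
qed

lemma orbit_point_coordinates: "\<exists>q. \<forall>\<sigma>\<in>carrier G. orbit_point \<sigma> i = coordinate_value \<sigma> q"
  using R_tensor_coordinates[OF g_closed[of i]] g_values[of _ i] by (simp add: orbit_point_def R_eq)

lemma C_noetherian: "noetherian_set C"
proof -
  obtain vs where vs: "set vs = (UNIV :: 'n set)" using finite_list[OF finite_UNIV] by blast
  let ?A = "adjoin_list (range emb) (map a vs)"
  have sub: "subring_set (range emb)" by (rule subring_image[OF subring_set_UNIV]) (simp_all add: emb_simps)
  note A_sub = subring_adjoin_list[OF sub, of "map a vs"]
  have "?A \<subseteq> C" by (rule adjoin_list_least[OF C_subring]) (use emb_C a_C in auto)
  moreover have "C \<subseteq> ?A"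
  proof
    have a_in: "a i \<in> ?A" for i using gens_in_adjoin_list[OF sub, of "map a vs"] vs by auto
    have emb_in: "emb c \<in> ?A" for c using subset_adjoin_list[OF sub, of "map a vs"] by auto
    fix x assume "x \<in> C"
    then obtain f where "x = eval_poly emb a f" by (auto simp: C_def)
    then show "x \<in> ?A" unfolding eval_poly_def
      by (auto intro!: subring_set_sum[OF A_sub] subring_set_closed(6,7)[OF A_sub] subring_set_prod[OF A_sub]
          a_in emb_in)
  qed
  ultimately show ?thesis
    using noetherian_adjoin_list[OF noetherian_field_image[OF emb_hom] sub, of "map a vs"] by simp
qed

context
  fixes fs :: "('n, 'k) mpoly list"
  assumes nil: "\<And>r. r \<in> C \<Longrightarrow> incl_S r \<in> J fs \<Longrightarrow> \<exists>k::nat. r ^ k = 0"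
begin

lemma E_proper: "E fs \<noteq> UNIV"
proof
  assume "E fs = UNIV"
  then have "\<rho> (incl_P 1) \<in> J fs" using E_iff[of 1 fs] by auto
  then have "incl_S 1 \<in> J fs"
    using ring_hom_one[OF \<rho>_hom] by (simp add: incl_one)
  then have "\<exists>k::nat. (1::'s) ^ k = 0" by (intro nil subring_set_closed(2)[OF C_subring])
  then show False by simp
qed

lemma E_extended: "extended_derksen_ideal G scl act a (E fs)"
  unfolding extended_derksen_ideal_def using E_ideal E_proper E_stable derksen_subset_E by blast

text \<open>
  The ideal \<open>I = {f(a\<^sub>1, \<dots>, a\<^sub>n) | f \<in> K[y\<^sub>1, \<dots>, y\<^sub>n] \<inter> E}\<close> and the intersection of its conjugates.
\<close>

abbreviation "values \<equiv> {eval_poly emb a f | f. poly_embed scl f \<in> E fs}"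
abbreviation "conj_values \<equiv> \<Inter>\<sigma>\<in>carrier G. act \<sigma> ` values"

lemma E_in: "ideal_in UNIV (E fs)"
  using E_ideal[of fs] by (simp add: poly_algebra_def ideal_type_algebra_iff)

lemma embed_simps:
  "poly_embed scl (f + f') = (poly_embed scl f + poly_embed scl f' :: ('n, 's) mpoly)"
  "poly_embed scl (f * f') = (poly_embed scl f * poly_embed scl f' :: ('n, 's) mpoly)"
  "poly_embed scl 0 = (0 :: ('n, 's) mpoly)"
  using unital_homD[OF map_coeffs_hom(1)[OF emb_hom]] by (simp_all add: poly_embed_eq)

lemma values_ideal: "ideal_in C values"
  unfolding ideal_in_def
proof (intro conjI ballI)
  show "values \<subseteq> C" by (auto simp: C_def)
  show "0 \<in> values" using ideal_inD(2)[OF E_in] embed_simps(3) emb_eval_simps(4)[of a] by force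
  fix x assume "x \<in> values"
  then obtain f where f: "x = eval_poly emb a f" "poly_embed scl f \<in> E fs" by blast
  { fix y assume "y \<in> values"
    then obtain f' where f': "y = eval_poly emb a f'" "poly_embed scl f' \<in> E fs" by blast
    have "poly_embed scl (f + f') \<in> E fs"
      unfolding embed_simps(1) by (rule ideal_inD(3)[OF E_in f(2) f'(2)])
    moreover have "x + y = eval_poly emb a (f + f')" by (simp add: f f' emb_eval_simps)
    ultimately show "x + y \<in> values" by blast }
  { fix b assume "b \<in> C"
    then obtain f' where f': "b = eval_poly emb a f'" by (auto simp: C_def)
    have "poly_embed scl (f' * f) \<in> E fs"
      unfolding embed_simps(2) by (rule ideal_inD(4)[OF E_in UNIV_I f(2)])
    moreover have "b * x = eval_poly emb a (f' * f)" by (simp add: f f' emb_eval_simps)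
    ultimately show "b * x \<in> values" by blast }
qed

lemma conj_ideal: "ideal_in C conj_values"
  unfolding ideal_in_def
proof (intro conjI ballI)
  note v_closed = ideal_inD[OF values_ideal]
  have "conj_values \<subseteq> act \<one>\<^bsub>G\<^esub> ` values" by blast
  also have "act \<one>\<^bsub>G\<^esub> ` values = values" by (simp add: act_one)
  finally show "conj_values \<subseteq> C" using v_closed(1) by blast
  have mem: "x \<in> act \<sigma> ` values \<longleftrightarrow> act (inv\<^bsub>G\<^esub> \<sigma>) x \<in> values" if "\<sigma> \<in> carrier G" for \<sigma> x
    using act_inv[OF that] by (metis (no_types, lifting) imageE imageI)
  note h = unital_homD[OF act_hom[OF G.inv_closed]]
  show "0 \<in> conj_values" using mem[of _ 0] v_closed(2) h(4) by auto
  fix x assume x: "x \<in> conj_values"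
  show "x + y \<in> conj_values" if y: "y \<in> conj_values" for y
  proof
    fix \<sigma> assume \<sigma>: "\<sigma> \<in> carrier G"
    then have "act (inv\<^bsub>G\<^esub> \<sigma>) x \<in> values" "act (inv\<^bsub>G\<^esub> \<sigma>) y \<in> values"
      using x y mem[OF \<sigma>, of x] mem[OF \<sigma>, of y] by blast+
    then have "act (inv\<^bsub>G\<^esub> \<sigma>) (x + y) \<in> values" unfolding h(2)[OF \<sigma>] by (rule v_closed(3))
    then show "x + y \<in> act \<sigma> ` values" using mem[OF \<sigma>, of "x + y"] by blast
  qed
  show "b * x \<in> conj_values" if b: "b \<in> C" for b
  proof
    fix \<sigma> assume \<sigma>: "\<sigma> \<in> carrier G"
    then have "act (inv\<^bsub>G\<^esub> \<sigma>) x \<in> values" using x mem[OF \<sigma>, of x] by blast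
    then have "act (inv\<^bsub>G\<^esub> \<sigma>) (b * x) \<in> values"
      unfolding h(3)[OF \<sigma>] by (rule v_closed(4)[OF act_C[OF G.inv_closed[OF \<sigma>] b]])
    then show "b * x \<in> act \<sigma> ` values" using mem[OF \<sigma>, of "b * x"] by blast
  qed
qed

text \<open>
  Let \<open>Q\<close> be the ideal of polynomials in the coordinates of \<open>G\<close> and in the \<open>y\<^sub>i\<close> whose image in
  \<open>K[G] \<otimes> S\<close> lies in \<open>J\<close>.  If no power of a representative \<open>h0\<close> of \<open>r\<close> were in \<open>Q\<close>, there would be a zero
  \<open>(\<sigma>, \<eta>)\<close> of \<open>Q\<close> with \<open>h0(\<eta>) \<noteq> 0\<close>.  Here \<open>\<sigma> \<in> G\<close>, and \<open>\<eta>\<close> satisfies the relations of the \<open>a\<^sub>i\<close>.  As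
  \<open>r = \<sigma>\<^sup>-\<^sup>1 p(a)\<close> with \<open>p \<in> E\<close>, the polynomial \<open>h0\<close> agrees with \<open>p(g)\<close> at \<open>(\<sigma>, a)\<close>, hence also at \<open>(\<sigma>, \<eta>)\<close>,
  where \<open>p(g) \<in> Q\<close> vanishes.
\<close>

lemma conj_nil:
  assumes r: "r \<in> conj_values"
  shows "\<exists>k::nat. r ^ k = 0"
proof -
  obtain \<theta> where \<theta>: "\<theta> \<in> ring_hom (poly_algebra ((*) :: 'k \<Rightarrow> 'k \<Rightarrow> 'k)) S.T"
    "\<And>q \<sigma>. \<sigma> \<in> carrier G \<Longrightarrow> ev_S \<sigma> (\<theta> q) = coordinate_value \<sigma> q"
    using coordinate_tensor_hom by blast
  have \<theta>_closed: "\<theta> q \<in> carrier S.T" for q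
    by (rule ring_hom_closed[OF \<theta>(1)]) (simp add: poly_algebra_def)
  let ?Q = "{q. \<theta> q \<in> J fs}"
  have "ring (poly_algebra ((*) :: 'k \<Rightarrow> 'k \<Rightarrow> 'k) :: (_, ('m + 'n, 'k) mpoly) module)"
    unfolding poly_algebra_def by (rule type_algebra.ring_axioms)
  from ring_hom_ring.ideal_vimage[OF ring_hom_ringI2[OF this S.T.ring_axioms \<theta>(1)] J_ideal[of fs]]
  have Q: "ideal_in UNIV ?Q" by (simp add: poly_algebra_def ideal_type_algebra_iff)
  have in_Q: "q \<in> ?Q" if t: "t \<in> J fs" "\<And>\<sigma>. \<sigma> \<in> carrier G \<Longrightarrow> ev_S \<sigma> t = coordinate_value \<sigma> q" for q t
  proof -
    have "\<theta> q = t" using t \<theta>(2) ideal.Icarr[OF J_ideal t(1)] by (intro S.tensor_eqI[OF \<theta>_closed]) auto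
    then show ?thesis using t(1) by simp
  qed
  have vanishing_in_Q: "q \<in> ?Q" if "\<And>\<sigma>. \<sigma> \<in> carrier G \<Longrightarrow> coordinate_value \<sigma> q = 0" for q
    by (rule in_Q[of "\<zero>\<^bsub>S.T\<^esub>"])
      (simp_all add: that S_eval_constants additive_subgroup.zero_closed[OF ideal.axioms(1)[OF J_ideal]])
  have "r \<in> C" using r ideal_inD(1)[OF conj_ideal] by blast
  then obtain h0 where h0: "r = eval_poly emb a h0" by (auto simp: C_def)
  let ?inr = "eval_poly mconst (\<lambda>i. mvar (Inr i)) :: ('n, 'k) mpoly \<Rightarrow> ('m + 'n, 'k) mpoly"
  have "\<exists>N::nat. ?inr h0 ^ N \<in> ?Q"
  proof (rule ccontr)
    assume "\<not> ?thesis"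
    then obtain x where x: "\<And>q. q \<in> ?Q \<Longrightarrow> poly_value x q = 0" "poly_value x (?inr h0) \<noteq> 0"
      using nullstellensatz[OF Q, of "?inr h0"] unfolding poly_value_def by blast
    define \<sigma> where "\<sigma> = (\<lambda>j. x (Inl j))"
    define \<eta> where "\<eta> = (\<lambda>i. x (Inr i))"
    have value_inr: "poly_value x (?inr f) = poly_value \<eta> f" for f
      unfolding \<eta>_def by (rule value_lift)
    obtain F where F: "carrier G = {y. \<forall>f\<in>F. poly_value y f = 0}"
      using linear_group unfolding linear_algebraic_group_def zariski_closed_def poly_eval_base_field poly_value_def
      by blast
    have \<sigma>: "\<sigma> \<in> carrier G"
      unfolding F
    proof (intro CollectI ballI)
      fix f assume f: "f \<in> F"
      have "eval_poly mconst (\<lambda>j. mvar (Inl j)) f \<in> ?Q"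
        by (rule vanishing_in_Q) (use f F in \<open>simp add: coordinate_value_lift emb_simps\<close>)
      from x(1)[OF this] show "poly_value \<sigma> f = 0" unfolding value_lift \<sigma>_def .
    qed
    have relations: "poly_value \<eta> f = 0" if "eval_poly emb a f = 0" for f
      using x(1)[OF vanishing_in_Q[of "?inr f"]] that by (simp add: coordinate_value_lift value_inr)
    have "r \<in> act (inv\<^bsub>G\<^esub> \<sigma>) ` values" using r G.inv_closed[OF \<sigma>] by blast
    then obtain p where p: "poly_embed scl p \<in> E fs" "r = act (inv\<^bsub>G\<^esub> \<sigma>) (eval_poly emb a p)" by blast
    have rp: "r = eval_poly emb (orbit_point \<sigma>) p"
      unfolding p(2) act_eval[OF G.inv_closed[OF \<sigma>]] orbit_point_def ..
    \<comment> \<open>Polynomials in the coordinates of the group and the \<open>y\<^sub>i\<close> that represent the \<open>g\<^sub>i\<close>.\<close>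
    obtain gh where gh: "\<And>i \<tau>. \<tau> \<in> carrier G \<Longrightarrow> orbit_point \<tau> i = coordinate_value \<tau> (gh i)"
      using orbit_point_coordinates by metis
    let ?pg = "eval_poly mconst gh p"
    have pg: "coordinate_value \<tau> ?pg = eval_poly emb (orbit_point \<tau>) p" if "\<tau> \<in> carrier G" for \<tau>
    proof -
      have "(\<lambda>i. coordinate_value \<tau> (gh i)) = orbit_point \<tau>" using gh[OF that] by auto
      then show ?thesis unfolding coordinate_value_def eval_poly_substitute[OF emb_hom] by simp
    qed
    have "?pg \<in> ?Q"
    proof (rule in_Q)
      show "\<rho> (incl_P (poly_embed scl p)) \<in> J fs" using p(1) by (simp add: E_iff)
      fix \<tau> assume "\<tau> \<in> carrier G"
      then show "ev_S \<tau> (\<rho> (incl_P (poly_embed scl p))) = coordinate_value \<tau> ?pg"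
        by (simp add: \<rho>_incl_eval pg poly_embed_eq poly_value_map_coeffs[OF emb_hom])
    qed
    then have pg0: "poly_value x ?pg = 0" by (rule x(1))
    \<comment> \<open>Specialising the coordinates of the group to \<open>\<sigma>\<close> turns \<open>p(g)\<close> into a polynomial in the \<open>y\<^sub>i\<close> alone.\<close>
    define u where "u = eval_poly mconst (case_sum (\<lambda>j. mconst (\<sigma> j)) mvar) ?pg"
    have "eval_poly emb a u = coordinate_value \<sigma> ?pg"
    proof -
      have "(\<lambda>v. eval_poly emb a (case_sum (\<lambda>j. mconst (\<sigma> j)) mvar v)) = case_sum (\<lambda>j. emb (\<sigma> j)) a"
        by (intro ext) (simp add: emb_eval split: sum.split)
      then show ?thesis unfolding u_def coordinate_value_def
        by (subst (1) eval_poly_substitute[OF emb_hom]) simp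
    qed
    then have "eval_poly emb a (h0 - u) = 0" using pg[OF \<sigma>] rp h0 by (simp add: emb_eval_simps)
    from relations[OF this] have "poly_value \<eta> h0 = poly_value \<eta> u"
      by (simp add: unital_homD[OF poly_value_hom(1)])
    also have "poly_value \<eta> u = poly_value x ?pg"
    proof -
      have "(\<lambda>v. poly_value \<eta> (case_sum (\<lambda>j. mconst (\<sigma> j)) mvar v)) = x"
        by (intro ext) (simp add: poly_value_hom \<sigma>_def \<eta>_def split: sum.split)
      then show ?thesis unfolding u_def poly_value_def
        by (subst (1) eval_poly_substitute[OF unital_hom_id]) simp
    qed
    finally show False using x(2) pg0 value_inr by simp
  qed
  then obtain N :: nat where N: "\<theta> (?inr h0 ^ N) \<in> J fs" by blast
  have "\<theta> (?inr h0 ^ N) = incl_S (r ^ N)"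
    by (rule S.tensor_eqI)
      (simp_all add: \<theta>_closed incl_closed \<theta>(2) S_eval_incl unital_homD(7)[OF coordinate_value_hom]
        coordinate_value_lift h0)
  then have "\<exists>k::nat. (r ^ N) ^ k = 0"
    using N \<open>r \<in> C\<close> by (intro nil subring_set_closed(7)[OF C_subring]) simp_all
  then show ?thesis by (metis power_mult)
qed

lemma E_tamely_extended: "tamely_extended_derksen_ideal G scl act a (E fs)"
proof -
  obtain k where "\<And>xs. length xs = k \<Longrightarrow> set xs \<subseteq> conj_values \<Longrightarrow> prod_list xs = 0"
    using nil_ideal_product_zero[OF C_noetherian C_subring conj_ideal conj_nil] by blast
  then have "nilpotent_ideal RR conj_values" by (rule nilpotent_ideal_power[OF C_subring conj_ideal])
  then show ?thesis
    using E_extended by (simp add: tamely_extended_derksen_ideal_def Let_def R_eq poly_eval_S)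
qed

end

end

theorem theorem5p1:
  fixes G :: "('m::finite \<Rightarrow> 'k::alg_closed_field) monoid"
    and scl :: "'k \<Rightarrow> 's \<Rightarrow> 's::comm_ring_1"
    and act :: "('m \<Rightarrow> 'k) \<Rightarrow> 's \<Rightarrow> 's"
    and a :: "'n::finite \<Rightarrow> 's"
    and g :: "'n \<Rightarrow> ((('m \<Rightarrow> 'k) \<Rightarrow> 'k) \<times> 's \<Rightarrow>\<^sub>0 int) set"
  assumes "linear_algebraic_group G"
    and "algebra base_field (type_algebra scl)"
    and "acts_by_automorphisms G scl act"
    and "\<And>i. g i \<in> carrier (coord_tensor G (gen_subalgebra (type_algebra scl) a))"
    and "\<And>\<sigma> i. \<sigma> \<in> carrier G \<Longrightarrow>
           act (inv\<^bsub>G\<^esub> \<sigma>) (a i) = coord_eval (gen_subalgebra (type_algebra scl) a) \<sigma> (g i)"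
  shows "derksen_ideal G scl act a = elimination_ideal G scl (derksen_hat G scl g)
    \<and> (\<forall>fs :: ('n, 'k) mpoly list.
         {r \<in> carrier (gen_subalgebra (type_algebra scl) a).
            coord_incl G (type_algebra scl) r \<in> substituted_ideal G scl g fs}
           \<subseteq> {r. \<exists>k::nat. r ^ k = 0}
         \<longrightarrow> tamely_extended_derksen_ideal G scl act a
               (elimination_ideal G scl (extended_hat G scl g fs)))"
proof -
  interpret derksen_setup G scl act a g by (rule derksen_setup.intro) fact+
  show ?thesis
  proof (intro conjI allI impI)
    show "derksen_ideal G scl act a = elimination_ideal G scl (derksen_hat G scl g)"
      by (rule derksen_elimination)
    fix fs :: "('n, 'k) mpoly list"
    assume "{r \<in> carrier (gen_subalgebra (type_algebra scl) a).
            coord_incl G (type_algebra scl) r \<in> substituted_ideal G scl g fs}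
           \<subseteq> {r. \<exists>k::nat. r ^ k = 0}"
    then have "\<exists>k::nat. r ^ k = 0"
      if "r \<in> C" "coord_incl G (type_algebra scl) r \<in> substituted_ideal G scl g fs" for r
      using that by (auto simp: R_eq)
    then show "tamely_extended_derksen_ideal G scl act a (elimination_ideal G scl (extended_hat G scl g fs))"
      by (rule E_tamely_extended)
  qed
qed

end
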